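(* Let $d$ be a positive integer and let $(R,\mathfrak m,k)$ be a $d$-dimensional regular local ring with maximal ideal $\mathfrak m$ and infinite residue field $k$. Let $I$ be an $\mathfrak m$-primary ideal of $R$, let $x\in\mathfrak m\setminus\mathfrak m^2$ be such that $xV=\mathfrak mV$ for each $V\in\operatorname{Rees}I$, let $S_1=R[\frac{\mathfrak m}{x}]$, let $r=\operatorname{ord}_RI$, and let $I_1$ be the transform of $I$ in $S_1$, so that $IS_1=x^rI_1$. Let $V\in\operatorname{Rees} I$, with corresponding Rees valuation $v$ (having value group $\mathbb Z$). Then: (1) If $I_1=S_1$, then $v=\operatorname{ord}_R$ and $\operatorname{ord}_R$ is the unique Rees valuation of $I$. (2) If $I_1\ne S_1$ and $v\ne\operatorname{ord}_R$, then $V\in\operatorname{Rees}_{S_1}I_1$. (3) In general, $\operatorname{Rees}I\subseteq\operatorname{Rees}_{S_1}I_1\cup\operatorname{Rees}\mathfrak m$.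
   Context: Order: for an ideal $I$ of a regular local ring $(R,\mathfrak m)$, $\operatorname{ord}_RI=r$ if $I\subseteq\mathfrak m^r$ and $I\not\subseteq\mathfrak m^{r+1}$. The function $a\mapsto\operatorname{ord}_R(aR)$ extends to a discrete rank-one valuation $\operatorname{ord}_R$ on the fraction field of $R$; its valuation ring is the order valuation ring of $R$. Rees valuations: for a nonzero ideal $I$ of a Noetherian domain $R$, $\operatorname{Rees}I=\operatorname{Rees}_RI$ is the set of DVRs $\big(\overline{R[I/a]}\big)_Q$, where $0\ne a\in I$, the bar is integral closure in the fraction field, and $Q$ is a height-one prime of $\overline{R[I/a]}$ with $I\subset Q$. The corresponding valuations with value group $\mathbb Z$ are the Rees valuations of $I$. Since $k$ is infinite and $\operatorname{Rees}I$ is finite, an element $x$ as required exists. The ring $S_1$ is a regular UFD. The transform of an ideal $I$ of a UFD $R$ (with $I$ not contained in any proper principal ideal) in a UFD $S\supseteq R$ with the same field of fractions is $a^{-1}IS$, where $aS$ is the smallest principal ideal of $S$ containing $IS$; in the present case $a=x^r$. *)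

theory Defs
  imports "HOL-Algebra.Algebra" "HOL-Library.Extended_Nat"
begin

text \<open>
  All rings in play share one field of fractions, so they are given as subrings of a fixed field
  \<open>K\<close>: a subring is a set \<open>A \<subseteq> carrier K\<close>, and \<open>K\<lparr>carrier := A\<rparr>\<close> is the corresponding ring.
\<close>

definition fraction_field_of :: "('a, 'b) ring_scheme \<Rightarrow> 'a set \<Rightarrow> bool" where
  "fraction_field_of K A \<longleftrightarrow>
     field K \<and> subring A K \<and>
     carrier K = {a \<otimes>\<^bsub>K\<^esub> inv\<^bsub>K\<^esub> b | a b. a \<in> A \<and> b \<in> A - {\<zero>\<^bsub>K\<^esub>}}"

section \<open>Dimension and regular local rings\<close>

definition prime_chain :: "('a, 'b) ring_scheme \<Rightarrow> (nat \<Rightarrow> 'a set) \<Rightarrow> nat \<Rightarrow> bool" where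
  "prime_chain A P n \<longleftrightarrow> (\<forall>i\<le>n. primeideal (P i) A) \<and> (\<forall>i<n. P i \<subset> P (Suc i))"

definition krull_dim :: "('a, 'b) ring_scheme \<Rightarrow> enat" where
  "krull_dim A = Sup {enat n | n. \<exists>P. prime_chain A P n}"

definition prime_height :: "('a, 'b) ring_scheme \<Rightarrow> 'a set \<Rightarrow> enat" where
  "prime_height A Q = Sup {enat n | n. \<exists>P. prime_chain A P n \<and> P n = Q}"

definition local_ring :: "('a, 'b) ring_scheme \<Rightarrow> 'a set \<Rightarrow> bool" where
  "local_ring A m \<longleftrightarrow> cring A \<and> (\<forall>M. maximalideal M A \<longleftrightarrow> M = m)"

definition regular_local_ring :: "('a, 'b) ring_scheme \<Rightarrow> 'a set \<Rightarrow> nat \<Rightarrow> bool" where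
  "regular_local_ring A m d \<longleftrightarrow>
     local_ring A m \<and> noetherian_ring A \<and> krull_dim A = enat d \<and>
     (\<exists>G. G \<subseteq> carrier A \<and> finite G \<and> card G = d \<and> m = Idl\<^bsub>A\<^esub> G)"

definition radical :: "('a, 'b) ring_scheme \<Rightarrow> 'a set \<Rightarrow> 'a set" where
  "radical A I = {a \<in> carrier A. \<exists>n::nat. a [^]\<^bsub>A\<^esub> n \<in> I}"

definition primary_to :: "('a, 'b) ring_scheme \<Rightarrow> 'a set \<Rightarrow> 'a set \<Rightarrow> bool" where
  "primary_to A P I \<longleftrightarrow>
     ideal I A \<and> I \<noteq> carrier A \<and>
     (\<forall>a\<in>carrier A. \<forall>b\<in>carrier A. a \<otimes>\<^bsub>A\<^esub> b \<in> I \<longrightarrow> a \<in> I \<or> b \<in> radical A I) \<and>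
     radical A I = P"

section \<open>Valuations\<close>

text \<open>The condition defining \<open>ideal_order\<close> determines \<open>r\<close> when it is satisfiable, since the
  powers of \<open>m\<close> decrease.\<close>

definition ideal_order :: "('a, 'b) ring_scheme \<Rightarrow> 'a set \<Rightarrow> 'a set \<Rightarrow> nat" where
  "ideal_order A m I =
     (THE r. I \<subseteq> m [^]\<^bsub>ideals_set A\<^esub> r \<and> \<not> I \<subseteq> m [^]\<^bsub>ideals_set A\<^esub> (Suc r))"

text \<open>Valuations are functions on the nonzero elements of \<open>K\<close>, so that no value \<open>\<infinity>\<close> is needed;
  they are \<open>undefined\<close> elsewhere, so that equality of valuations is equality of functions.\<close>

definition order_valuation :: "('a, 'b) ring_scheme \<Rightarrow> 'a set \<Rightarrow> 'a set \<Rightarrow> 'a \<Rightarrow> int" where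
  "order_valuation K R m =
     (\<lambda>z \<in> carrier (mult_of K). THE n. \<exists>a \<in> R - {\<zero>\<^bsub>K\<^esub>}. \<exists>b \<in> R - {\<zero>\<^bsub>K\<^esub>}.
        z = a \<otimes>\<^bsub>K\<^esub> inv\<^bsub>K\<^esub> b \<and>
        n = int (ideal_order (K\<lparr>carrier := R\<rparr>) m (PIdl\<^bsub>K\<lparr>carrier := R\<rparr>\<^esub> a))
          - int (ideal_order (K\<lparr>carrier := R\<rparr>) m (PIdl\<^bsub>K\<lparr>carrier := R\<rparr>\<^esub> b)))"

text \<open>Discrete valuations whose value group is all of \<open>\<int>\<close> (hence \<open>epi\<close>).\<close>

definition normalized_valuation :: "('a, 'b) ring_scheme \<Rightarrow> ('a \<Rightarrow> int) \<Rightarrow> bool" where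
  "normalized_valuation K v \<longleftrightarrow>
     v \<in> extensional (carrier (mult_of K)) \<and>
     v \<in> epi (mult_of K) integer_group \<and>
     (\<forall>a \<in> carrier (mult_of K). \<forall>b \<in> carrier (mult_of K).
        a \<oplus>\<^bsub>K\<^esub> b \<noteq> \<zero>\<^bsub>K\<^esub> \<longrightarrow> min (v a) (v b) \<le> v (a \<oplus>\<^bsub>K\<^esub> b))"

definition valuation_ring :: "('a, 'b) ring_scheme \<Rightarrow> ('a \<Rightarrow> int) \<Rightarrow> 'a set" where
  "valuation_ring K v = {a \<in> carrier K. a = \<zero>\<^bsub>K\<^esub> \<or> 0 \<le> v a}"

definition dvr :: "('a, 'b) ring_scheme \<Rightarrow> bool" where
  "dvr A \<longleftrightarrow> principal_domain A \<and> (\<exists>m. local_ring A m) \<and> \<not> field A"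

section \<open>Rees valuation rings\<close>

text \<open>\<open>blowup_chart K A I a\<close> is \<open>A[I/a]\<close>.\<close>

definition blowup_chart :: "('a, 'b) ring_scheme \<Rightarrow> 'a set \<Rightarrow> 'a set \<Rightarrow> 'a \<Rightarrow> 'a set" where
  "blowup_chart K A I a = generate_ring K (A \<union> {i \<otimes>\<^bsub>K\<^esub> inv\<^bsub>K\<^esub> a | i. i \<in> I})"

definition integral_closure :: "('a, 'b) ring_scheme \<Rightarrow> 'a set \<Rightarrow> 'a set" where
  "integral_closure K A =
     {z \<in> carrier K. \<exists>p. polynomial\<^bsub>K\<^esub> A p \<and> p \<noteq> [] \<and> lead_coeff p = \<one>\<^bsub>K\<^esub> \<and>
        ring.eval K p z = \<zero>\<^bsub>K\<^esub>}"

definition localization_at :: "('a, 'b) ring_scheme \<Rightarrow> 'a set \<Rightarrow> 'a set \<Rightarrow> 'a set" where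
  "localization_at K A Q = {a \<otimes>\<^bsub>K\<^esub> inv\<^bsub>K\<^esub> b | a b. a \<in> A \<and> b \<in> A - Q}"

text \<open>For a nonzero ideal \<open>I\<close> of a Noetherian domain \<open>A\<close>, the localizations below are
  automatically discrete valuation rings, by the Mori--Nagata theorem.\<close>

definition Rees :: "('a, 'b) ring_scheme \<Rightarrow> 'a set \<Rightarrow> 'a set \<Rightarrow> 'a set set" where
  "Rees K A I = {V. dvr (K\<lparr>carrier := V\<rparr>) \<and>
     (\<exists>a \<in> I - {\<zero>\<^bsub>K\<^esub>}. \<exists>C Q.
        C = integral_closure K (blowup_chart K A I a) \<and>
        primeideal Q (K\<lparr>carrier := C\<rparr>) \<and> prime_height (K\<lparr>carrier := C\<rparr>) Q = 1 \<and>
        I \<subseteq> Q \<and> V = localization_at K C Q)}"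

definition Rees_valuations :: "('a, 'b) ring_scheme \<Rightarrow> 'a set \<Rightarrow> 'a set \<Rightarrow> ('a \<Rightarrow> int) set" where
  "Rees_valuations K A I = {v. normalized_valuation K v \<and> valuation_ring K v \<in> Rees K A I}"

section \<open>Transforms\<close>

text \<open>The transform \<open>a\<^sup>-\<^sup>1IS\<close>, where \<open>aS\<close> is the smallest principal ideal of \<open>S\<close> containing
  \<open>IS\<close>. It does not depend on the choice of the generator \<open>a\<close> of \<open>aS\<close>, which is determined up to
  a unit of \<open>S\<close>.\<close>

definition ideal_transform :: "('a, 'b) ring_scheme \<Rightarrow> 'a set \<Rightarrow> 'a set \<Rightarrow> 'a set" where
  "ideal_transform K S I =
     (THE J. \<exists>a \<in> S - {\<zero>\<^bsub>K\<^esub>}.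
        Idl\<^bsub>K\<lparr>carrier := S\<rparr>\<^esub> I \<subseteq> PIdl\<^bsub>K\<lparr>carrier := S\<rparr>\<^esub> a \<and>
        (\<forall>b \<in> S. Idl\<^bsub>K\<lparr>carrier := S\<rparr>\<^esub> I \<subseteq> PIdl\<^bsub>K\<lparr>carrier := S\<rparr>\<^esub> b \<longrightarrow>
                 PIdl\<^bsub>K\<lparr>carrier := S\<rparr>\<^esub> a \<subseteq> PIdl\<^bsub>K\<lparr>carrier := S\<rparr>\<^esub> b) \<and>
        J = {inv\<^bsub>K\<^esub> a \<otimes>\<^bsub>K\<^esub> z | z. z \<in> Idl\<^bsub>K\<lparr>carrier := S\<rparr>\<^esub> I})"

end

theory Submission
  imports Defs
begin

text \<open>
  The order function of \<open>R\<close> is a valuation: two forms over the infinite residue field that do not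
  vanish have a common nonzero point, so the product of two elements survives modulo a suitable line,
  and the height theorem says that no power of the maximal ideal lies in an ideal with fewer
  generators than the dimension. The same argument modulo part of a regular system of parameters
  shows that \<open>R/(x\<^sub>1, \<dots>, x\<^sub>i)\<close> is a domain, and complete integral closedness lifts
  from \<open>R/(x\<^sub>1, \<dots>, x\<^sub>i\<^sub>+\<^sub>1)\<close> to \<open>R/(x\<^sub>1, \<dots>, x\<^sub>i)\<close>, so \<open>R\<close> is normal. The chart
  \<open>S = R[m/x]\<close> is the intersection of \<open>R[1/x]\<close> with the order valuation ring; hence it is normal, and
  \<open>x\<close> generates the center of the order valuation on it, which gives \<open>IS = x\<^sup>r I\<^sub>1\<close>. Finally, a Rees
  valuation ring \<open>W\<close> of \<open>I\<close> contains \<open>S\<close>, and \<open>IW = aW\<close>. If \<open>I\<^sub>1\<close> lies in the maximal ideal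
  of \<open>W\<close>, the chart \<open>S[I\<^sub>1/(a/x\<^sup>r)]\<close> exhibits \<open>W\<close> as a Rees valuation ring of \<open>I\<^sub>1\<close>. If not, \<open>R[I/a]\<close>
  lies in the localisation of \<open>S\<close> at the center of \<open>W\<close>, and \<open>W\<close> is the order valuation ring.
\<close>

section \<open>Noetherian rings relative to a prime ideal\<close>

text \<open>Arguments about a quotient R/J or a localisation R_P are carried out inside R, with the
  ideals \<open>adj J y\<close>, the congruences \<open>cg J\<close> and ideals saturated with
  respect to P, so that passing along a chain of quotients never changes the ring. Complete integral
  closedness is what lifts along the chain: the condition that b^j divides t a^j for all j survives
  cancelling powers of a parameter, and it is trivial in the residue field, where the chain ends.
  That integral elements form a ring comes from Chevalley's argument: an element s that is not
  integral over B lies outside B[1/s], and this ring can be enlarged by elements integral over B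
  without capturing s. The equation xW = mW gives y/x in W for all y in m, which is why S lies in W.
  Height one of a center follows from rank one: W is the localisation of the chart at the center,
  and powers of any nonunit of W become divisible by any given nonzero element, so no prime fits
  strictly between zero and the center.\<close>

lemma (in ring) ideal_carrier: "ideal I R \<Longrightarrow> a \<in> I \<Longrightarrow> a \<in> carrier R"
  by (rule ideal.Icarr)

lemma (in ring) ideal_zero: "ideal I R \<Longrightarrow> \<zero> \<in> I"
  by (simp add: additive_subgroup.zero_closed ideal.axioms(1))

lemma (in ring) ideal_add: "ideal I R \<Longrightarrow> a \<in> I \<Longrightarrow> b \<in> I \<Longrightarrow> a \<oplus> b \<in> I"
  by (simp add: additive_subgroup.a_closed ideal.axioms(1))

lemma (in ring) ideal_neg: "ideal I R \<Longrightarrow> a \<in> I \<Longrightarrow> \<ominus> a \<in> I"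
  by (simp add: additive_subgroup.a_inv_closed ideal.axioms(1))

lemma (in ring) ideal_minus: "ideal I R \<Longrightarrow> a \<in> I \<Longrightarrow> b \<in> I \<Longrightarrow> a \<ominus> b \<in> I"
  unfolding a_minus_def by (simp add: ideal_add ideal_neg)

lemma (in ring) ideal_lmult: "ideal I R \<Longrightarrow> a \<in> I \<Longrightarrow> x \<in> carrier R \<Longrightarrow> x \<otimes> a \<in> I"
  by (rule ideal.I_l_closed)

lemma (in ring) ideal_rmult: "ideal I R \<Longrightarrow> a \<in> I \<Longrightarrow> x \<in> carrier R \<Longrightarrow> a \<otimes> x \<in> I"
  by (rule ideal.I_r_closed)

lemma (in ring) ideal_intro:
  assumes "I \<subseteq> carrier R" "\<zero> \<in> I"
    and "\<And>a b. a \<in> I \<Longrightarrow> b \<in> I \<Longrightarrow> a \<oplus> b \<in> I"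
    and "\<And>a x. a \<in> I \<Longrightarrow> x \<in> carrier R \<Longrightarrow> x \<otimes> a \<in> I"
    and "\<And>a x. a \<in> I \<Longrightarrow> x \<in> carrier R \<Longrightarrow> a \<otimes> x \<in> I"
  shows "ideal I R"
proof (rule idealI[OF ring_axioms])
  show "subgroup I (add_monoid R)"
  proof (rule add.subgroupI)
    show "I \<subseteq> carrier R" by fact
    show "I \<noteq> {}" using assms(2) by blast
    show "\<ominus> a \<in> I" if "a \<in> I" for a
      using assms(4)[OF that, of "\<ominus> \<one>"] that assms(1) by (auto simp: l_minus)
    show "a \<oplus> b \<in> I" if "a \<in> I" "b \<in> I" for a b using assms(3) that by simp
  qed
qed (use assms in auto)

lemma (in cring) ideal_intro_comm:
  assumes "I \<subseteq> carrier R" "\<zero> \<in> I"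
    and "\<And>a b. a \<in> I \<Longrightarrow> b \<in> I \<Longrightarrow> a \<oplus> b \<in> I"
    and "\<And>a x. a \<in> I \<Longrightarrow> x \<in> carrier R \<Longrightarrow> x \<otimes> a \<in> I"
  shows "ideal I R"
  using assms by (intro ideal_intro) (auto simp: m_comm subset_iff)

lemma (in ring) primeideal_D:
  assumes "primeideal P R"
  shows "ideal P R" "\<one> \<notin> P" "P \<subseteq> carrier R"
    "\<And>a b. a \<in> carrier R \<Longrightarrow> b \<in> carrier R \<Longrightarrow> a \<otimes> b \<in> P \<Longrightarrow> a \<in> P \<or> b \<in> P"
proof -
  interpret P: primeideal P R by fact
  show "ideal P R" by (rule P.is_ideal)
  show "\<one> \<notin> P" using P.one_imp_carrier P.I_notcarr by blast
  show "P \<subseteq> carrier R" using P.Icarr by blast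
  show "\<And>a b. a \<in> carrier R \<Longrightarrow> b \<in> carrier R \<Longrightarrow> a \<otimes> b \<in> P \<Longrightarrow> a \<in> P \<or> b \<in> P"
    by (rule P.I_prime)
qed

lemma (in ring) primeideal_pow:
  assumes "primeideal P R" "a \<in> carrier R" "a [^] (n::nat) \<in> P"
  shows "a \<in> P"
  using assms(3)
proof (induction n)
  case 0 then show ?case using primeideal_D(2)[OF assms(1)] by simp
next
  case (Suc n) then show ?case using primeideal_D(4)[OF assms(1), of "a [^] n" a] assms(2) by auto
qed

text \<open>The ideal I + (y) for an ideal I, written elementwise because most uses take the
  coefficient of y apart.\<close>

definition (in ring) adj :: "'a set \<Rightarrow> 'a \<Rightarrow> 'a set" where
  "adj I y = {j \<oplus> c \<otimes> y | j c. j \<in> I \<and> c \<in> carrier R}"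

lemma (in cring) mem_adj:
  assumes "y \<in> carrier R"
  shows "z \<in> adj I y \<longleftrightarrow> (\<exists>j\<in>I. \<exists>c\<in>carrier R. z = j \<oplus> c \<otimes> y)"
  unfolding adj_def by auto

lemma (in cring) mem_adjI:
  "y \<in> carrier R \<Longrightarrow> j \<in> I \<Longrightarrow> c \<in> carrier R \<Longrightarrow> j \<oplus> c \<otimes> y \<in> adj I y"
  by (auto simp: mem_adj)

lemma (in cring) ideal_adj:
  assumes "ideal I R" "y \<in> carrier R" shows "ideal (adj I y) R"
proof -
  have "adj I y = I <+>\<^bsub>R\<^esub> PIdl y" unfolding adj_def set_add_def' cgenideal_def by auto
  then show ?thesis using assms by (auto intro!: add_ideals cgenideal_ideal)
qed

lemma (in cring) subset_adj:
  assumes "ideal I R" "y \<in> carrier R" shows "I \<subseteq> adj I y"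
proof
  fix j assume j: "j \<in> I"
  then have "j = j \<oplus> \<zero> \<otimes> y" using assms by (simp add: ideal_carrier)
  then show "j \<in> adj I y" using j assms(2) mem_adjI[OF assms(2) j zero_closed] by simp
qed

lemma (in cring) self_adj:
  assumes "ideal I R" "y \<in> carrier R" shows "y \<in> adj I y"
proof -
  have "y = \<zero> \<oplus> \<one> \<otimes> y" using assms by simp
  then show ?thesis using ideal_zero[OF assms(1)] assms(2)
    by (metis mem_adj one_closed)
qed

lemma (in cring) adj_minimal:
  assumes "ideal J R" "I \<subseteq> J" "y \<in> J" shows "adj I y \<subseteq> J"
  using assms by (auto simp: mem_adj[OF ideal_carrier[OF assms(1,3)]]
      intro!: ideal_add ideal_lmult)

lemma (in cring) adj_mono:
  assumes "I \<subseteq> J" "y \<in> carrier R" shows "adj I y \<subseteq> adj J y"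
  using assms by (auto simp: adj_def)

section \<open>Noetherian induction, and saturation in place of localisation at a prime\<close>

locale noetherian_cring = noetherian_ring R + cring R for R (structure)

context noetherian_cring
begin

text \<open>A nonempty chain of ideals in a Noetherian ring contains its own union, so Zorn's lemma
  applies to any nonempty family, with no closure condition on it. All Noetherian inductions below
  pass through this.\<close>

lemma ex_maximal_ideal_in:
  assumes "S \<noteq> {}" "\<And>I. I \<in> S \<Longrightarrow> ideal I R"
  obtains M where "M \<in> S" "\<And>I. I \<in> S \<Longrightarrow> M \<subseteq> I \<Longrightarrow> I = M"
proof -
  have "\<exists>M\<in>S. \<forall>Y\<in>S. M \<subseteq> Y \<longrightarrow> Y = M"
  proof (rule subset_Zorn_nonempty[OF assms(1)])
    fix C assume C: "C \<noteq> {}" "subset.chain S C"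
    then have sub: "C \<subseteq> S" by (simp add: subset.chain_def)
    have "subset.chain {I. ideal I R} C"
      using C(2) assms(2) by (auto simp: subset.chain_def)
    from ideal_chain_is_trivial[OF C(1) this] show "\<Union>C \<in> S"
      using sub by (rule subsetD[rotated])
  qed
  then obtain M where "M \<in> S" "\<forall>Y\<in>S. M \<subseteq> Y \<longrightarrow> Y = M" by (rule bexE)
  then show ?thesis by (intro that) auto
qed

text \<open>The contraction to R of the extension of D to the local ring R_P.\<close>

definition sat :: "'a set \<Rightarrow> 'a set \<Rightarrow> 'a set" where
  "sat P D = {z \<in> carrier R. \<exists>u \<in> carrier R - P. u \<otimes> z \<in> D}"

text \<open>These ideals correspond to the ideals of R_P.\<close>

definition saturated :: "'a set \<Rightarrow> 'a set \<Rightarrow> bool" where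
  "saturated P D \<longleftrightarrow> ideal D R \<and> (\<forall>u\<in>carrier R - P. \<forall>z\<in>carrier R. u \<otimes> z \<in> D \<longrightarrow> z \<in> D)"

text \<open>In R_P: the maximal ideal lies in the radical of the extension of E.\<close>

definition prime_nil :: "'a set \<Rightarrow> 'a set \<Rightarrow> bool" where
  "prime_nil P E \<longleftrightarrow> (\<forall>p\<in>P. \<exists>u\<in>carrier R - P. \<exists>N::nat. u \<otimes> p [^] N \<in> E)"

lemma mult_notin_prime:
  assumes "primeideal P R" "u \<in> carrier R - P" "v \<in> carrier R - P"
  shows "u \<otimes> v \<in> carrier R - P"
  using primeideal_D(4)[OF assms(1)] assms by auto

lemma one_notin_prime:
  assumes "primeideal P R" shows "\<one> \<in> carrier R - P"
  using primeideal_D(2)[OF assms(1)] by simp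

lemma saturated_ideal: "saturated P D \<Longrightarrow> ideal D R"
  by (simp add: saturated_def)

lemma saturatedD: "saturated P D \<Longrightarrow> u \<in> carrier R - P \<Longrightarrow> z \<in> carrier R \<Longrightarrow> u \<otimes> z \<in> D \<Longrightarrow> z \<in> D"
  by (simp add: saturated_def)

lemma sat_ideal:
  assumes P: "primeideal P R" and D: "ideal D R"
  shows "ideal (sat P D) R"
proof (rule ideal_intro_comm)
  show "sat P D \<subseteq> carrier R" by (auto simp: sat_def)
  show "\<zero> \<in> sat P D" using one_notin_prime[OF P] ideal_zero[OF D] by (auto simp: sat_def)
  show "a \<oplus> b \<in> sat P D" if "a \<in> sat P D" "b \<in> sat P D" for a b
  proof -
    from that obtain u v where u: "u \<in> carrier R - P" "u \<otimes> a \<in> D" and v: "v \<in> carrier R - P" "v \<otimes> b \<in> D"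
      and c: "a \<in> carrier R" "b \<in> carrier R" by (auto simp: sat_def)
    have "(u \<otimes> v) \<otimes> (a \<oplus> b) = v \<otimes> (u \<otimes> a) \<oplus> u \<otimes> (v \<otimes> b)" using u v c by (simp, algebra)
    also have "\<dots> \<in> D" using u v by (intro ideal_add[OF D] ideal_lmult[OF D u(2)] ideal_lmult[OF D v(2)]) auto
    finally show ?thesis using mult_notin_prime[OF P u(1) v(1)] c by (auto simp: sat_def)
  qed
  show "x \<otimes> a \<in> sat P D" if "a \<in> sat P D" "x \<in> carrier R" for a x
  proof -
    from that obtain u where u: "u \<in> carrier R - P" "u \<otimes> a \<in> D" and c: "a \<in> carrier R" by (auto simp: sat_def)
    have "u \<otimes> (x \<otimes> a) = x \<otimes> (u \<otimes> a)" using u c that by (simp, algebra)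
    then have "u \<otimes> (x \<otimes> a) \<in> D" using ideal_lmult[OF D u(2) that(2)] by simp
    then show ?thesis using u(1) c that(2) by (auto simp: sat_def)
  qed
qed

lemma sat_saturated:
  assumes P: "primeideal P R" and D: "ideal D R"
  shows "saturated P (sat P D)"
  unfolding saturated_def
proof (intro conjI ballI impI)
  show "ideal (sat P D) R" by (rule sat_ideal[OF assms])
  fix u z assume u: "u \<in> carrier R - P" and z: "z \<in> carrier R" and "u \<otimes> z \<in> sat P D"
  then obtain v where v: "v \<in> carrier R - P" "v \<otimes> (u \<otimes> z) \<in> D" by (auto simp: sat_def)
  have "(v \<otimes> u) \<otimes> z \<in> D" using v u z by (simp add: m_assoc)
  then show "z \<in> sat P D" using mult_notin_prime[OF P v(1) u] z by (auto simp: sat_def)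
qed

lemma sat_superset:
  assumes P: "primeideal P R" and D: "ideal D R"
  shows "D \<subseteq> sat P D"
proof
  fix z assume "z \<in> D"
  then have "z \<in> carrier R" "\<one> \<otimes> z \<in> D" using ideal_carrier[OF D] by auto
  then show "z \<in> sat P D" using one_notin_prime[OF P] unfolding sat_def by blast
qed

lemma sat_mono: "D \<subseteq> E \<Longrightarrow> sat P D \<subseteq> sat P E"
  by (auto simp: sat_def)

lemma sat_minimal: "saturated P E \<Longrightarrow> D \<subseteq> E \<Longrightarrow> sat P D \<subseteq> E"
  by (auto simp: sat_def dest: saturatedD)

text \<open>An ideal maximal among those disjoint from the multiplicative set of all u p^N, with u
  outside P, is prime. Since u = u p^0 belongs to this set, disjointness also keeps the ideal inside
  P.\<close>

lemma prime_avoiding: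
  assumes P: "primeideal P R" and E: "ideal E R" and p: "p \<in> carrier R"
    and av: "\<And>u N. u \<in> carrier R - P \<Longrightarrow> u \<otimes> p [^] (N::nat) \<notin> E"
  obtains E' where "primeideal E' R" "E \<subseteq> E'" "E' \<subseteq> P" "p \<notin> E'"
proof -
  define S where "S = {M. ideal M R \<and> E \<subseteq> M \<and> (\<forall>u\<in>carrier R - P. \<forall>N::nat. u \<otimes> p [^] N \<notin> M)}"
  have "S \<noteq> {}" using E av by (auto simp: S_def)
  then obtain M where M: "M \<in> S" and max: "\<And>I. I \<in> S \<Longrightarrow> M \<subseteq> I \<Longrightarrow> I = M"
    by (rule ex_maximal_ideal_in) (auto simp: S_def)
  have iM: "ideal M R" and EM: "E \<subseteq> M"
    and avM: "\<And>u N. u \<in> carrier R - P \<Longrightarrow> u \<otimes> p [^] (N::nat) \<notin> M"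
    using M by (auto simp: S_def)
  have MP: "M \<subseteq> P"
  proof
    fix z assume z: "z \<in> M"
    show "z \<in> P"
    proof (rule ccontr)
      assume "z \<notin> P"
      then have "z \<in> carrier R - P" using z ideal_carrier[OF iM] by auto
      from avM[OF this, of 0] z show False using ideal_carrier[OF iM] by simp
    qed
  qed
  have key: "\<exists>u\<in>carrier R - P. \<exists>N::nat. \<exists>j\<in>M. \<exists>c\<in>carrier R. u \<otimes> p [^] N = j \<oplus> c \<otimes> a"
    if a: "a \<in> carrier R" "a \<notin> M" for a
  proof (rule ccontr)
    assume "\<not> ?thesis"
    then have "adj M a \<in> S"
      using ideal_adj[OF iM a(1)] subset_adj[OF iM a(1)] EM
      unfolding S_def by (auto simp: mem_adj[OF a(1)])
    from max[OF this subset_adj[OF iM a(1)]] show False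
      using self_adj[OF iM a(1)] a(2) by simp
  qed
  have "primeideal M R"
  proof (rule primeidealI[OF iM is_cring])
    show "carrier R \<noteq> M" using MP primeideal_D(2)[OF P] by auto
    fix a b assume a: "a \<in> carrier R" and b: "b \<in> carrier R" and ab: "a \<otimes> b \<in> M"
    show "a \<in> M \<or> b \<in> M"
    proof (rule ccontr)
      assume "\<not> ?thesis"
      then have na: "a \<notin> M" and nb: "b \<notin> M" by auto
      obtain u N j c where 1: "u \<in> carrier R - P" "j \<in> M" "c \<in> carrier R" "u \<otimes> p [^] (N::nat) = j \<oplus> c \<otimes> a"
        using key[OF a na] by blast
      obtain v N' j' c' where 2: "v \<in> carrier R - P" "j' \<in> M" "c' \<in> carrier R" "v \<otimes> p [^] (N'::nat) = j' \<oplus> c' \<otimes> b"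
        using key[OF b nb] by blast
      have carr: "j \<in> carrier R" "j' \<in> carrier R" "u \<in> carrier R" "v \<in> carrier R"
        using 1 2 ideal_carrier[OF iM] by auto
      have "(u \<otimes> v) \<otimes> p [^] (N + N') = (u \<otimes> p [^] N) \<otimes> (v \<otimes> p [^] N')"
        using carr p by (simp add: nat_pow_mult[symmetric] m_ac)
      also have "\<dots> = (j' \<oplus> c' \<otimes> b) \<otimes> j \<oplus> (c \<otimes> a) \<otimes> j' \<oplus> (c \<otimes> c') \<otimes> (a \<otimes> b)"
        unfolding 1(4) 2(4) using carr a b 1(3) 2(3) by algebra
      also have "\<dots> \<in> M"
        using 1 2 a b carr by (intro ideal_add[OF iM] ideal_lmult[OF iM ab] ideal_lmult[OF iM 1(2)] ideal_lmult[OF iM 2(2)]) auto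
      finally show False using avM[OF mult_notin_prime[OF P 1(1) 2(1)]] by blast
    qed
  qed
  moreover have "p \<notin> M" using avM[OF one_notin_prime[OF P], of 1] p by simp
  ultimately show ?thesis using that EM MP by blast
qed

lemma prime_nil_minimal:
  assumes P: "primeideal P R" and E: "ideal E R"
    and min: "\<And>P'. primeideal P' R \<Longrightarrow> E \<subseteq> P' \<Longrightarrow> P' \<subseteq> P \<Longrightarrow> P' = P"
  shows "prime_nil P E"
  unfolding prime_nil_def
proof (rule ballI, rule ccontr)
  fix p assume p: "p \<in> P" and n: "\<not> (\<exists>u\<in>carrier R - P. \<exists>N::nat. u \<otimes> p [^] N \<in> E)"
  have pc: "p \<in> carrier R" using p primeideal_D(3)[OF P] by blast
  obtain E' where "primeideal E' R" "E \<subseteq> E'" "E' \<subseteq> P" "p \<notin> E'"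
    using prime_avoiding[OF P E pc] n by blast
  then show False using min p by blast
qed

text \<open>A maximal annihilator \<open>M : g\<close> is all of \<open>P\<close>.\<close>

lemma ex_socle_element:
  assumes P: "primeideal P R" and sM: "saturated P M" and nM: "prime_nil P M" and ne: "M \<noteq> carrier R"
  obtains g where "g \<in> carrier R" "g \<notin> M" "\<And>p. p \<in> P \<Longrightarrow> p \<otimes> g \<in> M"
proof -
  have iM: "ideal M R" using sM by (rule saturated_ideal)
  obtain g0 where g0: "g0 \<in> carrier R" "g0 \<notin> M" using ne ideal_carrier[OF iM] by blast
  define col where "col g = {r \<in> carrier R. g \<otimes> r \<in> M}" for g
  obtain Mx where Mx: "Mx \<in> (col ` (carrier R - M))" and Mxmax: "\<And>I. I \<in> (col ` (carrier R - M)) \<Longrightarrow> Mx \<subseteq> I \<Longrightarrow> I = Mx"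
  proof -
    have "col ` (carrier R - M) \<noteq> {}" using g0 by blast
    moreover have "ideal I R" if "I \<in> col ` (carrier R - M)" for I
      using that ideal.helper_max_prime[OF iM is_cring] unfolding col_def by auto
    ultimately show thesis using that by (rule ex_maximal_ideal_in)
  qed
  then obtain g where g: "g \<in> carrier R" "g \<notin> M" "Mx = col g" by auto
  have Pg: "p \<otimes> g \<in> M" if p: "p \<in> P" for p
  proof (rule ccontr)
    assume npg: "p \<otimes> g \<notin> M"
    have pc: "p \<in> carrier R" using p primeideal_D(3)[OF P] by blast
    have "Mx \<subseteq> col (p \<otimes> g)"
    proof
      fix r assume "r \<in> Mx"
      then have r: "r \<in> carrier R" "g \<otimes> r \<in> M" by (auto simp: g(3) col_def)
      have "p \<otimes> g \<otimes> r = p \<otimes> (g \<otimes> r)" using pc g r by (simp add: m_assoc)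
      then show "r \<in> col (p \<otimes> g)" using r ideal_lmult[OF iM r(2) pc] by (simp add: col_def)
    qed
    \<comment> \<open>Maximality of M : g forces M : (p g) = M : g. Inductively no p^n g lies in M,
      against the nilpotence of p modulo M in the localisation.\<close>
    then have eq: "col (p \<otimes> g) = col g" using Mxmax[of "col (p \<otimes> g)"] npg pc g by auto
    have np: "p [^] n \<otimes> g \<notin> M" for n :: nat
    proof (induction n)
      case 0 then show ?case using g by simp
    next
      case (Suc n)
      have "p [^] n \<notin> col g" using Suc pc g by (simp add: col_def m_comm)
      then have "p \<otimes> g \<otimes> p [^] n \<notin> M" using eq pc unfolding col_def by auto
      moreover have "p \<otimes> g \<otimes> p [^] n = p [^] Suc n \<otimes> g" using pc g by (simp add: m_ac)
      ultimately show ?case by simp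
    qed
    obtain u N where u: "u \<in> carrier R - P" "u \<otimes> p [^] (N::nat) \<in> M" using nM p unfolding prime_nil_def by blast
    have "u \<otimes> (p [^] N \<otimes> g) = u \<otimes> p [^] N \<otimes> g" using u pc g by (simp add: m_assoc)
    also have "\<dots> \<in> M" using ideal_rmult[OF iM u(2) g(1)] .
    finally have "p [^] N \<otimes> g \<in> M" using saturatedD[OF sM u(1), of "p [^] N \<otimes> g"] pc g by simp
    then show False using np by simp
  qed
  show ?thesis using that[OF g(1,2) Pg] .
qed

text \<open>The quotient of R_P by A is Artinian. Noetherian induction on A: for a maximal
  counterexample M, pick g outside M with P g inside M. The condition holds above M + (g), and a
  chain above M is controlled by its sums with g, because the multiples c g with c in P already lie
  in M.\<close>

lemma dcc_saturated:
  assumes P: "primeideal P R" and A: "ideal A R" and nil: "prime_nil P A"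
    and D: "\<And>n. saturated P (D n)" "\<And>n. A \<subseteq> D n" "\<And>n. D (Suc n) \<subseteq> D n"
  shows "\<exists>n::nat. D (Suc n) = D n"
proof (rule ccontr)
  assume neg: "\<not> ?thesis"
  define dcc where "dcc A \<longleftrightarrow> (\<forall>D. (\<forall>n. saturated P (D n) \<and> A \<subseteq> D n \<and> D (Suc n) \<subseteq> D n) \<longrightarrow> (\<exists>n::nat. D (Suc n) = D n))" for A
  have "\<not> dcc A" unfolding dcc_def using D neg by blast
  define S where "S = {A. ideal A R \<and> prime_nil P A \<and> \<not> dcc A}"
  have "S \<noteq> {}" using A nil \<open>\<not> dcc A\<close> by (auto simp: S_def)
  then obtain M where M: "M \<in> S" and max: "\<And>I. I \<in> S \<Longrightarrow> M \<subseteq> I \<Longrightarrow> I = M"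
    by (rule ex_maximal_ideal_in) (auto simp: S_def)
  have iM: "ideal M R" and nM: "prime_nil P M" and ndM: "\<not> dcc M" using M by (auto simp: S_def)
  have nil_mono: "prime_nil P I" if "M \<subseteq> I" for I
    using nM that unfolding prime_nil_def by blast
  \<comment> \<open>A saturated ideal that contains M contains its saturation, so both have the same
    chains above them, and maximality makes M saturated.\<close>
  have "\<not> dcc (sat P M)"
    using ndM sat_minimal unfolding dcc_def by meson
  then have "sat P M = M"
    using max[of "sat P M"] sat_superset[OF P iM] sat_ideal[OF P iM] nil_mono[OF sat_superset[OF P iM]] by (simp add: S_def)
  then have sM: "saturated P M" using sat_saturated[OF P iM] by simp
  have "M \<noteq> carrier R"
  proof
    assume "M = carrier R"
    then have "dcc M" unfolding dcc_def
      using saturated_ideal ideal_carrier by (metis subset_antisym subsetI)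
    then show False using ndM by simp
  qed
  obtain g where g: "g \<in> carrier R" "g \<notin> M" and Pg: "\<And>p. p \<in> P \<Longrightarrow> p \<otimes> g \<in> M"
    using ex_socle_element[OF P sM nM \<open>M \<noteq> carrier R\<close>] by blast
  let ?A = "adj M g"
  have "M \<noteq> ?A" using self_adj[OF iM g(1)] g(2) by blast
  then have dA: "dcc ?A"
    using max[of ?A] subset_adj[OF iM g(1)] ideal_adj[OF iM g(1)] nil_mono[of ?A] by (auto simp: S_def)
  have "dcc M" unfolding dcc_def
  proof (intro allI impI)
    fix D :: "nat \<Rightarrow> 'a set" assume D: "\<forall>n. saturated P (D n) \<and> M \<subseteq> D n \<and> D (Suc n) \<subseteq> D n"
    then have iD: "ideal (D n) R" for n using saturated_ideal[of P "D n"] by blast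
    show "\<exists>n. D (Suc n) = D n"
    proof (cases "\<forall>n. g \<in> D n")
      case True
      then have "\<forall>n. ?A \<subseteq> D n" using D iD by (simp add: adj_minimal)
      then show ?thesis using dA D unfolding dcc_def by blast
    next
      case False
      then obtain n0 where n0: "g \<notin> D n0" by blast
      define F where "F k = sat P (adj (D (n0 + k)) g)" for k
      have gF: "g \<notin> D (n0 + k)" for k
      proof
        assume "g \<in> D (n0 + k)"
        moreover have "D (n0 + k) \<subseteq> D n0" by (induction k) (use D in auto)
        ultimately show False using n0 by blast
      qed
      have "saturated P (F k) \<and> ?A \<subseteq> F k \<and> F (Suc k) \<subseteq> F k" for k
      proof (intro conjI)
        show "saturated P (F k)" unfolding F_def by (intro sat_saturated P ideal_adj iD g)
        have "?A \<subseteq> adj (D (n0 + k)) g" using D by (intro adj_mono g) auto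
        also have "\<dots> \<subseteq> F k" unfolding F_def by (intro sat_superset P ideal_adj iD g)
        finally show "?A \<subseteq> F k" .
        show "F (Suc k) \<subseteq> F k" unfolding F_def using D by (intro sat_mono adj_mono g) auto
      qed
      then obtain k where k: "F (Suc k) = F k" using dA unfolding dcc_def by blast
      have "D (n0 + k) \<subseteq> D (Suc (n0 + k))"
      proof
        fix z assume z: "z \<in> D (n0 + k)"
        have zc: "z \<in> carrier R" using z ideal_carrier[OF iD] by blast
        have "z \<in> F k" unfolding F_def
          using z subset_adj[OF iD g(1), of "n0+k"] sat_superset[OF P ideal_adj[OF iD g(1), of "n0+k"]] by blast
        then have "z \<in> F (Suc k)" using k by simp
        then obtain u d c where u: "u \<in> carrier R - P" and d: "d \<in> D (Suc (n0 + k))" and c: "c \<in> carrier R"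
          and eq: "u \<otimes> z = d \<oplus> c \<otimes> g" unfolding F_def sat_def by (auto simp: mem_adj[OF g(1)])
        have dc: "d \<in> carrier R" using d ideal_carrier[OF iD] by blast
        have "c \<otimes> g = u \<otimes> z \<ominus> d" unfolding eq using dc c g(1) by algebra
        also have "\<dots> \<in> D (n0 + k)" using z u d D by (intro ideal_minus[OF iD] ideal_lmult[OF iD]) auto
        finally have cg: "c \<otimes> g \<in> D (n0 + k)" .
        \<comment> \<open>Otherwise saturation would put g into \<open>D (n0 + k)\<close>. Hence c g
          lies in M, which is contained in every member of the chain.\<close>
        have "c \<in> P" using saturatedD[of P "D (n0+k)" c g] cg c g(1) gF D by blast
        then have "c \<otimes> g \<in> D (Suc (n0 + k))" using Pg D by blast
        then have "u \<otimes> z \<in> D (Suc (n0 + k))" unfolding eq using d by (intro ideal_add[OF iD])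
        then show "z \<in> D (Suc (n0 + k))" using saturatedD D u zc by blast
      qed
      then show ?thesis using D by blast
    qed
  qed
  then show False using ndM by simp
qed

text \<open>A substitute for the Artin-Rees lemma: B is maximal among the saturated ideals over D
  that avoid z, so every element outside B brings z into the saturation of the ideal it generates
  with B. This forces z to be killed by P modulo B, and then P to be nil modulo B.\<close>

lemma ex_nil_avoiding:
  assumes P: "primeideal P R" and D: "saturated P D" and z: "z \<in> carrier R" "z \<notin> D"
  obtains B where "saturated P B" "D \<subseteq> B" "z \<notin> B" "\<And>y. y \<in> P \<Longrightarrow> \<exists>k::nat. y [^] k \<in> B"
proof -
  define S where "S = {B. saturated P B \<and> D \<subseteq> B \<and> z \<notin> B}"
  have "S \<noteq> {}" using D z(2) by (auto simp: S_def)
  then obtain B where B: "B \<in> S" and max: "\<And>I. I \<in> S \<Longrightarrow> B \<subseteq> I \<Longrightarrow> I = B"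
    by (rule ex_maximal_ideal_in) (auto simp: S_def saturated_def)
  have sB: "saturated P B" and DB: "D \<subseteq> B" and zB: "z \<notin> B" using B by (auto simp: S_def)
  have iB: "ideal B R" using sB by (rule saturated_ideal)
  have key: "\<exists>u\<in>carrier R - P. \<exists>b\<in>B. \<exists>c\<in>carrier R. u \<otimes> z = b \<oplus> c \<otimes> a"
    if a: "a \<in> carrier R" "a \<notin> B" for a
  proof (rule ccontr)
    assume "\<not> ?thesis"
    then have nz: "z \<notin> sat P (adj B a)" unfolding sat_def by (auto simp: mem_adj[OF a(1)])
    have sub: "adj B a \<subseteq> sat P (adj B a)"
      by (intro sat_superset P ideal_adj iB a)
    have "sat P (adj B a) \<in> S"
      using nz sat_saturated[OF P ideal_adj[OF iB a(1)]] sub subset_adj[OF iB a(1)] DB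
      by (auto simp: S_def)
    from max[OF this] show False using sub subset_adj[OF iB a(1)] self_adj[OF iB a(1)] a(2) by blast
  qed
  have "\<exists>k::nat. y [^] k \<in> B" if y: "y \<in> P" for y
  proof -
    have yc: "y \<in> carrier R" using y primeideal_D(3)[OF P] by blast
    \<comment> \<open>Nakayama in disguise: otherwise u z = b + c y z with b in B, so (u - c y) z
      lies in B, and u - c y is outside P.\<close>
    have yz: "y \<otimes> z \<in> B"
    proof (rule ccontr)
      assume "y \<otimes> z \<notin> B"
      then obtain u b c where u: "u \<in> carrier R - P" and b: "b \<in> B" and c: "c \<in> carrier R"
        and eq: "u \<otimes> z = b \<oplus> c \<otimes> (y \<otimes> z)" using key[of "y \<otimes> z"] yc z(1) by blast
      have bc: "b \<in> carrier R" using b ideal_carrier[OF iB] by blast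
      have "(u \<ominus> c \<otimes> y) \<otimes> z = u \<otimes> z \<ominus> c \<otimes> (y \<otimes> z)" using u c yc z(1) by (simp, algebra)
      also have "\<dots> = b" unfolding eq using bc c yc z(1) by algebra
      finally have "(u \<ominus> c \<otimes> y) \<otimes> z \<in> B" using b by simp
      moreover have "u \<ominus> c \<otimes> y \<notin> P"
      proof
        assume "u \<ominus> c \<otimes> y \<in> P"
        moreover have "c \<otimes> y \<in> P" using y c ideal_lmult[OF primeideal_D(1)[OF P]] by blast
        ultimately have "(u \<ominus> c \<otimes> y) \<oplus> c \<otimes> y \<in> P" using ideal_add[OF primeideal_D(1)[OF P]] by blast
        moreover have "(u \<ominus> c \<otimes> y) \<oplus> c \<otimes> y = u" using u c yc by (simp, algebra)
        ultimately show False using u by simp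
      qed
      ultimately show False using saturatedD[OF sB, of "u \<ominus> c \<otimes> y" z] u c yc z(1) zB by auto
    qed
    define T where "T k = {r \<in> carrier R. y [^] k \<otimes> r \<in> B}" for k :: nat
    have iT: "ideal (T k) R" for k unfolding T_def by (intro ideal.helper_max_prime[OF iB is_cring]) (simp add: yc)
    have Tmono: "T k \<subseteq> T (k + l)" for k l
    proof
      fix r assume "r \<in> T k"
      then have r: "r \<in> carrier R" "y [^] k \<otimes> r \<in> B" by (auto simp: T_def)
      have "y [^] (k+l) \<otimes> r = y [^] l \<otimes> (y [^] k \<otimes> r)" using yc r by (simp add: nat_pow_mult[symmetric] m_ac)
      then show "r \<in> T (k + l)" using r ideal_lmult[OF iB r(2), of "y [^] l"] yc by (simp add: T_def)
    qed
    obtain Mx where Mx: "Mx \<in> range T" and Mxmax: "\<And>I. I \<in> range T \<Longrightarrow> Mx \<subseteq> I \<Longrightarrow> I = Mx"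
      by (rule ex_maximal_ideal_in[of "range T"]) (use iT in auto)
    then obtain k where k: "Mx = T k" by blast
    \<comment> \<open>The annihilators of y^k modulo B stabilise. If y^k is outside B, then u z = b
      + c y^k; multiplying by y, where y z is in B, puts c into \<open>T (Suc k)\<close>, which is
      \<open>T k\<close>, hence u z into B.\<close>
    have Tk: "T (Suc k) = T k" using Mxmax[of "T (Suc k)"] Tmono[of k 1] k by simp
    have "y [^] k \<in> B"
    proof (rule ccontr)
      assume "y [^] k \<notin> B"
      then obtain u b c where u: "u \<in> carrier R - P" and b: "b \<in> B" and c: "c \<in> carrier R"
        and eq: "u \<otimes> z = b \<oplus> c \<otimes> y [^] k" using key[of "y [^] k"] yc by blast
      have bc: "b \<in> carrier R" using b ideal_carrier[OF iB] by blast
      define w where "w = y [^] k"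
      have w: "w \<in> carrier R" "y [^] Suc k = w \<otimes> y" using yc by (auto simp: w_def)
      have "y [^] Suc k \<otimes> c = y \<otimes> (u \<otimes> z) \<ominus> y \<otimes> b"
        unfolding eq w(2) w_def[symmetric] using bc c yc w(1) by algebra
      also have "\<dots> = u \<otimes> (y \<otimes> z) \<ominus> y \<otimes> b" using u yc z(1) bc by (simp, algebra)
      also have "\<dots> \<in> B" using b u yc by (intro ideal_minus[OF iB] ideal_lmult[OF iB yz] ideal_lmult[OF iB b]) auto
      finally have "c \<in> T (Suc k)" using c by (simp add: T_def)
      then have "c \<in> T k" unfolding Tk .
      then have "y [^] k \<otimes> c \<in> B" by (simp add: T_def)
      then have "c \<otimes> y [^] k \<in> B" using c yc by (simp add: m_comm)
      then have "u \<otimes> z \<in> B" unfolding eq using b by (intro ideal_add[OF iB])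
      then show False using saturatedD[OF sB u z(1)] zB by blast
    qed
    then show ?thesis by blast
  qed
  then show ?thesis using that[OF sB DB zB] by blast
qed

lemma krull_intersection_sat:
  assumes P: "primeideal P R" and D: "saturated P D" and y: "y \<in> P" and z: "z \<in> carrier R"
    and zD: "\<And>k. z \<in> sat P (adj D (y [^] (k::nat)))"
  shows "z \<in> D"
proof (rule ccontr)
  assume "z \<notin> D"
  then obtain B where B: "saturated P B" "D \<subseteq> B" "z \<notin> B" "\<And>y. y \<in> P \<Longrightarrow> \<exists>k::nat. y [^] k \<in> B"
    using ex_nil_avoiding[OF P D z] by blast
  then obtain k where "y [^] (k::nat) \<in> B" using y by blast
  then have "adj D (y [^] k) \<subseteq> B" using B by (intro adj_minimal saturated_ideal)
  then have "z \<in> B" using zD[of k] sat_minimal[OF B(1)] by blast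
  then show False using B(3) by simp
qed

end

section \<open>Krull's principal ideal theorem and height theorem\<close>

context noetherian_cring
begin

text \<open>Krull's principal ideal theorem, with saturation with respect to \<open>P\<close> in place of localisation.
  The ideals \<open>B n\<close> play the role of the symbolic powers \<open>(a\<^sup>n) : y\<^sup>\<infinity>\<close>: they stabilise modulo \<open>y\<close>,
  hence stabilise, and a relation \<open>u y\<^sup>k a\<^sup>n = e a\<^sup>n\<^sup>+\<^sup>1\<close> results.\<close>

lemma principal_ideal_theorem:
  assumes P: "primeideal P R" and Q: "primeideal Q R" "Q \<subset> P"
    and Z: "ideal Z R" and y: "y \<in> P" "y \<notin> Q"
    and nil: "prime_nil P (adj Z y)" and a: "a \<in> Q"
  shows "\<exists>v\<in>carrier R - Q. \<exists>n::nat. v \<otimes> a [^] n \<in> Z"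
proof -
  have yc: "y \<in> carrier R" and ac: "a \<in> carrier R"
    using y a primeideal_D(3)[OF P] primeideal_D(3)[OF Q(1)] by auto
  define A where "A n = adj Z (a [^] n)" for n :: nat
  have iA: "ideal (A n) R" for n unfolding A_def by (intro ideal_adj Z) (simp add: ac)
  have Amono: "A (Suc n) \<subseteq> A n" for n
  proof -
    have "a \<otimes> a [^] n \<in> A n" unfolding A_def
      by (intro ideal_lmult[OF ideal_adj[OF Z] self_adj[OF Z]] ac nat_pow_closed)
    then have "a [^] Suc n \<in> A n" using ac by (simp add: m_comm)
    moreover have "Z \<subseteq> A n" unfolding A_def by (intro subset_adj Z) (simp add: ac)
    ultimately show ?thesis unfolding A_def[of "Suc n"] by (intro adj_minimal iA)
  qed
  define B where "B n = {z \<in> carrier R. \<exists>u\<in>carrier R - P. \<exists>k::nat. u \<otimes> (y [^] k \<otimes> z) \<in> A n}" for n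
  have BI: "z \<in> B n" if "z \<in> carrier R" "u \<in> carrier R - P" "u \<otimes> (y [^] (k::nat) \<otimes> z) \<in> A n" for u k z n
    using that unfolding B_def by blast
  have iB: "ideal (B n) R" for n
  proof (rule ideal_intro_comm)
    show "B n \<subseteq> carrier R" by (auto simp: B_def)
    show "\<zero> \<in> B n" using BI[of \<zero> \<one> 0 n] one_notin_prime[OF P] ideal_zero[OF iA] by simp
    show "c \<oplus> d \<in> B n" if "c \<in> B n" "d \<in> B n" for c d
    proof -
      from that obtain u k v l where u: "u \<in> carrier R - P" "u \<otimes> (y [^] (k::nat) \<otimes> c) \<in> A n"
        and v: "v \<in> carrier R - P" "v \<otimes> (y [^] (l::nat) \<otimes> d) \<in> A n"
        and cd: "c \<in> carrier R" "d \<in> carrier R" by (auto simp: B_def)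
      have "(u \<otimes> v) \<otimes> (y [^] (k + l) \<otimes> (c \<oplus> d))
        = (v \<otimes> y [^] l) \<otimes> (u \<otimes> (y [^] k \<otimes> c)) \<oplus> (u \<otimes> y [^] k) \<otimes> (v \<otimes> (y [^] l \<otimes> d))"
        using u v cd yc by (simp add: nat_pow_mult[symmetric] r_distr m_ac)
      also have "\<dots> \<in> A n" using u(1) v(1) yc
        by (intro ideal_add[OF iA] ideal_lmult[OF iA u(2)] ideal_lmult[OF iA v(2)]) auto
      finally show ?thesis using BI[OF _ mult_notin_prime[OF P u(1) v(1)]] cd by blast
    qed
    show "x \<otimes> c \<in> B n" if "c \<in> B n" "x \<in> carrier R" for c x
    proof -
      from that obtain u k where u: "u \<in> carrier R - P" "u \<otimes> (y [^] (k::nat) \<otimes> c) \<in> A n"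
        and c: "c \<in> carrier R" by (auto simp: B_def)
      have "u \<otimes> (y [^] k \<otimes> (x \<otimes> c)) = x \<otimes> (u \<otimes> (y [^] k \<otimes> c))"
        using u c that(2) yc by (simp add: m_ac)
      then show ?thesis using BI[OF _ u(1), of "x \<otimes> c" k] ideal_lmult[OF iA u(2) that(2)] c that(2) by simp
    qed
  qed
  have Bmono: "B (Suc n) \<subseteq> B n" for n using Amono unfolding B_def by blast
  have sB: "saturated P (B n)" for n
    unfolding saturated_def
  proof (intro conjI ballI impI iB)
    fix u z assume u: "u \<in> carrier R - P" and z: "z \<in> carrier R" and "u \<otimes> z \<in> B n"
    then obtain v k where v: "v \<in> carrier R - P" "v \<otimes> (y [^] (k::nat) \<otimes> (u \<otimes> z)) \<in> A n" by (auto simp: B_def)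
    have "v \<otimes> (y [^] k \<otimes> (u \<otimes> z)) = (v \<otimes> u) \<otimes> (y [^] k \<otimes> z)" using u v z yc by (simp add: m_ac)
    then show "z \<in> B n" using BI[OF z mult_notin_prime[OF P v(1) u], of k n] v(2) by simp
  qed
  \<comment> \<open>Cancelling y is built into \<open>B n\<close>; when z and b lie in
    \<open>B n\<close> and u z = b + c y, the coefficient c is again in \<open>B n\<close>.\<close>
  have ysat: "z \<in> B n" if "y \<otimes> z \<in> B n" "z \<in> carrier R" for z n
  proof -
    from that obtain v k where v: "v \<in> carrier R - P" "v \<otimes> (y [^] (k::nat) \<otimes> (y \<otimes> z)) \<in> A n" by (auto simp: B_def)
    have "v \<otimes> (y [^] k \<otimes> (y \<otimes> z)) = v \<otimes> (y [^] (Suc k) \<otimes> z)" using v that yc by (simp add: m_ac)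
    then show ?thesis using BI[OF that(2) v(1), of "Suc k" n] v(2) by simp
  qed
  define D where "D n = sat P (adj (B n) y)" for n
  have AB: "A n \<subseteq> B n" for n
  proof
    fix z assume z: "z \<in> A n"
    then have "z \<in> carrier R" using ideal_carrier[OF iA] by blast
    then show "z \<in> B n" using BI[OF _ one_notin_prime[OF P], of z 0 n] z by simp
  qed
  have ZA: "Z \<subseteq> A n" for n unfolding A_def by (intro subset_adj Z) (simp add: ac)
  have "\<exists>n. D (Suc n) = D n"
  proof (rule dcc_saturated[OF P ideal_adj[OF Z yc] nil])
    show "saturated P (D n)" for n unfolding D_def by (intro sat_saturated P ideal_adj iB yc)
    show "adj Z y \<subseteq> D n" for n
    proof -
      have "adj Z y \<subseteq> adj (B n) y" using ZA AB yc by (intro adj_mono) blast+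
      also have "\<dots> \<subseteq> D n" unfolding D_def by (intro sat_superset P ideal_adj iB yc)
      finally show ?thesis .
    qed
    show "D (Suc n) \<subseteq> D n" for n unfolding D_def by (intro sat_mono adj_mono Bmono yc)
  qed
  then obtain n where n: "D (Suc n) = D n" by blast
  \<comment> \<open>Stability of \<open>D\<close> reads, up to a factor outside P:
    \<open>B n\<close> lies in \<open>B (Suc n)\<close> + y \<open>B n\<close>. Iterating this and
    applying Krull's intersection theorem removes the second summand.\<close>
  have step: "\<exists>u\<in>carrier R - P. \<exists>b\<in>B (Suc n). \<exists>c\<in>B n. u \<otimes> z = b \<oplus> c \<otimes> y" if z: "z \<in> B n" for z
  proof -
    have zc: "z \<in> carrier R" using z ideal_carrier[OF iB] by blast
    have "z \<in> adj (B n) y" using subset_adj[OF iB yc] z by blast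
    then have "z \<in> D n" unfolding D_def using sat_superset[OF P ideal_adj[OF iB yc]] by blast
    then have "z \<in> D (Suc n)" using n by simp
    then obtain u b c where u: "u \<in> carrier R - P" and b: "b \<in> B (Suc n)" and c: "c \<in> carrier R"
      and eq: "u \<otimes> z = b \<oplus> c \<otimes> y" unfolding D_def sat_def by (auto simp: mem_adj[OF yc])
    have bc: "b \<in> carrier R" using b ideal_carrier[OF iB] by blast
    have "y \<otimes> c = u \<otimes> z \<ominus> b" unfolding eq using bc c yc by algebra
    also have "\<dots> \<in> B n" using u b Bmono by (intro ideal_minus[OF iB] ideal_lmult[OF iB z]) auto
    finally have "c \<in> B n" using ysat c by blast
    then show ?thesis using u b eq by blast
  qed
  have iter: "\<exists>u\<in>carrier R - P. \<exists>b\<in>B (Suc n). \<exists>c\<in>B n. u \<otimes> z = b \<oplus> c \<otimes> y [^] (k::nat)"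
    if z: "z \<in> B n" for z k
  proof (induction k)
    case 0
    have "\<one> \<otimes> z = \<zero> \<oplus> z \<otimes> y [^] (0::nat)" using z ideal_carrier[OF iB] by simp
    then show ?case using one_notin_prime[OF P] ideal_zero[OF iB] z by blast
  next
    case (Suc k)
    then obtain u b c where 1: "u \<in> carrier R - P" "b \<in> B (Suc n)" "c \<in> B n" "u \<otimes> z = b \<oplus> c \<otimes> y [^] k" by blast
    obtain v b' c' where 2: "v \<in> carrier R - P" "b' \<in> B (Suc n)" "c' \<in> B n" "v \<otimes> c = b' \<oplus> c' \<otimes> y" using step[OF 1(3)] by blast
    define w where "w = y [^] k"
    have w: "w \<in> carrier R" "y [^] Suc k = w \<otimes> y" using yc by (auto simp: w_def)
    have carr: "b \<in> carrier R" "b' \<in> carrier R" "c \<in> carrier R" "c' \<in> carrier R" "z \<in> carrier R" "u \<in> carrier R" "v \<in> carrier R"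
      using 1 2 z ideal_carrier[OF iB] by auto
    have "(v \<otimes> u) \<otimes> z = v \<otimes> (u \<otimes> z)" using carr by (simp add: m_assoc)
    also have "\<dots> = v \<otimes> b \<oplus> (v \<otimes> c) \<otimes> w" unfolding 1(4) w_def[symmetric] using carr w(1) by algebra
    also have "\<dots> = (v \<otimes> b \<oplus> w \<otimes> b') \<oplus> c' \<otimes> y [^] Suc k" unfolding 2(4) w(2) using carr w(1) yc by algebra
    finally have eq: "(v \<otimes> u) \<otimes> z = (v \<otimes> b \<oplus> w \<otimes> b') \<oplus> c' \<otimes> y [^] Suc k" .
    moreover have "v \<otimes> b \<oplus> w \<otimes> b' \<in> B (Suc n)"
      using carr w(1) by (intro ideal_add[OF iB] ideal_lmult[OF iB 1(2)] ideal_lmult[OF iB 2(2)]) auto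
    ultimately show ?case using mult_notin_prime[OF P 2(1) 1(1)] 2(3) by blast
  qed
  have BB: "B n \<subseteq> B (Suc n)"
  proof
    fix z assume z: "z \<in> B n"
    have zc: "z \<in> carrier R" using z ideal_carrier[OF iB] by blast
    show "z \<in> B (Suc n)"
    proof (rule krull_intersection_sat[OF P sB y(1) zc])
      fix k :: nat
      obtain u b c where 1: "u \<in> carrier R - P" "b \<in> B (Suc n)" "c \<in> B n" "u \<otimes> z = b \<oplus> c \<otimes> y [^] k" using iter[OF z] by blast
      then have "u \<otimes> z \<in> adj (B (Suc n)) (y [^] k)" using ideal_carrier[OF iB] yc by (auto intro!: mem_adjI)
      then show "z \<in> sat P (adj (B (Suc n)) (y [^] k))" using 1(1) zc by (auto simp: sat_def)
    qed
  qed
  have "a [^] n \<in> A n" unfolding A_def by (intro self_adj Z) (simp add: ac)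
  then have "a [^] n \<in> B (Suc n)" using AB BB by blast
  then obtain u k where u: "u \<in> carrier R - P" "u \<otimes> (y [^] (k::nat) \<otimes> a [^] n) \<in> A (Suc n)" by (auto simp: B_def)
  then obtain j e where j: "j \<in> Z" and e: "e \<in> carrier R" and eq: "u \<otimes> (y [^] k \<otimes> a [^] n) = j \<oplus> e \<otimes> a [^] Suc n"
    unfolding A_def using ac by (auto simp: mem_adj)
  \<comment> \<open>The relation u y^k a^n = j + e a^(n+1), solved for v a^n = j. Here v is outside
    Q, since a is in Q while neither u nor y is.\<close>
  define v where "v = u \<otimes> y [^] k \<ominus> e \<otimes> a"
  define w where "w = a [^] n"
  have w: "w \<in> carrier R" "a [^] Suc n = w \<otimes> a" using ac by (auto simp: w_def)
  define t where "t = y [^] k"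
  have t: "t \<in> carrier R" using yc by (simp add: t_def)
  have jc: "j \<in> carrier R" using j ideal_carrier[OF Z] by blast
  have vc: "v \<in> carrier R" unfolding v_def using u yc e ac by auto
  have "v \<otimes> w = u \<otimes> (t \<otimes> w) \<ominus> e \<otimes> (w \<otimes> a)" unfolding v_def t_def[symmetric] using u t w(1) e ac by (simp, algebra)
  also have "\<dots> = j" using eq unfolding t_def[symmetric] w_def[symmetric] w(2) using jc e w(1) ac by algebra
  finally have "v \<otimes> a [^] n \<in> Z" using j unfolding w_def by simp
  moreover have "v \<notin> Q"
  proof
    assume "v \<in> Q"
    then have "v \<oplus> e \<otimes> a \<in> Q" using a e by (intro ideal_add ideal_lmult primeideal_D(1)[OF Q(1)])
    moreover have "v \<oplus> e \<otimes> a = u \<otimes> t" unfolding v_def t_def[symmetric] using u t e ac by (simp, algebra)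
    ultimately have "u \<otimes> y [^] k \<in> Q" unfolding t_def by simp
    then have "u \<in> Q \<or> y [^] k \<in> Q" using primeideal_D(4)[OF Q(1)] u(1) yc by auto
    then show False using u(1) Q(2) y(2) primeideal_pow[OF Q(1) yc] by blast
  qed
  ultimately show ?thesis using vc by blast
qed

lemma ex_prime_just_below:
  assumes P: "primeideal P R" and Q0: "primeideal Q0 R" "Q0 \<subset> P"
  obtains Q where "primeideal Q R" "Q0 \<subseteq> Q" "Q \<subset> P"
    "\<And>Q'. primeideal Q' R \<Longrightarrow> Q \<subset> Q' \<Longrightarrow> Q' \<subseteq> P \<Longrightarrow> Q' = P"
proof -
  define S where "S = {Q. primeideal Q R \<and> Q0 \<subseteq> Q \<and> Q \<subset> P}"
  have "S \<noteq> {}" using Q0 by (auto simp: S_def)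
  then obtain M where M: "M \<in> S" and max: "\<And>I. I \<in> S \<Longrightarrow> M \<subseteq> I \<Longrightarrow> I = M"
    by (rule ex_maximal_ideal_in) (auto simp: S_def primeideal_D(1))
  show ?thesis
  proof (rule that[of M])
    show "primeideal M R" "Q0 \<subseteq> M" "M \<subset> P" using M by (auto simp: S_def)
    fix Q' assume Q': "primeideal Q' R" "M \<subset> Q'" "Q' \<subseteq> P"
    show "Q' = P"
    proof (rule ccontr)
      assume "Q' \<noteq> P"
      then have "Q' \<in> S" using Q' \<open>Q0 \<subseteq> M\<close> by (auto simp: S_def)
      then show False using max[of Q'] Q'(2) by blast
    qed
  qed
qed

text \<open>Induction on the number of generators. Enlarge the prime below P to a Q with nothing
  strictly between Q and P, and choose a generator g outside Q. Each other generator can be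
  exchanged for an element of Q, and Q is then minimal over the exchanged elements, which are
  fewer.\<close>

theorem height_theorem:
  assumes "primeideal P R" and "finite G" "card G \<le> s" "G \<subseteq> P"
    and "\<And>P'. primeideal P' R \<Longrightarrow> G \<subseteq> P' \<Longrightarrow> P' \<subseteq> P \<Longrightarrow> P' = P"
    and "prime_chain R C n" "C n = P"
  shows "n \<le> s"
  using assms
proof (induction s arbitrary: P G C n)
  case 0
  then have "G = {}" by simp
  show ?case
  proof (rule ccontr)
    assume "\<not> n \<le> 0"
    then obtain k where "n = Suc k" using not0_implies_Suc by auto
    then have C0: "primeideal (C k) R" "C k \<subset> P"
      using "0.prems"(6,7) by (auto simp: prime_chain_def)
    then show False using "0.prems"(5)[OF C0(1)] \<open>G = {}\<close> by blast
  qed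
next
  case (Suc s)
  note P = Suc.prems(1) and min = Suc.prems(5)
  show ?case
  proof (cases n)
    case 0 then show ?thesis by simp
  next
    case (Suc n')
    have Cp: "primeideal (C n') R" "C n' \<subset> P" using Suc.prems(6,7) Suc by (auto simp: prime_chain_def)
    obtain Q where Q: "primeideal Q R" "C n' \<subseteq> Q" "Q \<subset> P"
      and Qmax: "\<And>Q'. primeideal Q' R \<Longrightarrow> Q \<subset> Q' \<Longrightarrow> Q' \<subseteq> P \<Longrightarrow> Q' = P"
      using ex_prime_just_below[OF P Cp] by blast
    have iQ: "ideal Q R" using primeideal_D(1)[OF Q(1)] .
    have "\<not> G \<subseteq> Q" using min[OF Q(1)] Q(3) by blast
    then obtain g where g: "g \<in> G" "g \<notin> Q" by blast
    have Gc: "G \<subseteq> carrier R" using Suc.prems(4) primeideal_D(3)[OF P] by blast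
    have gc: "g \<in> carrier R" using g Gc by blast
    have nilQ: "prime_nil P (adj Q g)"
    proof (rule prime_nil_minimal[OF P ideal_adj[OF iQ gc]])
      fix P' assume "primeideal P' R" "adj Q g \<subseteq> P'" "P' \<subseteq> P"
      then show "P' = P" using Qmax[of P'] subset_adj[OF iQ gc] self_adj[OF iQ gc] g(2) by blast
    qed
    \<comment> \<open>Since P is minimal over Q + (g), some power of each h lies in Q + (g) up to a
      factor outside P; its component in Q replaces h.\<close>
    have "\<forall>h\<in>G. \<exists>q\<in>Q. \<exists>u\<in>carrier R - P. \<exists>N::nat. \<exists>c\<in>carrier R. u \<otimes> h [^] N = q \<oplus> c \<otimes> g"
      using nilQ Suc.prems(4) unfolding prime_nil_def by (fastforce simp: mem_adj[OF gc])
    then obtain q where q: "\<And>h. h \<in> G \<Longrightarrow> q h \<in> Q"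
      and qe: "\<And>h. h \<in> G \<Longrightarrow> \<exists>u\<in>carrier R - P. \<exists>N::nat. \<exists>c\<in>carrier R. u \<otimes> h [^] N = q h \<oplus> c \<otimes> g"
      by metis
    define Z where "Z = q ` (G - {g})"
    have ZQ: "Z \<subseteq> Q" using q by (auto simp: Z_def)
    have Zc: "Z \<subseteq> carrier R" using ZQ primeideal_D(3)[OF Q(1)] by blast
    have cZ: "finite Z" "card Z \<le> s"
    proof -
      show "finite Z" using Suc.prems(2) by (simp add: Z_def)
      have "card Z \<le> card (G - {g})" unfolding Z_def using Suc.prems(2) by (intro card_image_le) simp
      also have "\<dots> \<le> s" using Suc.prems(2,3) g(1) by simp
      finally show "card Z \<le> s" .
    qed
    have iZ: "ideal (Idl Z) R" by (intro genideal_ideal Zc)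
    have nilZ: "prime_nil P (adj (Idl Z) g)"
    proof (rule prime_nil_minimal[OF P ideal_adj[OF iZ gc]])
      fix P' assume P': "primeideal P' R" "adj (Idl Z) g \<subseteq> P'" "P' \<subseteq> P"
      have gP': "g \<in> P'" using P'(2) self_adj[OF iZ gc] by blast
      have ZP': "Z \<subseteq> P'" using P'(2) subset_adj[OF iZ gc] genideal_self[OF Zc] by blast
      have "G \<subseteq> P'"
      proof
        fix h assume h: "h \<in> G"
        show "h \<in> P'"
        proof (cases "h = g")
          case False
          then have "q h \<in> P'" using ZP' h by (auto simp: Z_def)
          moreover obtain u N c where u: "u \<in> carrier R - P" "c \<in> carrier R" "u \<otimes> h [^] (N::nat) = q h \<oplus> c \<otimes> g"
            using qe[OF h] by blast
          ultimately have "u \<otimes> h [^] N \<in> P'"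
            using gP' by (simp add: ideal_add ideal_lmult primeideal_D(1)[OF P'(1)])
          then have "u \<in> P' \<or> h [^] N \<in> P'" using primeideal_D(4)[OF P'(1), of u "h [^] N"] u(1) h Gc by auto
          then show ?thesis using u(1) P'(3) primeideal_pow[OF P'(1)] h Gc by blast
        qed (use gP' in simp)
      qed
      then show "P' = P" using min P' by blast
    qed
    \<comment> \<open>The principal ideal theorem, taken modulo the exchanged elements: P is minimal
      over g there, so every element of Q is nilpotent modulo them after localising at Q.\<close>
    have minQ: "P' = Q" if P': "primeideal P' R" "Z \<subseteq> P'" "P' \<subseteq> Q" for P'
    proof
      show "Q \<subseteq> P'"
      proof
        fix a assume a: "a \<in> Q"
        have "g \<in> P" using g Suc.prems(4) by blast
        from principal_ideal_theorem[OF P Q(1,3) iZ this g(2) nilZ a]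
        obtain v N where v: "v \<in> carrier R - Q" "v \<otimes> a [^] (N::nat) \<in> Idl Z" by blast
        have "Idl Z \<subseteq> P'" by (intro genideal_minimal primeideal_D(1) P')
        then have "v \<otimes> a [^] N \<in> P'" using v by blast
        moreover have ac: "a \<in> carrier R" using a primeideal_D(3)[OF Q(1)] by blast
        ultimately have "v \<in> P' \<or> a [^] N \<in> P'" using primeideal_D(4)[OF P'(1), of v "a [^] N"] v(1) by auto
        then show "a \<in> P'" using v(1) P'(3) primeideal_pow[OF P'(1) ac] by blast
      qed
    qed (use P' in simp)
    have "prime_chain R (C(n' := Q)) n'"
      unfolding prime_chain_def
    proof (intro conjI allI impI)
      show "primeideal ((C(n' := Q)) i) R" if "i \<le> n'" for i
        using that Q(1) Suc.prems(6) Suc by (auto simp: prime_chain_def)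
      show "(C(n' := Q)) i \<subset> (C(n' := Q)) (Suc i)" if "i < n'" for i
      proof -
        have "C i \<subset> C (Suc i)" using that Suc.prems(6) Suc by (auto simp: prime_chain_def)
        then show ?thesis using that Q(2) by (cases "Suc i = n'") auto
      qed
    qed
    from Suc.IH[OF Q(1) cZ ZQ minQ this] have "n' \<le> s" by simp
    then show ?thesis using Suc by simp
  qed
qed

end

section \<open>Orders in Noetherian local rings\<close>

context cring
begin

definition mpow :: "'a set \<Rightarrow> nat \<Rightarrow> 'a set" where
  "mpow I n = I [^]\<^bsub>ideals_set R\<^esub> n"

lemma mpow_0: "mpow I 0 = carrier R"
  by (simp add: mpow_def) (simp add: ideals_set_def)

lemma mpow_Suc: "mpow I (Suc n) = ideal_prod R (mpow I n) I"
  by (simp add: mpow_def) (simp add: ideals_set_def)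

lemma mpow_ideal: "ideal I R \<Longrightarrow> ideal (mpow I n) R"
  by (induction n) (auto simp: mpow_0 mpow_Suc intro: oneideal ideal_prod_is_ideal)

lemma mpow_1: "ideal I R \<Longrightarrow> mpow I 1 = I"
  using mpow_Suc[of I 0] ideal_prod_one ideal_prod_commute[OF oneideal] by (simp add: mpow_0)

lemma mpow_add_mem:
  assumes I: "ideal I R" and "a \<in> mpow I n" "b \<in> mpow I k"
  shows "a \<otimes> b \<in> mpow I (n + k)"
proof -
  interpret S: comm_monoid "ideals_set R" by (rule ideals_set_is_comm_monoid)
  have "I \<in> carrier (ideals_set R)" using I by (simp add: ideals_set_def)
  then have "mpow I (n + k) = ideal_prod R (mpow I n) (mpow I k)"
    unfolding mpow_def by (simp add: S.nat_pow_mult[symmetric]) (simp add: ideals_set_def)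
  then show ?thesis using assms(2,3) by (auto intro: ideal_prod.prod)
qed

lemma mpow_Suc_subset:
  assumes I: "ideal I R" shows "mpow I (Suc n) \<subseteq> mpow I n"
  using ideal_prod_inter[OF mpow_ideal[OF I] I, of n] unfolding mpow_Suc by blast

lemma mpow_antimono:
  assumes I: "ideal I R" and "n \<le> k" shows "mpow I k \<subseteq> mpow I n"
  using lift_Suc_antimono_le[of "mpow I", OF mpow_Suc_subset[OF I] assms(2)] .

lemma ideal_prod_subset:
  assumes K: "ideal K R" and "\<And>a b. a \<in> I \<Longrightarrow> b \<in> J \<Longrightarrow> a \<otimes> b \<in> K"
  shows "ideal_prod R I J \<subseteq> K"
proof
  fix z assume "z \<in> ideal_prod R I J"
  then show "z \<in> K" by (induction rule: ideal_prod.induct) (auto intro: assms(2) ideal_add[OF K])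
qed

lemma mpow_pow_mem:
  assumes I: "ideal I R" and "a \<in> I" shows "a [^] (n::nat) \<in> mpow I n"
proof (induction n)
  case 0 then show ?case by (simp add: mpow_0)
next
  case (Suc n)
  have "a \<in> mpow I 1" using assms mpow_1 by simp
  from mpow_add_mem[OF I Suc this] show ?case by simp
qed

end

locale noetherian_local = noetherian_cring +
  fixes m assumes local: "local_ring R m"
begin

lemma m_maximal: "maximalideal m R" using local by (simp add: local_ring_def)

lemma m_prime: "primeideal m R" using maximalideal_prime[OF m_maximal] .

lemma m_ideal: "ideal m R" using primeideal_D(1)[OF m_prime] .

lemma m_carrier: "a \<in> m \<Longrightarrow> a \<in> carrier R" using ideal_carrier[OF m_ideal] .

lemma proper_ideal_subset_m:
  assumes I: "ideal I R" "I \<noteq> carrier R" shows "I \<subseteq> m"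
proof -
  define S where "S = {J. ideal J R \<and> I \<subseteq> J \<and> J \<noteq> carrier R}"
  have "S \<noteq> {}" using I by (auto simp: S_def)
  then obtain M where M: "M \<in> S" and max: "\<And>I. I \<in> S \<Longrightarrow> M \<subseteq> I \<Longrightarrow> I = M"
    by (rule ex_maximal_ideal_in) (auto simp: S_def)
  have "maximalideal M R"
  proof (rule maximalidealI)
    show "ideal M R" "carrier R \<noteq> M" using M by (auto simp: S_def)
    show "J = M \<or> J = carrier R" if "ideal J R" "M \<subseteq> J" "J \<subseteq> carrier R" for J
      using max[of J] that M by (auto simp: S_def)
  qed
  then have "M = m" using local by (simp add: local_ring_def)
  then show ?thesis using M by (auto simp: S_def)
qed

lemma ex_inverse:
  assumes u: "u \<in> carrier R - m"
  shows "\<exists>v\<in>carrier R. v \<otimes> u = \<one>"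
proof (rule ccontr)
  assume n: "\<not> ?thesis"
  have "PIdl u \<noteq> carrier R"
  proof
    assume "PIdl u = carrier R"
    then have "\<one> \<in> PIdl u" by simp
    then show False using n unfolding cgenideal_def by force
  qed
  then have "PIdl u \<subseteq> m" using u by (intro proper_ideal_subset_m cgenideal_ideal) auto
  then show False using u cgenideal_self by blast
qed

lemma cancel_unit:
  assumes J: "ideal J R" and u: "u \<in> carrier R - m" and z: "z \<in> carrier R" "u \<otimes> z \<in> J"
  shows "z \<in> J"
proof -
  obtain v where v: "v \<in> carrier R" "v \<otimes> u = \<one>" using ex_inverse[OF u] by blast
  have "z = v \<otimes> (u \<otimes> z)" using v u z by (simp add: m_assoc[symmetric])
  then show ?thesis using ideal_lmult[OF J z(2) v(1)] by simp
qed

text \<open>Elements outside m are units, so the results on saturated ideals apply to all ideals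
  when P = m.\<close>

lemma ideal_saturated: "ideal J R \<Longrightarrow> saturated m J"
  unfolding saturated_def using cancel_unit by blast

lemma krull_intersection:
  assumes J: "ideal J R" and y: "y \<in> m" and z: "z \<in> carrier R"
    and zJ: "\<And>k. z \<in> adj J (y [^] (k::nat))"
  shows "z \<in> J"
proof (rule krull_intersection_sat[OF m_prime ideal_saturated[OF J] y z])
  fix k :: nat
  have "ideal (adj J (y [^] k)) R" by (intro ideal_adj J) (simp add: m_carrier y)
  from sat_superset[OF m_prime this] zJ show "z \<in> sat m (adj J (y [^] k))" by blast
qed

text \<open>Turns nilpotence of single elements into one exponent for all of m. For a maximal
  counterexample M and g with m g inside M, a power of m lies in M + (g), and one further factor
  from m brings it into M.\<close>

lemma mpow_subset_of_nil:
  assumes B: "ideal B R" and nil: "\<And>y. y \<in> m \<Longrightarrow> \<exists>k::nat. y [^] k \<in> B"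
  shows "\<exists>N. mpow m N \<subseteq> B"
proof (rule ccontr)
  assume neg: "\<not> ?thesis"
  define S where "S = {B. ideal B R \<and> (\<forall>y\<in>m. \<exists>k::nat. y [^] k \<in> B) \<and> \<not> (\<exists>N. mpow m N \<subseteq> B)}"
  have "S \<noteq> {}" using B nil neg by (auto simp: S_def)
  then obtain M where M: "M \<in> S" and max: "\<And>I. I \<in> S \<Longrightarrow> M \<subseteq> I \<Longrightarrow> I = M"
    by (rule ex_maximal_ideal_in) (auto simp: S_def)
  have iM: "ideal M R" and nilM: "\<forall>y\<in>m. \<exists>k::nat. y [^] k \<in> M" and no: "\<And>N. \<not> mpow m N \<subseteq> M"
    using M by (auto simp: S_def)
  have "prime_nil m M" unfolding prime_nil_def
  proof
    fix y assume y: "y \<in> m"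
    then obtain k where "y [^] (k::nat) \<in> M" using nilM by blast
    then have "\<one> \<otimes> y [^] k \<in> M" using m_carrier[OF y] by simp
    then show "\<exists>u\<in>carrier R - m. \<exists>N::nat. u \<otimes> y [^] N \<in> M" using one_notin_prime[OF m_prime] by blast
  qed
  moreover have "M \<noteq> carrier R" using no[of 0] by (auto simp: mpow_0)
  ultimately obtain g where g: "g \<in> carrier R" "g \<notin> M" and mg: "\<And>p. p \<in> m \<Longrightarrow> p \<otimes> g \<in> M"
    using ex_socle_element[OF m_prime ideal_saturated[OF iM]] by blast
  have "adj M g \<notin> S" using max[of "adj M g"] subset_adj[OF iM g(1)] self_adj[OF iM g(1)] g(2) by blast
  then obtain N where N: "mpow m N \<subseteq> adj M g"
    using nilM subset_adj[OF iM g(1)] ideal_adj[OF iM g(1)] unfolding S_def by blast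
  have "mpow m (Suc N) \<subseteq> M" unfolding mpow_Suc
  proof (rule ideal_prod_subset[OF iM])
    fix a b assume "a \<in> mpow m N" and b: "b \<in> m"
    then obtain j c where a: "j \<in> M" "c \<in> carrier R" "a = j \<oplus> c \<otimes> g"
      using N mem_adj[OF g(1), of a M] by blast
    have "a \<otimes> b = b \<otimes> j \<oplus> c \<otimes> (b \<otimes> g)" unfolding a(3)
      using ideal_carrier[OF iM a(1)] a(2) g(1) m_carrier[OF b] by algebra
    also have "\<dots> \<in> M" using a(2) m_carrier[OF b] by (intro ideal_add[OF iM] ideal_lmult[OF iM mg[OF b]] ideal_lmult[OF iM a(1)])
    finally show "a \<otimes> b \<in> M" .
  qed
  then show False using no by blast
qed

text \<open>The residue of z in R/J has order at least n, that is, z lies in m^n + J.\<close>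

definition in_ord :: "'a set \<Rightarrow> nat \<Rightarrow> 'a \<Rightarrow> bool" where
  "in_ord J n z \<longleftrightarrow> z \<in> carrier R \<and> (\<exists>h\<in>mpow m n. z \<ominus> h \<in> J)"

lemma krull_intersection_mpow:
  assumes J: "ideal J R" and z: "\<And>n. in_ord J n z"
  shows "z \<in> J"
proof (rule ccontr)
  assume "z \<notin> J"
  have zc: "z \<in> carrier R" using z by (auto simp: in_ord_def)
  obtain B where B: "saturated m B" "J \<subseteq> B" "z \<notin> B" "\<And>y. y \<in> m \<Longrightarrow> \<exists>k::nat. y [^] k \<in> B"
    using ex_nil_avoiding[OF m_prime ideal_saturated[OF J] zc \<open>z \<notin> J\<close>] by blast
  have iB: "ideal B R" using B(1) by (rule saturated_ideal)
  obtain N where N: "mpow m N \<subseteq> B" using mpow_subset_of_nil[OF iB B(4)] by blast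
  obtain h where h: "h \<in> mpow m N" "z \<ominus> h \<in> J" using z[of N] by (auto simp: in_ord_def)
  have hc: "h \<in> carrier R" using h(1) N ideal_carrier[OF iB] by blast
  have "z = (z \<ominus> h) \<oplus> h" using zc hc by algebra
  also have "\<dots> \<in> B" using h N B(2) by (intro ideal_add[OF iB]) auto
  finally show False using B(3) by simp
qed

lemma in_ord_0: "ideal J R \<Longrightarrow> z \<in> carrier R \<Longrightarrow> in_ord J 0 z"
  unfolding in_ord_def mpow_0 by (auto intro!: bexI[of _ z] simp: ideal_zero a_minus_def r_neg)

lemma ex_ord:
  assumes J: "ideal J R" and z: "z \<in> carrier R" "z \<notin> J"
  shows "\<exists>n. in_ord J n z \<and> \<not> in_ord J (Suc n) z"
proof (rule ccontr)
  assume "\<not> ?thesis"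
  then have "in_ord J n z \<Longrightarrow> in_ord J (Suc n) z" for n by blast
  then have "in_ord J n z" for n by (induction n) (use in_ord_0[OF J z(1)] in auto)
  then show False using krull_intersection_mpow[OF J] z(2) by blast
qed

end

section \<open>Polynomial functions of one variable modulo a prime\<close>

context cring
begin

text \<open>Polynomial functions of degree at most n in Horner form. Only values on the carrier
  matter; coefficients need not be unique.\<close>

primrec upoly :: "nat \<Rightarrow> ('a \<Rightarrow> 'a) \<Rightarrow> bool" where
  "upoly 0 f \<longleftrightarrow> (\<exists>r\<in>carrier R. \<forall>t\<in>carrier R. f t = r)"
| "upoly (Suc n) f \<longleftrightarrow> (\<exists>r\<in>carrier R. \<exists>g. upoly n g \<and> (\<forall>t\<in>carrier R. f t = r \<oplus> t \<otimes> g t))"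

lemma upoly_closed: "upoly n f \<Longrightarrow> t \<in> carrier R \<Longrightarrow> f t \<in> carrier R"
  by (induction n arbitrary: f) auto

lemma upoly_cong: "upoly n f \<Longrightarrow> (\<And>t. t \<in> carrier R \<Longrightarrow> f' t = f t) \<Longrightarrow> upoly n f'"
  by (cases n) auto

lemma upoly_Suc: "upoly n f \<Longrightarrow> upoly (Suc n) f"
proof (induction n arbitrary: f)
  case 0
  then obtain r where r: "r \<in> carrier R" "\<forall>t\<in>carrier R. f t = r" by auto
  then have "f t = r \<oplus> t \<otimes> \<zero>" if "t \<in> carrier R" for t using that by simp
  moreover have "upoly 0 (\<lambda>_. \<zero>)" by (auto intro: bexI[of _ \<zero>])
  ultimately show ?case unfolding upoly.simps(2) using r(1) by (intro bexI[of _ r] exI[of _ "\<lambda>_. \<zero>"]) auto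
next
  case (Suc n)
  then obtain r g where "r \<in> carrier R" "upoly n g" "\<forall>t\<in>carrier R. f t = r \<oplus> t \<otimes> g t" by auto
  then show ?case using Suc.IH[of g] unfolding upoly.simps(2)[of "Suc n" f] by (intro bexI[of _ r] exI[of _ g] conjI)
qed

lemma upoly_const: "r \<in> carrier R \<Longrightarrow> upoly n (\<lambda>_. r)"
  by (induction n) (auto intro: upoly_Suc simp del: upoly.simps(2))

lemma upoly_add: "upoly n f \<Longrightarrow> upoly n g \<Longrightarrow> upoly n (\<lambda>t. f t \<oplus> g t)"
proof (induction n arbitrary: f g)
  case 0 then show ?case by auto
next
  case (Suc n)
  obtain r f' where f: "r \<in> carrier R" "upoly n f'" "\<forall>t\<in>carrier R. f t = r \<oplus> t \<otimes> f' t" using Suc.prems(1) by auto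
  obtain s g' where g: "s \<in> carrier R" "upoly n g'" "\<forall>t\<in>carrier R. g t = s \<oplus> t \<otimes> g' t" using Suc.prems(2) by auto
  have "f t \<oplus> g t = (r \<oplus> s) \<oplus> t \<otimes> (f' t \<oplus> g' t)" if t: "t \<in> carrier R" for t
    using f g t upoly_closed[OF f(2) t] upoly_closed[OF g(2) t] by (simp, algebra)
  then show ?case using Suc.IH[OF f(2) g(2)] f(1) g(1)
    by (auto intro!: bexI[of _ "r \<oplus> s"] exI[of _ "\<lambda>t. f' t \<oplus> g' t"])
qed

lemma upoly_scale: "upoly n f \<Longrightarrow> c \<in> carrier R \<Longrightarrow> upoly n (\<lambda>t. c \<otimes> f t)"
proof (induction n arbitrary: f)
  case 0 then show ?case by auto
next
  case (Suc n)
  obtain r f' where f: "r \<in> carrier R" "upoly n f'" "\<forall>t\<in>carrier R. f t = r \<oplus> t \<otimes> f' t" using Suc.prems(1) by auto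
  have "c \<otimes> f t = c \<otimes> r \<oplus> t \<otimes> (c \<otimes> f' t)" if t: "t \<in> carrier R" for t
    using f t upoly_closed[OF f(2) t] Suc.prems(2) by (simp, algebra)
  then show ?case using Suc.IH[OF f(2) Suc.prems(2)] f(1) Suc.prems(2)
    by (auto intro!: bexI[of _ "c \<otimes> r"] exI[of _ "\<lambda>t. c \<otimes> f' t"])
qed

lemma upoly_linear_mult:
  assumes "upoly n f" "a \<in> carrier R" "b \<in> carrier R"
  shows "upoly (Suc n) (\<lambda>t. (a \<oplus> t \<otimes> b) \<otimes> f t)"
proof -
  have "upoly (Suc n) (\<lambda>t. \<zero> \<oplus> t \<otimes> (b \<otimes> f t))"
    unfolding upoly.simps(2) using upoly_scale[OF assms(1,3)] by (intro bexI[of _ \<zero>] exI[of _ "\<lambda>t. b \<otimes> f t"]) auto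
  from upoly_add[OF upoly_Suc[OF upoly_scale[OF assms(1,2)]] this] show ?thesis
  proof (rule upoly_cong)
    fix t assume t: "t \<in> carrier R"
    show "(a \<oplus> t \<otimes> b) \<otimes> f t = a \<otimes> f t \<oplus> (\<zero> \<oplus> t \<otimes> (b \<otimes> f t))"
      using assms(2,3) t upoly_closed[OF assms(1) t] by algebra
  qed
qed

lemma upoly_factor:
  assumes "upoly (Suc n) f" "s \<in> carrier R"
  obtains q where "upoly n q" "\<And>t. t \<in> carrier R \<Longrightarrow> f t = f s \<oplus> (t \<ominus> s) \<otimes> q t"
  using assms
proof (induction n arbitrary: f thesis)
  case 0
  then obtain r g where "r \<in> carrier R" "upoly 0 g" "\<forall>t\<in>carrier R. f t = r \<oplus> t \<otimes> g t" by auto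
  then obtain r' where r: "r \<in> carrier R" "r' \<in> carrier R" "\<forall>t\<in>carrier R. f t = r \<oplus> t \<otimes> r'" by auto
  show ?case
  proof (rule "0.prems"(1))
    show "upoly 0 (\<lambda>_. r')" using r by auto
    show "f t = f s \<oplus> (t \<ominus> s) \<otimes> r'" if t: "t \<in> carrier R" for t using r t assms(2) by (simp, algebra)
  qed
next
  case (Suc n)
  obtain r g where f: "r \<in> carrier R" "upoly (Suc n) g" "\<forall>t\<in>carrier R. f t = r \<oplus> t \<otimes> g t" using Suc.prems(2) by auto
  obtain q where q: "upoly n q" "\<And>t. t \<in> carrier R \<Longrightarrow> g t = g s \<oplus> (t \<ominus> s) \<otimes> q t"
    using Suc.IH[OF _ f(2) assms(2)] by blast
  have gs: "g s \<in> carrier R" using upoly_closed[OF f(2) assms(2)] .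
  show ?case
  proof (rule Suc.prems(1))
    show "upoly (Suc n) (\<lambda>t. g s \<oplus> t \<otimes> q t)" using q(1) gs by auto
    fix t assume t: "t \<in> carrier R"
    have qt: "q t \<in> carrier R" using upoly_closed[OF q(1) t] .
    have "f t = r \<oplus> t \<otimes> (g s \<oplus> (t \<ominus> s) \<otimes> q t)" using f(3) q(2)[OF t] t by simp
    also have "\<dots> = (r \<oplus> s \<otimes> g s) \<oplus> (t \<ominus> s) \<otimes> (g s \<oplus> t \<otimes> q t)" using f(1) gs qt t assms(2) by algebra
    also have "r \<oplus> s \<otimes> g s = f s" using f(3) assms(2) by simp
    finally show "f t = f s \<oplus> (t \<ominus> s) \<otimes> (g s \<oplus> t \<otimes> q t)" .
  qed
qed

text \<open>The usual root count by splitting off a linear factor at each root. Roots are counted as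
  cosets of P, and the point \<open>t0\<close> shows that the function is not zero modulo P.\<close>

lemma upoly_finite_roots:
  assumes P: "primeideal P R" and "upoly n f" and "t0 \<in> carrier R" "f t0 \<notin> P"
  shows "finite {P +> t | t. t \<in> carrier R \<and> f t \<in> P}"
  using assms(2,4)
proof (induction n arbitrary: f)
  case 0
  then have eq: "{P +> t | t. t \<in> carrier R \<and> f t \<in> P} = {}" using assms(3) by auto
  show ?case unfolding eq by simp
next
  case (Suc n)
  show ?case
  proof (cases "\<exists>s\<in>carrier R. f s \<in> P")
    case False
    then have eq: "{P +> t | t. t \<in> carrier R \<and> f t \<in> P} = {}" by auto
    show ?thesis unfolding eq by simp
  next
    case True
    then obtain s where s: "s \<in> carrier R" "f s \<in> P" by blast
    obtain q where q: "upoly n q" "\<And>t. t \<in> carrier R \<Longrightarrow> f t = f s \<oplus> (t \<ominus> s) \<otimes> q t"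
      using upoly_factor[OF Suc.prems(1) s(1)] by blast
    note iP = primeideal_D(1)[OF P]
    have q0: "q t0 \<notin> P"
    proof
      assume "q t0 \<in> P"
      then have "f t0 \<in> P" unfolding q(2)[OF assms(3)] using s assms(3) by (intro ideal_add[OF iP] ideal_lmult[OF iP]) auto
      then show False using Suc.prems(2) by simp
    qed
    have "{P +> t | t. t \<in> carrier R \<and> f t \<in> P} \<subseteq> insert (P +> s) {P +> t | t. t \<in> carrier R \<and> q t \<in> P}"
    proof
      fix z assume "z \<in> {P +> t | t. t \<in> carrier R \<and> f t \<in> P}"
      then obtain t where t: "z = P +> t" "t \<in> carrier R" "f t \<in> P" by blast
      have qt: "q t \<in> carrier R" "f s \<in> carrier R" using upoly_closed[OF q(1) t(2)] upoly_closed[OF Suc.prems(1) s(1)] by auto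
      have "(t \<ominus> s) \<otimes> q t = f t \<ominus> f s" unfolding q(2)[OF t(2)] using s(1) t(2) qt by algebra
      also have "\<dots> \<in> P" using s t by (intro ideal_minus[OF iP])
      finally have "t \<ominus> s \<in> P \<or> q t \<in> P" using primeideal_D(4)[OF P, of "t \<ominus> s" "q t"] t(2) s(1) qt(1) by auto
      then show "z \<in> insert (P +> s) {P +> t | t. t \<in> carrier R \<and> q t \<in> P}"
        using quotient_eq_iff_same_a_r_cos[OF iP t(2) s(1)] t by blast
    qed
    then show ?thesis using Suc.IH[OF q(1) q0] by (rule finite_subset[OF _ finite.insertI])
  qed
qed

lemma upoly_common_nonroot:
  assumes P: "primeideal P R" and inf: "infinite (carrier (R Quot P))"
    and "upoly n f" "s \<in> carrier R" "f s \<notin> P" and "upoly k g" "t \<in> carrier R" "g t \<notin> P"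
  obtains c where "c \<in> carrier R" "f c \<notin> P" "g c \<notin> P"
proof -
  let ?A = "{P +> t | t. t \<in> carrier R \<and> f t \<in> P}" and ?B = "{P +> t | t. t \<in> carrier R \<and> g t \<in> P}"
  have "finite (?A \<union> ?B)" using upoly_finite_roots[OF P] assms by blast
  moreover have "carrier (R Quot P) = {P +> t | t. t \<in> carrier R}" by (auto simp: FactRing_def A_RCOSETS_def')
  ultimately obtain z where "z \<in> {P +> t | t. t \<in> carrier R}" "z \<notin> ?A \<union> ?B" using inf finite_subset by (metis (no_types, lifting) subsetI)
  then show ?thesis using that by blast
qed

end

section \<open>Forms in the generators of the maximal ideal\<close>

context cring
begin

text \<open>\<open>hform x ys p a \<phi>\<close>: the element \<open>a\<close> is the value at \<open>(x, ys)\<close> of a form \<open>F\<close> of degree \<open>p\<close>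
  whose dehomogenisation \<open>F(1, \<cdot>)\<close> is the polynomial function \<open>\<phi>\<close>.\<close>

inductive hform :: "'a \<Rightarrow> 'a list \<Rightarrow> nat \<Rightarrow> 'a \<Rightarrow> ('a list \<Rightarrow> 'a) \<Rightarrow> bool" for x where
  hform_Nil: "r \<in> carrier R \<Longrightarrow> hform x [] p (r \<otimes> x [^] p) (\<lambda>_. r)"
| hform_0: "r \<in> carrier R \<Longrightarrow> hform x (y # ys) 0 r (\<lambda>_. r)"
| hform_Suc: "hform x ys (Suc p) a0 \<phi>0 \<Longrightarrow> hform x (y # ys) p a1 \<phi>1 \<Longrightarrow>
    hform x (y # ys) (Suc p) (a0 \<oplus> y \<otimes> a1) (\<lambda>cs. \<phi>0 (tl cs) \<oplus> hd cs \<otimes> \<phi>1 cs)"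

definition points :: "'a list \<Rightarrow> 'a list set" where
  "points ys = {cs. length cs = length ys \<and> set cs \<subseteq> carrier R}"

lemma points_Cons: "cs \<in> points (y # ys) \<longleftrightarrow> (\<exists>c cs'. cs = c # cs' \<and> c \<in> carrier R \<and> cs' \<in> points ys)"
  by (cases cs) (auto simp: points_def)

lemma hform_carrier:
  assumes "hform x ys p a \<phi>" "x \<in> carrier R" "set ys \<subseteq> carrier R"
  shows "a \<in> carrier R"
  using assms by induction auto

lemma hform_fun_carrier:
  assumes "hform x ys p a \<phi>" "cs \<in> points ys"
  shows "\<phi> cs \<in> carrier R"
  using assms
proof (induction arbitrary: cs)
  case (hform_Suc ys p a0 \<phi>0 y a1 \<phi>1)
  obtain c cs' where c: "cs = c # cs'" "c \<in> carrier R" "cs' \<in> points ys"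
    using hform_Suc.prems by (auto simp: points_Cons)
  then show ?case using hform_Suc.IH(1)[OF c(3)] hform_Suc.IH(2)[OF hform_Suc.prems] by simp
qed auto

text \<open>The values alone, without the dehomogenisation: closure under sums, multiples and
  products with generators is needed only for these.\<close>

definition hforms :: "'a \<Rightarrow> 'a list \<Rightarrow> nat \<Rightarrow> 'a set" where
  "hforms x ys p = {a. \<exists>\<phi>. hform x ys p a \<phi>}"

lemma hforms_Suc:
  "a0 \<in> hforms x ys (Suc p) \<Longrightarrow> a1 \<in> hforms x (y # ys) p \<Longrightarrow> a0 \<oplus> y \<otimes> a1 \<in> hforms x (y # ys) (Suc p)"
  unfolding hforms_def using hform_Suc by blast

lemma hforms_0: "r \<in> carrier R \<Longrightarrow> r \<in> hforms x ys 0"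
proof (cases ys)
  case Nil
  assume r: "r \<in> carrier R"
  from hform_Nil[OF this, of x 0] show ?thesis unfolding hforms_def Nil using r by auto
next
  case (Cons y zs)
  assume "r \<in> carrier R"
  from hform_0[OF this] show ?thesis unfolding hforms_def Cons by auto
qed

lemma hforms_Nil: "r \<in> carrier R \<Longrightarrow> r \<otimes> x [^] p \<in> hforms x [] p"
  unfolding hforms_def using hform_Nil by blast

lemma hforms_NilE: "a \<in> hforms x [] p \<Longrightarrow> \<exists>r\<in>carrier R. a = r \<otimes> x [^] p"
  unfolding hforms_def by (auto elim: hform.cases)

lemma hforms_SucE:
  "a \<in> hforms x (y # ys) (Suc p) \<Longrightarrow>
    \<exists>a0\<in>hforms x ys (Suc p). \<exists>a1\<in>hforms x (y # ys) p. a = a0 \<oplus> y \<otimes> a1"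
  unfolding hforms_def by (auto elim!: hform.cases[of x "y # ys" "Suc p"])

lemma hforms_carrier:
  "x \<in> carrier R \<Longrightarrow> set ys \<subseteq> carrier R \<Longrightarrow> a \<in> hforms x ys p \<Longrightarrow> a \<in> carrier R"
  unfolding hforms_def using hform_carrier by blast

context
  fixes x assumes x: "x \<in> carrier R"
begin

lemma hforms_add:
  "set ys \<subseteq> carrier R \<Longrightarrow> a \<in> hforms x ys p \<Longrightarrow> b \<in> hforms x ys p \<Longrightarrow> a \<oplus> b \<in> hforms x ys p"
proof (induction ys arbitrary: p a b)
  case Nil
  then obtain r s where rs: "r \<in> carrier R" "s \<in> carrier R" "a = r \<otimes> x [^] p" "b = s \<otimes> x [^] p" using hforms_NilE by metis
  then have "a \<oplus> b = (r \<oplus> s) \<otimes> x [^] p" using x by (simp add: l_distr)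
  then show ?case using hforms_Nil[of "r \<oplus> s"] rs by simp
next
  case (Cons y ys)
  show ?case using Cons.prems
  proof (induction p arbitrary: a b)
    case 0
    then show ?case using hforms_carrier[OF x "0"(1)] by (intro hforms_0) auto
  next
    case (Suc p)
    obtain a0 a1 where a: "a0 \<in> hforms x ys (Suc p)" "a1 \<in> hforms x (y # ys) p" "a = a0 \<oplus> y \<otimes> a1" using hforms_SucE[OF Suc.prems(2)] by blast
    obtain b0 b1 where b: "b0 \<in> hforms x ys (Suc p)" "b1 \<in> hforms x (y # ys) p" "b = b0 \<oplus> y \<otimes> b1" using hforms_SucE[OF Suc.prems(3)] by blast
    have ys: "set ys \<subseteq> carrier R" "y \<in> carrier R" using Suc.prems(1) by auto
    have c: "a0 \<in> carrier R" "a1 \<in> carrier R" "b0 \<in> carrier R" "b1 \<in> carrier R"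
      using a b hforms_carrier[OF x ys(1)] hforms_carrier[OF x Suc.prems(1)] by auto
    have "a \<oplus> b = (a0 \<oplus> b0) \<oplus> y \<otimes> (a1 \<oplus> b1)" unfolding a(3) b(3) using c ys(2) by algebra
    then show ?case using hforms_Suc[OF Cons.IH[OF ys(1) a(1) b(1)] Suc.IH[OF Suc.prems(1) a(2) b(2)]] by simp
  qed
qed

lemma hforms_scale:
  "set ys \<subseteq> carrier R \<Longrightarrow> a \<in> hforms x ys p \<Longrightarrow> c \<in> carrier R \<Longrightarrow> c \<otimes> a \<in> hforms x ys p"
proof (induction ys arbitrary: p a)
  case Nil
  then obtain r where r: "r \<in> carrier R" "a = r \<otimes> x [^] p" using hforms_NilE by metis
  then have "c \<otimes> a = (c \<otimes> r) \<otimes> x [^] p" using x Nil by (simp add: m_assoc)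
  then show ?case using hforms_Nil[of "c \<otimes> r"] r Nil by simp
next
  case (Cons y ys)
  show ?case using Cons.prems
  proof (induction p arbitrary: a)
    case 0
    then show ?case using hforms_carrier[OF x "0"(1)] by (intro hforms_0) auto
  next
    case (Suc p)
    obtain a0 a1 where a: "a0 \<in> hforms x ys (Suc p)" "a1 \<in> hforms x (y # ys) p" "a = a0 \<oplus> y \<otimes> a1" using hforms_SucE[OF Suc.prems(2)] by blast
    have ys: "set ys \<subseteq> carrier R" "y \<in> carrier R" using Suc.prems(1) by auto
    have k: "a0 \<in> carrier R" "a1 \<in> carrier R"
      using a hforms_carrier[OF x ys(1)] hforms_carrier[OF x Suc.prems(1)] by auto
    have "c \<otimes> a = (c \<otimes> a0) \<oplus> y \<otimes> (c \<otimes> a1)" unfolding a(3) using k ys(2) Suc.prems(3) by algebra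
    then show ?case using hforms_Suc[OF Cons.IH[OF ys(1) a(1) Suc.prems(3)] Suc.IH[OF Suc.prems(1) a(2) Suc.prems(3)]] by simp
  qed
qed

lemma hforms_zero: "set ys \<subseteq> carrier R \<Longrightarrow> \<zero> \<in> hforms x ys p"
proof (induction ys arbitrary: p)
  case Nil then show ?case using hforms_Nil[of \<zero> x p] x by simp
next
  case (Cons y ys)
  show ?case
  proof (induction p)
    case 0 then show ?case by (intro hforms_0) simp
  next
    case (Suc p)
    then show ?case using hforms_Suc[OF Cons.IH[of "Suc p"] Suc] Cons.prems by simp
  qed
qed

lemma hforms_mult:
  "set ys \<subseteq> carrier R \<Longrightarrow> a \<in> hforms x ys p \<Longrightarrow> g \<in> insert x (set ys) \<Longrightarrow> g \<otimes> a \<in> hforms x ys (Suc p)"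
proof (induction ys arbitrary: p a)
  case Nil
  then obtain r where r: "r \<in> carrier R" "a = r \<otimes> x [^] p" using hforms_NilE by metis
  then have "g \<otimes> a = r \<otimes> x [^] Suc p" using x Nil by (simp add: m_ac)
  then show ?case using hforms_Nil[of r x "Suc p"] r Nil by simp
next
  case (Cons y ys)
  have ys: "set ys \<subseteq> carrier R" "y \<in> carrier R" using Cons.prems(1) by auto
  have gc: "g \<in> carrier R" using Cons.prems(1,3) x by auto
  have ac: "a \<in> carrier R" using hforms_carrier[OF x Cons.prems(1,2)] .
  show ?case
  proof (cases "g \<in> insert x (set ys)")
    case False
    then have "g = y" using Cons.prems(3) by auto
    then have "g \<otimes> a = \<zero> \<oplus> y \<otimes> a" using ac ys by simp
    then show ?thesis using hforms_Suc[OF hforms_zero[OF ys(1)] Cons.prems(2)] by simp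
  next
    case True
    show ?thesis using Cons.prems(2) ac
    proof (induction p arbitrary: a)
      case 0
      have "g \<otimes> a = g \<otimes> a \<oplus> y \<otimes> \<zero>" using gc ys 0 by simp
      moreover have "g \<otimes> a \<in> hforms x ys (Suc 0)" using Cons.IH[OF ys(1) hforms_0[OF "0"(2)] True] .
      ultimately show ?case using hforms_Suc[OF _ hforms_zero[OF Cons.prems(1)], of "g \<otimes> a"] by simp
    next
      case (Suc p)
      obtain a0 a1 where a: "a0 \<in> hforms x ys (Suc p)" "a1 \<in> hforms x (y # ys) p" "a = a0 \<oplus> y \<otimes> a1" using hforms_SucE[OF Suc.prems(1)] by blast
      have k: "a0 \<in> carrier R" "a1 \<in> carrier R"
        using a hforms_carrier[OF x ys(1)] hforms_carrier[OF x Cons.prems(1)] by auto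
      have "g \<otimes> a = (g \<otimes> a0) \<oplus> y \<otimes> (g \<otimes> a1)" unfolding a(3) using k ys(2) gc by algebra
      then show ?case using hforms_Suc[OF Cons.IH[OF ys(1) a(1) True] Suc.IH[OF a(2) k(2)]] by simp
    qed
  qed
qed

text \<open>Homogeneity: where each y equals c x, a form F of degree p satisfies F(x, ys) = F(1, cs)
  x^p. The ideal L need only contain the equations y - c x of that line.\<close>

lemma hform_mod:
  assumes "hform x ys p a \<phi>" "set ys \<subseteq> carrier R" "cs \<in> points ys"
    and L: "ideal L R" and "list_all2 (\<lambda>y c. y \<ominus> c \<otimes> x \<in> L) ys cs"
  shows "a \<ominus> \<phi> cs \<otimes> x [^] p \<in> L"
  using assms(1-3,5)
proof (induction arbitrary: cs)
  case (hform_Nil r p)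
  then show ?case using ideal_zero[OF L] x by (simp add: a_minus_def r_neg)
next
  case (hform_0 r y ys)
  then show ?case using ideal_zero[OF L] x by (simp add: a_minus_def r_neg)
next
  case (hform_Suc ys p a0 \<phi>0 y a1 \<phi>1)
  obtain c cs' where c: "cs = c # cs'" "c \<in> carrier R" "cs' \<in> points ys"
    using hform_Suc.prems by (auto simp: points_Cons)
  have l: "y \<ominus> c \<otimes> x \<in> L" "list_all2 (\<lambda>y c. y \<ominus> c \<otimes> x \<in> L) ys cs'" using hform_Suc.prems(3) c(1) by auto
  have ys: "set ys \<subseteq> carrier R" "y \<in> carrier R" using hform_Suc.prems(1) by auto
  define w where "w = x [^] p"
  have w: "w \<in> carrier R" "x [^] Suc p = w \<otimes> x" using x by (auto simp: w_def)
  have k: "a0 \<in> carrier R" "a1 \<in> carrier R" "\<phi>0 cs' \<in> carrier R" "\<phi>1 cs \<in> carrier R"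
    using hform_carrier[OF hform_Suc.hyps(1) x ys(1)] hform_carrier[OF hform_Suc.hyps(2) x hform_Suc.prems(1)]
      hform_fun_carrier[OF hform_Suc.hyps(1) c(3)] hform_fun_carrier[OF hform_Suc.hyps(2) hform_Suc.prems(2)] by auto
  have 1: "a0 \<ominus> \<phi>0 cs' \<otimes> (w \<otimes> x) \<in> L" using hform_Suc.IH(1)[OF ys(1) c(3) l(2)] w(2) by simp
  have 2: "a1 \<ominus> \<phi>1 cs \<otimes> w \<in> L" using hform_Suc.IH(2)[OF hform_Suc.prems] w_def by simp
  have "(a0 \<oplus> y \<otimes> a1) \<ominus> (\<phi>0 cs' \<oplus> c \<otimes> \<phi>1 cs) \<otimes> (w \<otimes> x)
    = (a0 \<ominus> \<phi>0 cs' \<otimes> (w \<otimes> x)) \<oplus> y \<otimes> (a1 \<ominus> \<phi>1 cs \<otimes> w) \<oplus> (\<phi>1 cs \<otimes> w) \<otimes> (y \<ominus> c \<otimes> x)"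
    using k c(2) ys(2) w(1) x by algebra
  also have "\<dots> \<in> L" using k w(1) ys(2) by (intro ideal_add[OF L] ideal_lmult[OF L 2] ideal_lmult[OF L l(1)] 1) auto
  finally show ?case using c(1) w(2) by simp
qed

end

text \<open>The line through two points, with \<open>ps\<close> at parameter zero and
  \<open>qs\<close> at parameter one. Restriction to it reduces several variables to one.\<close>

definition on_line :: "'a list \<Rightarrow> 'a list \<Rightarrow> 'a \<Rightarrow> 'a list" where
  "on_line ps qs t = map2 (\<lambda>a b. a \<oplus> t \<otimes> (b \<ominus> a)) ps qs"

lemma on_line_points:
  assumes "ps \<in> points ys" "qs \<in> points ys" "t \<in> carrier R"
  shows "on_line ps qs t \<in> points ys"
proof -
  have "a \<oplus> t \<otimes> (b \<ominus> a) \<in> carrier R" if "a \<in> carrier R" "b \<in> carrier R" for a b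
    using that assms(3) by simp
  moreover have "a \<in> carrier R \<and> b \<in> carrier R" if "(a, b) \<in> set (zip ps qs)" for a b
    using assms(1,2) set_zip_leftD[OF that] set_zip_rightD[OF that] unfolding points_def by blast
  ultimately show ?thesis using assms(1,2) unfolding points_def on_line_def by auto
qed

lemma on_line_0:
  assumes "ps \<in> points ys" "qs \<in> points ys" shows "on_line ps qs \<zero> = ps"
proof -
  have "a \<oplus> \<zero> \<otimes> (b \<ominus> a) = a" if "a \<in> carrier R" "b \<in> carrier R" for a b
    using that by simp
  then show ?thesis using assms unfolding points_def on_line_def
    by (auto intro!: nth_equalityI simp: subset_iff)
qed

lemma on_line_1: "ps \<in> points ys \<Longrightarrow> qs \<in> points ys \<Longrightarrow> on_line ps qs \<one> = qs"
proof -
  assume a: "ps \<in> points ys" "qs \<in> points ys"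
  have "a \<oplus> \<one> \<otimes> (b \<ominus> a) = b" if "a \<in> carrier R" "b \<in> carrier R" for a b using that by algebra
  then show ?thesis using a unfolding points_def on_line_def by (auto intro!: nth_equalityI simp: subset_iff)
qed

lemma hform_upoly:
  assumes "hform x ys p a \<phi>" "ps \<in> points ys" "qs \<in> points ys"
  shows "upoly p (\<lambda>t. \<phi> (on_line ps qs t))"
  using assms
proof (induction arbitrary: ps qs)
  case (hform_Nil r p)
  then show ?case by (simp add: upoly_const)
next
  case (hform_0 r y ys)
  then show ?case by (simp add: upoly_const del: upoly.simps)
next
  case (hform_Suc ys p a0 \<phi>0 y a1 \<phi>1)
  obtain c ps' where c: "ps = c # ps'" "c \<in> carrier R" "ps' \<in> points ys"
    using hform_Suc.prems by (auto simp: points_Cons)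
  obtain d qs' where d: "qs = d # qs'" "d \<in> carrier R" "qs' \<in> points ys"
    using hform_Suc.prems by (auto simp: points_Cons)
  have "upoly (Suc p) (\<lambda>t. \<phi>0 (on_line ps' qs' t) \<oplus> (c \<oplus> t \<otimes> (d \<ominus> c)) \<otimes> \<phi>1 (on_line ps qs t))"
    using c d by (intro upoly_add hform_Suc.IH(1) upoly_linear_mult hform_Suc.IH(2) hform_Suc.prems) auto
  then show ?case unfolding c(1) d(1) by (simp add: on_line_def del: upoly.simps)
qed

text \<open>On the line joining a nonzero of each form, both restrict to one-variable functions that
  do not vanish modulo P, and infinitely many residues leave a common nonroot.\<close>

lemma hform_common_nonzero:
  assumes P: "primeideal P R" "infinite (carrier (R Quot P))"
    and "hform x ys p a \<phi>" "ps \<in> points ys" "\<phi> ps \<notin> P"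
    and "hform x ys q b \<psi>" "qs \<in> points ys" "\<psi> qs \<notin> P"
  obtains cs where "cs \<in> points ys" "\<phi> cs \<notin> P" "\<psi> cs \<notin> P"
proof -
  have "\<phi> (on_line ps qs \<zero>) \<notin> P" "\<psi> (on_line ps qs \<one>) \<notin> P"
    using assms on_line_0 on_line_1 by auto
  from upoly_common_nonroot[OF P hform_upoly[OF assms(3,4,7)] zero_closed this(1) hform_upoly[OF assms(6,4,7)] one_closed this(2)]
  obtain c where "c \<in> carrier R" "\<phi> (on_line ps qs c) \<notin> P" "\<psi> (on_line ps qs c) \<notin> P" by blast
  then show ?thesis using that on_line_points[OF assms(4,7)] by blast
qed

text \<open>Over an infinite residue ring a form vanishing at all points has all coefficients in P;
  each coefficient then contributes one extra factor from P, which raises the degree p to p +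
  1.\<close>

lemma hform_vanishing:
  assumes P: "primeideal P R" "infinite (carrier (R Quot P))"
    and "hform x ys p a \<phi>" "x \<in> P" "set ys \<subseteq> P" "\<And>cs. cs \<in> points ys \<Longrightarrow> \<phi> cs \<in> P"
  shows "a \<in> mpow P (Suc p)"
  using assms(3-)
proof induction
  note iP = primeideal_D(1)[OF P(1)]
  have P1: "r \<in> mpow P 1" if "r \<in> P" for r using that mpow_1[OF iP] by simp
  {
    case (hform_Nil r p)
    have "[] \<in> points []" by (simp add: points_def)
    then have "r \<in> P" using hform_Nil.prems(3) by blast
    then show ?case using mpow_add_mem[OF iP P1 mpow_pow_mem[OF iP hform_Nil.prems(1)]] by simp
  next
    case (hform_0 r y ys)
    have "replicate (length (y # ys)) \<zero> \<in> points (y # ys)" by (auto simp: points_def)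
    then have "r \<in> P" using hform_0.prems(3) by blast
    then show ?case using P1 by simp
  next
    case (hform_Suc ys p a0 \<phi>0 y a1 \<phi>1)
    have ys: "set ys \<subseteq> P" "y \<in> P" using hform_Suc.prems(2) by auto
    have Pc: "P \<subseteq> carrier R" using primeideal_D(3)[OF P(1)] .
    have k1: "\<phi>1 cs \<in> carrier R" if "cs \<in> points (y # ys)" for cs
      using hform_fun_carrier[OF hform_Suc.hyps(2) that] .
    have v0: "\<phi>0 cs \<in> P" if cs: "cs \<in> points ys" for cs
    proof -
      have 0: "\<zero> # cs \<in> points (y # ys)" using cs by (auto simp: points_Cons)
      show ?thesis
        using hform_Suc.prems(3)[OF 0] k1[OF 0] hform_fun_carrier[OF hform_Suc.hyps(1) cs] by simp
    qed
    have v1: "\<phi>1 cs \<in> P" if cs: "cs \<in> points (y # ys)" for cs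
    proof (rule ccontr)
      assume n: "\<phi>1 cs \<notin> P"
      obtain c cs' where c: "cs = c # cs'" "c \<in> carrier R" "cs' \<in> points ys" using cs by (auto simp: points_Cons)
      \<comment> \<open>The line from \<open>ps\<close> to \<open>qs\<close> varies the first
        coordinate only and is parametrised by t itself. A common nonroot of \<open>\<phi>1\<close>
        and of the function t contradicts the vanishing of t times \<open>\<phi>1\<close>.\<close>
      define ps where "ps = \<zero> # cs'" define qs where "qs = \<one> # cs'"
      have pq: "ps \<in> points (y # ys)" "qs \<in> points (y # ys)" using c by (auto simp: ps_def qs_def points_Cons)
      have l: "on_line ps qs t = t # cs'" if t: "t \<in> carrier R" for t
      proof -
        have "on_line cs' cs' t = cs'"
        proof -
          have "a \<oplus> t \<otimes> (a \<ominus> a) = a" if "a \<in> carrier R" for a using that t by (simp add: a_minus_def r_neg)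
          then show ?thesis using c(3) unfolding on_line_def points_def by (auto intro!: nth_equalityI simp: subset_iff)
        qed
        then show ?thesis using t unfolding ps_def qs_def by (simp add: on_line_def a_minus_def)
      qed
      have u: "upoly p (\<lambda>t. \<phi>1 (on_line ps qs t))" using hform_upoly[OF hform_Suc.hyps(2) pq] .
      have u1: "upoly 1 (\<lambda>t. t)"
        unfolding One_nat_def upoly.simps by (intro bexI[of _ \<zero>] exI[of _ "\<lambda>_. \<one>"] conjI bexI[of _ \<one>]) auto
      obtain t where t: "t \<in> carrier R" "\<phi>1 (on_line ps qs t) \<notin> P" "t \<notin> P"
        using upoly_common_nonroot[OF P u c(2) _ u1 one_closed primeideal_D(2)[OF P(1)]] n l[OF c(2)] c(1) by auto
      have tc: "t # cs' \<in> points (y # ys)" using t c by (auto simp: points_Cons)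
      have "\<phi>0 cs' \<oplus> t \<otimes> \<phi>1 (t # cs') \<in> P" using hform_Suc.prems(3)[OF tc] by simp
      then have "(\<phi>0 cs' \<oplus> t \<otimes> \<phi>1 (t # cs')) \<ominus> \<phi>0 cs' \<in> P" using v0[OF c(3)] by (intro ideal_minus[OF iP])
      moreover have "(\<phi>0 cs' \<oplus> t \<otimes> \<phi>1 (t # cs')) \<ominus> \<phi>0 cs' = t \<otimes> \<phi>1 (t # cs')"
        using k1[OF tc] subsetD[OF Pc v0[OF c(3)]] t(1) by algebra
      ultimately have "t \<otimes> \<phi>1 (t # cs') \<in> P" by simp
      then show False using primeideal_D(4)[OF P(1) t(1) k1[OF tc]] t l[OF t(1)] by auto
    qed
    have 0: "a0 \<in> mpow P (Suc (Suc p))" using hform_Suc.IH(1)[OF hform_Suc.prems(1) ys(1) v0] .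
    have "a1 \<in> mpow P (Suc p)" using hform_Suc.IH(2)[OF hform_Suc.prems(1,2) v1] .
    from mpow_add_mem[OF iP P1[OF ys(2)] this] have "y \<otimes> a1 \<in> mpow P (Suc (Suc p))" by simp
    then show ?case using 0 by (intro ideal_add[OF mpow_ideal[OF iP]])
  }
qed

text \<open>Modulo the generators in B, the p-th power of the ideal consists of forms of degree p in
  the remaining generators.\<close>

lemma mpow_subset_hforms:
  assumes B: "B \<subseteq> carrier R" and x: "x \<in> carrier R" and ys: "set ys \<subseteq> carrier R"
    and m: "I = Idl (B \<union> insert x (set ys))" and z: "z \<in> mpow I p"
  shows "\<exists>h\<in>hforms x ys p. z \<ominus> h \<in> Idl B"
proof -
  let ?b = "Idl B"
  have ib: "ideal ?b R" by (intro genideal_ideal B)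
  have gc: "B \<union> insert x (set ys) \<subseteq> carrier R" using B x ys by auto
  have iI: "ideal I R" unfolding m by (intro genideal_ideal gc)
  define K where "K p = {z \<in> carrier R. \<exists>h\<in>hforms x ys p. z \<ominus> h \<in> ?b}" for p
  note hc = hforms_carrier[OF x ys]
  have iK: "ideal (K p) R" for p
  proof (rule ideal_intro_comm)
    show "K p \<subseteq> carrier R" by (auto simp: K_def)
    show "\<zero> \<in> K p" using hforms_zero[OF x ys] ideal_zero[OF ib] by (auto simp: K_def a_minus_def intro!: bexI[of _ \<zero>])
    show "a \<oplus> b \<in> K p" if "a \<in> K p" "b \<in> K p" for a b
    proof -
      from that obtain h k where h: "h \<in> hforms x ys p" "a \<ominus> h \<in> ?b" "k \<in> hforms x ys p" "b \<ominus> k \<in> ?b"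
        and c: "a \<in> carrier R" "b \<in> carrier R" by (auto simp: K_def)
      have "(a \<oplus> b) \<ominus> (h \<oplus> k) = (a \<ominus> h) \<oplus> (b \<ominus> k)" using c hc[OF h(1)] hc[OF h(3)] by algebra
      then have "(a \<oplus> b) \<ominus> (h \<oplus> k) \<in> ?b" using ideal_add[OF ib h(2,4)] by simp
      then show ?thesis using c hforms_add[OF x ys h(1,3)] unfolding K_def by blast
    qed
    show "r \<otimes> a \<in> K p" if "a \<in> K p" "r \<in> carrier R" for a r
    proof -
      from that obtain h where h: "h \<in> hforms x ys p" "a \<ominus> h \<in> ?b" and c: "a \<in> carrier R" by (auto simp: K_def)
      have "r \<otimes> a \<ominus> r \<otimes> h = r \<otimes> (a \<ominus> h)" using c hc[OF h(1)] that(2) by algebra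
      then have "r \<otimes> a \<ominus> r \<otimes> h \<in> ?b" using ideal_lmult[OF ib h(2) that(2)] by simp
      then show ?thesis using c that(2) hforms_scale[OF x ys h(1) that(2)] unfolding K_def by blast
    qed
  qed
  have "mpow I p \<subseteq> K p"
  proof (induction p)
    case 0
    show ?case
    proof
      fix z assume "z \<in> mpow I 0"
      then have "z \<in> carrier R" by (simp add: mpow_0)
      then show "z \<in> K 0" using hforms_0[of z x ys] ideal_zero[OF ib]
        by (auto simp: K_def a_minus_def r_neg intro!: bexI[of _ z])
    qed
  next
    case (Suc p)
    show ?case unfolding mpow_Suc
    proof (rule ideal_prod_subset[OF iK])
      fix z w assume z: "z \<in> mpow I p" and w: "w \<in> I"
      have zK: "z \<in> K p" using z Suc by blast
      then obtain h where h: "h \<in> hforms x ys p" "z \<ominus> h \<in> ?b" and zc: "z \<in> carrier R" by (auto simp: K_def)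
      \<comment> \<open>For fixed z the admissible second factors form an ideal, so it is enough to
        test the generators.\<close>
      let ?W = "{w \<in> carrier R. z \<otimes> w \<in> K (Suc p)}"
      have iW: "ideal ?W R" by (rule ideal.helper_max_prime[OF iK is_cring zc])
      have "B \<union> insert x (set ys) \<subseteq> ?W"
      proof
        fix g assume g: "g \<in> B \<union> insert x (set ys)"
        have gcr: "g \<in> carrier R" using g gc by blast
        show "g \<in> ?W"
        proof (cases "g \<in> B")
          case True
          then have "g \<in> ?b" using genideal_self[OF B] by blast
          then have "z \<otimes> g \<ominus> \<zero> \<in> ?b" using ideal_lmult[OF ib _ zc] zc gcr by (simp add: a_minus_def)
          then show ?thesis using gcr zc hforms_zero[OF x ys] by (auto simp: K_def)
        next
          case False
          then have "g \<otimes> h \<in> hforms x ys (Suc p)" using hforms_mult[OF x ys h(1)] g by blast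
          moreover have "z \<otimes> g \<ominus> g \<otimes> h = g \<otimes> (z \<ominus> h)" using zc gcr hc[OF h(1)] by algebra
          then have "z \<otimes> g \<ominus> g \<otimes> h \<in> ?b" using ideal_lmult[OF ib h(2) gcr] by simp
          ultimately show ?thesis using gcr zc unfolding K_def by blast
        qed
      qed
      then have "I \<subseteq> ?W" unfolding m by (intro genideal_minimal iW)
      then show "z \<otimes> w \<in> K (Suc p)" using w by blast
    qed
  qed
  then show ?thesis using z by (auto simp: K_def)
qed

end

section \<open>Multiplicativity of the order modulo part of a system of parameters\<close>

context noetherian_local
begin

text \<open>The height theorem in contrapositive form: if only m contained G among the primes inside
  m, the chain of length d, with its top replaced by m, would be too long for G.\<close>

lemma ex_prime_below_m:
  assumes C: "prime_chain R C d" and G: "finite G" "card G < d" "G \<subseteq> m"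
  shows "\<exists>P'. primeideal P' R \<and> G \<subseteq> P' \<and> P' \<subseteq> m \<and> P' \<noteq> m"
proof (rule ccontr)
  assume "\<not> ?thesis"
  then have min: "\<And>P'. primeideal P' R \<Longrightarrow> G \<subseteq> P' \<Longrightarrow> P' \<subseteq> m \<Longrightarrow> P' = m" by blast
  have "prime_chain R (C(d := m)) d" unfolding prime_chain_def
  proof (intro conjI allI impI)
    show "primeideal ((C(d := m)) i) R" if "i \<le> d" for i using that C m_prime by (auto simp: prime_chain_def)
    fix i assume i: "i < d"
    have Ci: "primeideal (C (Suc i)) R" "C i \<subset> C (Suc i)" using C i by (auto simp: prime_chain_def)
    have "C (Suc i) \<subseteq> m" using proper_ideal_subset_m primeideal_D[OF Ci(1)] by (metis one_closed)
    then show "(C(d := m)) i \<subset> (C(d := m)) (Suc i)" using Ci(2) i by auto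
  qed
  then have "d \<le> card G" using height_theorem[OF m_prime G(1) order.refl G(3) min] by simp
  then show False using G(2) by simp
qed

text \<open>Two forms not vanishing modulo \<open>m\<close> stay nonzero at a common point \<open>cs\<close>, hence modulo the
  line \<open>L\<close> through \<open>cs\<close>; were their product of larger order, a power of \<open>x\<close> would lie in \<open>L\<close>,
  against the height theorem.\<close>

lemma order_mult_mod:
  assumes inf: "infinite (carrier (R Quot m))" and C: "prime_chain R C d"
    and B: "finite B" "card B + length ys < d"
    and m: "m = Idl (B \<union> insert x (set ys))" "B \<union> insert x (set ys) \<subseteq> m"
    and a: "in_ord (Idl B) p a" "\<not> in_ord (Idl B) (Suc p) a"
    and b: "in_ord (Idl B) q b" "\<not> in_ord (Idl B) (Suc q) b"
  shows "\<not> in_ord (Idl B) (Suc (p + q)) (a \<otimes> b)"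
proof
  assume ab: "in_ord (Idl B) (Suc (p + q)) (a \<otimes> b)"
  let ?b = "Idl B"
  have Bc: "B \<subseteq> carrier R" and x: "x \<in> carrier R" and ys: "set ys \<subseteq> carrier R" and xm: "x \<in> m" and ysm: "set ys \<subseteq> m"
    using m(2) m_carrier by auto
  have ib: "ideal ?b R" by (intro genideal_ideal Bc)
  have ac: "a \<in> carrier R" "b \<in> carrier R" using a b by (auto simp: in_ord_def)
  have rep: "\<exists>h\<in>hforms x ys n. c \<ominus> h \<in> ?b" if c: "in_ord ?b n c" for c n
  proof -
    from c obtain k where k: "k \<in> mpow m n" "c \<ominus> k \<in> ?b" and cc: "c \<in> carrier R" by (auto simp: in_ord_def)
    obtain h where h: "h \<in> hforms x ys n" "k \<ominus> h \<in> ?b"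
      using mpow_subset_hforms[OF Bc x ys m(1) k(1)] by blast
    have "c \<ominus> h = (c \<ominus> k) \<oplus> (k \<ominus> h)"
      using cc ideal_carrier[OF mpow_ideal[OF m_ideal] k(1)] hforms_carrier[OF x ys h(1)] by algebra
    then have "c \<ominus> h \<in> ?b" using ideal_add[OF ib k(2) h(2)] by simp
    then show ?thesis using h(1) by blast
  qed
  have nonvanish: "\<exists>cs\<in>points ys. \<phi> cs \<notin> m"
    if "hform x ys n h \<phi>" "c \<in> carrier R" "c \<ominus> h \<in> ?b" "\<not> in_ord ?b (Suc n) c" for n h \<phi> c
    using that hform_vanishing[OF m_prime inf that(1) xm ysm] unfolding in_ord_def by blast
  obtain h \<phi> where h: "hform x ys p h \<phi>" "a \<ominus> h \<in> ?b" using rep[OF a(1)] by (auto simp: hforms_def)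
  obtain k \<psi> where k: "hform x ys q k \<psi>" "b \<ominus> k \<in> ?b" using rep[OF b(1)] by (auto simp: hforms_def)
  obtain l \<theta> where l: "hform x ys (Suc (p + q)) l \<theta>" "a \<otimes> b \<ominus> l \<in> ?b" using rep[OF ab] by (auto simp: hforms_def)
  obtain cs where cs: "cs \<in> points ys" "\<phi> cs \<notin> m" "\<psi> cs \<notin> m"
    using hform_common_nonzero[OF m_prime inf h(1) _ _ k(1)] nonvanish[OF h(1) ac(1) h(2) a(2)] nonvanish[OF k(1) ac(2) k(2) b(2)] by blast
  \<comment> \<open>The generators in B together with the equations of the line through
    \<open>cs\<close>: at most \<open>card B + length ys\<close> elements, hence fewer than
    d.\<close>
  define G where "G = B \<union> set (map2 (\<lambda>y c. y \<ominus> c \<otimes> x) ys cs)"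
  have len: "length cs = length ys" and csc: "set cs \<subseteq> carrier R" using cs(1) by (auto simp: points_def)
  have Gm: "G \<subseteq> m"
    using m(2) csc unfolding G_def
    by (auto intro!: ideal_minus[OF m_ideal] ideal_lmult[OF m_ideal xm] dest: set_zip_leftD set_zip_rightD)
  then have Gc: "G \<subseteq> carrier R" using m_carrier by blast
  define L where "L = Idl G"
  have iL: "ideal L R" unfolding L_def by (intro genideal_ideal Gc)
  have GL: "G \<subseteq> L" unfolding L_def by (intro genideal_self Gc)
  have bL: "?b \<subseteq> L" using GL by (intro genideal_minimal iL) (auto simp: G_def)
  have la: "list_all2 (\<lambda>y c. y \<ominus> c \<otimes> x \<in> L) ys cs"
    using GL len by (force simp: list_all2_iff G_def)
  have modL: "c \<ominus> \<chi> cs \<otimes> x [^] n \<in> L" if "hform x ys n g \<chi>" "c \<ominus> g \<in> ?b" "c \<in> carrier R" for n g \<chi> c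
  proof -
    have "g \<in> carrier R" "\<chi> cs \<in> carrier R" "x [^] n \<in> carrier R"
      using hform_carrier[OF that(1) x ys] hform_fun_carrier[OF that(1) cs(1)] x by auto
    then have "c \<ominus> \<chi> cs \<otimes> x [^] n = (c \<ominus> g) \<oplus> (g \<ominus> \<chi> cs \<otimes> x [^] n)" using that(3) by algebra
    then show ?thesis using ideal_add[OF iL _ hform_mod[OF x that(1) ys cs(1) iL la]] that(2) bL by auto
  qed
  define \<alpha> \<beta> \<gamma> Xp Yq where defs: "\<alpha> = \<phi> cs" "\<beta> = \<psi> cs" "\<gamma> = \<theta> cs" "Xp = x [^] p" "Yq = x [^] q"
  have k1: "\<alpha> \<in> carrier R" "\<beta> \<in> carrier R" "\<gamma> \<in> carrier R" "Xp \<in> carrier R" "Yq \<in> carrier R"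
    using hform_fun_carrier[OF h(1) cs(1)] hform_fun_carrier[OF k(1) cs(1)] hform_fun_carrier[OF l(1) cs(1)] x by (auto simp: defs)
  have XpYq: "x [^] (p + q) = Xp \<otimes> Yq" "x [^] Suc (p + q) = Xp \<otimes> Yq \<otimes> x" using x by (auto simp: defs nat_pow_mult)
  have 1: "a \<ominus> \<alpha> \<otimes> Xp \<in> L" using modL[OF h ac(1)] by (simp add: defs)
  have 2: "b \<ominus> \<beta> \<otimes> Yq \<in> L" using modL[OF k ac(2)] by (simp add: defs)
  have 3: "a \<otimes> b \<ominus> \<gamma> \<otimes> (Xp \<otimes> Yq \<otimes> x) \<in> L" using modL[OF l] ac unfolding XpYq(2)[symmetric] defs(3) by simp
  \<comment> \<open>Modulo L the product ab is \<alpha> \<beta> x^(p+q), and by the assumed larger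
    order also \<gamma> x^(p+q+1). The difference has coefficient \<alpha> \<beta> - \<gamma> x, a
    unit because x is in m and neither \<alpha> nor \<beta> is.\<close>
  have "(\<alpha> \<otimes> \<beta> \<ominus> \<gamma> \<otimes> x) \<otimes> (Xp \<otimes> Yq)
    = (a \<otimes> b \<ominus> \<gamma> \<otimes> (Xp \<otimes> Yq \<otimes> x)) \<ominus> (b \<otimes> (a \<ominus> \<alpha> \<otimes> Xp) \<oplus> (\<alpha> \<otimes> Xp) \<otimes> (b \<ominus> \<beta> \<otimes> Yq))"
    using ac k1 x by algebra
  also have "\<dots> \<in> L" using ac k1 by (intro ideal_minus[OF iL 3] ideal_add[OF iL] ideal_lmult[OF iL 1] ideal_lmult[OF iL 2]) auto
  finally have 4: "(\<alpha> \<otimes> \<beta> \<ominus> \<gamma> \<otimes> x) \<otimes> (Xp \<otimes> Yq) \<in> L" .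
  have "\<alpha> \<otimes> \<beta> \<ominus> \<gamma> \<otimes> x \<notin> m"
  proof
    assume "\<alpha> \<otimes> \<beta> \<ominus> \<gamma> \<otimes> x \<in> m"
    then have "(\<alpha> \<otimes> \<beta> \<ominus> \<gamma> \<otimes> x) \<oplus> \<gamma> \<otimes> x \<in> m" using k1 by (intro ideal_add[OF m_ideal] ideal_lmult[OF m_ideal xm])
    moreover have "(\<alpha> \<otimes> \<beta> \<ominus> \<gamma> \<otimes> x) \<oplus> \<gamma> \<otimes> x = \<alpha> \<otimes> \<beta>" using k1 x by algebra
    ultimately show False using primeideal_D(4)[OF m_prime k1(1,2)] cs by (auto simp: defs)
  qed
  then have xL: "x [^] (p + q) \<in> L" unfolding XpYq(1) using cancel_unit[OF iL _ _ 4] k1 x by auto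
  have fin: "finite G" using B by (simp add: G_def)
  have crd: "card G < d"
  proof -
    have "card G \<le> card B + card (set (map2 (\<lambda>y c. y \<ominus> c \<otimes> x) ys cs))" unfolding G_def by (rule card_Un_le)
    also have "card (set (map2 (\<lambda>y c. y \<ominus> c \<otimes> x) ys cs)) \<le> length (map2 (\<lambda>y c. y \<ominus> c \<otimes> x) ys cs)" by (rule card_length)
    finally show ?thesis using len B(2) by simp
  qed
  \<comment> \<open>A prime containing the line and a power of x contains x, then every y by the
    equations y - c x, and so all generators of m.\<close>
  have min: "P' = m" if P': "primeideal P' R" "G \<subseteq> P'" "P' \<subseteq> m" for P'
  proof
    note iP' = primeideal_D(1)[OF P'(1)]
    have "L \<subseteq> P'" unfolding L_def by (intro genideal_minimal iP' P')
    then have xP': "x \<in> P'" using xL primeideal_pow[OF P'(1) x] by blast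
    have "y \<in> P'" if y: "y \<in> set ys" for y
    proof -
      obtain i where i: "i < length ys" "ys ! i = y" using y unfolding in_set_conv_nth by blast
      have c: "cs ! i \<in> carrier R" "y \<in> carrier R" using i len csc y ys nth_mem by auto
      have "y \<ominus> cs ! i \<otimes> x \<in> G" using i len unfolding G_def by (auto simp: set_zip)
      then have "(y \<ominus> cs ! i \<otimes> x) \<oplus> cs ! i \<otimes> x \<in> P'" using P'(2) xP' c by (intro ideal_add[OF iP'] ideal_lmult[OF iP']) auto
      moreover have "(y \<ominus> cs ! i \<otimes> x) \<oplus> cs ! i \<otimes> x = y" using c x by algebra
      ultimately show ?thesis by simp
    qed
    then show "m \<subseteq> P'" using xP' P'(2) unfolding m(1) by (intro genideal_minimal iP') (auto simp: G_def)
  qed (use P' in simp)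
  show False using ex_prime_below_m[OF C fin crd Gm] min by blast
qed

end

section \<open>Complete integral closedness of regular local rings\<close>

context cring
begin

definition cg :: "'a set \<Rightarrow> 'a \<Rightarrow> 'a \<Rightarrow> bool" where
  "cg J a b \<longleftrightarrow> a \<in> carrier R \<and> b \<in> carrier R \<and> a \<ominus> b \<in> J"

context
  fixes J assumes J: "ideal J R"
begin

lemma cg_refl: "a \<in> carrier R \<Longrightarrow> cg J a a"
  using ideal_zero[OF J] by (simp add: cg_def a_minus_def r_neg)

lemma cg_sym: "cg J a b \<Longrightarrow> cg J b a"
proof -
  assume c: "cg J a b"
  then have "b \<ominus> a = \<ominus> (a \<ominus> b)" unfolding cg_def by (elim conjE) algebra
  then show ?thesis using c ideal_neg[OF J] by (simp add: cg_def)
qed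

lemma cg_trans: "cg J a b \<Longrightarrow> cg J b c \<Longrightarrow> cg J a c"
proof -
  assume c: "cg J a b" "cg J b c"
  then have "a \<ominus> c = (a \<ominus> b) \<oplus> (b \<ominus> c)" unfolding cg_def by (elim conjE) algebra
  then show ?thesis using c ideal_add[OF J] by (simp add: cg_def)
qed

lemma cg_add: "cg J a b \<Longrightarrow> cg J c d \<Longrightarrow> cg J (a \<oplus> c) (b \<oplus> d)"
proof -
  assume c: "cg J a b" "cg J c d"
  then have "(a \<oplus> c) \<ominus> (b \<oplus> d) = (a \<ominus> b) \<oplus> (c \<ominus> d)" unfolding cg_def by (elim conjE) algebra
  then show ?thesis using c ideal_add[OF J] by (simp add: cg_def)
qed

lemma cg_minus: "cg J a b \<Longrightarrow> cg J c d \<Longrightarrow> cg J (a \<ominus> c) (b \<ominus> d)"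
proof -
  assume c: "cg J a b" "cg J c d"
  then have "(a \<ominus> c) \<ominus> (b \<ominus> d) = (a \<ominus> b) \<ominus> (c \<ominus> d)" unfolding cg_def by (elim conjE) algebra
  then show ?thesis using c ideal_minus[OF J] by (simp add: cg_def)
qed

lemma cg_mult: "cg J a b \<Longrightarrow> cg J c d \<Longrightarrow> cg J (a \<otimes> c) (b \<otimes> d)"
proof -
  assume c: "cg J a b" "cg J c d"
  then have "(a \<otimes> c) \<ominus> (b \<otimes> d) = c \<otimes> (a \<ominus> b) \<oplus> b \<otimes> (c \<ominus> d)" unfolding cg_def by (elim conjE) algebra
  moreover have "c \<otimes> (a \<ominus> b) \<oplus> b \<otimes> (c \<ominus> d) \<in> J"
    using c unfolding cg_def by (intro ideal_add[OF J] ideal_lmult[OF J]) auto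
  ultimately show ?thesis using c by (simp add: cg_def)
qed

lemma cg_pow: "cg J a b \<Longrightarrow> cg J (a [^] (n::nat)) (b [^] n)"
  by (induction n) (auto intro: cg_mult cg_refl)

lemma mem_adj_cg: "y \<in> carrier R \<Longrightarrow> z \<in> carrier R \<Longrightarrow> z \<in> adj J y \<longleftrightarrow> (\<exists>c\<in>carrier R. cg J z (c \<otimes> y))"
proof -
  assume y: "y \<in> carrier R" and z: "z \<in> carrier R"
  show ?thesis
  proof
    assume "z \<in> adj J y"
    then obtain j c where j: "j \<in> J" "c \<in> carrier R" "z = j \<oplus> c \<otimes> y" by (auto simp: mem_adj[OF y])
    have "z \<ominus> c \<otimes> y = j" unfolding j(3) using ideal_carrier[OF J j(1)] j(2) y by algebra
    then show "\<exists>c\<in>carrier R. cg J z (c \<otimes> y)" using j(1,2) y z by (auto simp: cg_def)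
  next
    assume "\<exists>c\<in>carrier R. cg J z (c \<otimes> y)"
    then obtain c where c: "c \<in> carrier R" "z \<ominus> c \<otimes> y \<in> J" by (auto simp: cg_def)
    have "z = (z \<ominus> c \<otimes> y) \<oplus> c \<otimes> y" using c(1) y z by algebra
    then show "z \<in> adj J y" using mem_adjI[OF y c(2,1)] by simp
  qed
qed

lemma cg_cancel:
  assumes "primeideal J R" "y \<in> carrier R" "y \<notin> J" "a \<in> carrier R" "b \<in> carrier R" "cg J (y \<otimes> a) (y \<otimes> b)"
  shows "cg J a b"
proof -
  have "y \<otimes> (a \<ominus> b) = y \<otimes> a \<ominus> y \<otimes> b" using assms by algebra
  then have "y \<otimes> (a \<ominus> b) \<in> J" using assms(6) by (simp add: cg_def)
  then show ?thesis using primeideal_D(4)[OF assms(1,2), of "a \<ominus> b"] assms by (auto simp: cg_def)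
qed

text \<open>Here y and e behave like a regular sequence modulo J: in w e = y^k c the factor y cannot
  divide e modulo J, so it divides w and cancels, one power at a time.\<close>

lemma cg_cancel_pow:
  assumes P: "primeideal J R" "y \<in> carrier R" "y \<notin> J" and P': "primeideal (adj J y) R"
    and e: "e \<in> carrier R" "e \<notin> adj J y" and c: "c \<in> carrier R" and w: "w \<in> carrier R"
    and cg: "cg J (y [^] (k::nat) \<otimes> c) (w \<otimes> e)"
  shows "\<exists>w'\<in>carrier R. cg J c (w' \<otimes> e)"
  using w cg
proof (induction k arbitrary: w)
  case 0
  then show ?case using c by auto
next
  case (Suc k)
  have "cg J (w \<otimes> e) ((y [^] k \<otimes> c) \<otimes> y)" using cg_sym[OF Suc.prems(2)] P(2) c by (simp add: m_ac)
  moreover have "w \<otimes> e \<in> carrier R" "y [^] k \<otimes> c \<in> carrier R" using Suc.prems(1) e(1) P(2) c by auto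
  ultimately have "w \<otimes> e \<in> adj J y" using mem_adj_cg[OF P(2), of "w \<otimes> e"] by blast
  then have "w \<in> adj J y" using primeideal_D(4)[OF P' Suc.prems(1) e(1)] e(2) by blast
  then obtain v where v: "v \<in> carrier R" "cg J w (v \<otimes> y)" using mem_adj_cg[OF P(2) Suc.prems(1)] by blast
  have "cg J (y [^] Suc k \<otimes> c) ((v \<otimes> y) \<otimes> e)" using cg_trans[OF Suc.prems(2) cg_mult[OF v(2) cg_refl[OF e(1)]]] .
  then have "cg J (y \<otimes> (y [^] k \<otimes> c)) (y \<otimes> (v \<otimes> e))" using P(2) c v(1) e(1) by (simp add: m_ac)
  then have "cg J (y [^] k \<otimes> c) (v \<otimes> e)" using c v(1) e(1) P(2) by (intro cg_cancel[OF P, of "y [^] k \<otimes> c" "v \<otimes> e"]) auto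
  then show ?case using Suc.IH[OF v(1)] by blast
qed

end

text \<open>For prime \<open>J\<close>: the quotient by \<open>J\<close> is completely integrally closed.\<close>

definition cic :: "'a set \<Rightarrow> bool" where
  "cic J \<longleftrightarrow> (\<forall>a\<in>carrier R. \<forall>b\<in>carrier R - J. \<forall>t\<in>carrier R - J.
     (\<forall>j::nat. t \<otimes> a [^] j \<in> adj J (b [^] j)) \<longrightarrow> a \<in> adj J b)"

end

section \<open>Lifting complete integral closedness from J + (y) to J\<close>

context noetherian_local
begin

text \<open>Krull's intersection theorem makes the y-adic filtration of R/J separated, so a largest
  power of y can be split off.\<close>

lemma ex_adic_order:
  assumes J: "ideal J R" and y: "y \<in> m" and z: "z \<in> carrier R" "z \<notin> J"
  shows "\<exists>k::nat. \<exists>z'\<in>carrier R - adj J y. cg J z (y [^] k \<otimes> z')"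
proof -
  have yc: "y \<in> carrier R" using y by (rule m_carrier)
  have "\<exists>k. z \<in> adj J (y [^] k) \<and> z \<notin> adj J (y [^] Suc k)"
  proof (rule ccontr)
    assume n: "\<not> ?thesis"
    have "z \<in> adj J (y [^] k)" for k :: nat
    proof (induction k)
      case 0
      have "cg J z (z \<otimes> y [^] (0::nat))" using cg_refl[OF J z(1)] z(1) by simp
      then show ?case using mem_adj_cg[OF J _ z(1), of "y [^] (0::nat)"] yc z(1) by blast
    qed (use n in blast)
    then show False using krull_intersection[OF J y z(1)] z(2) by blast
  qed
  then obtain k where k: "z \<in> adj J (y [^] k)" "z \<notin> adj J (y [^] Suc k)" by blast
  then obtain c where c: "c \<in> carrier R" "cg J z (c \<otimes> y [^] k)" using mem_adj_cg[OF J _ z(1)] yc by blast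
  have "c \<notin> adj J y"
  proof
    assume "c \<in> adj J y"
    then obtain d where d: "d \<in> carrier R" "cg J c (d \<otimes> y)" using mem_adj_cg[OF J yc c(1)] by blast
    have "cg J z ((d \<otimes> y) \<otimes> y [^] k)"
      using cg_trans[OF J c(2) cg_mult[OF J d(2) cg_refl[OF J]]] yc by simp
    then have "cg J z (d \<otimes> y [^] Suc k)" using d(1) yc by (simp add: m_ac)
    then show False using k(2) mem_adj_cg[OF J _ z(1), of "y [^] Suc k"] yc d(1) by blast
  qed
  then show ?thesis using c yc by (intro exI[of _ k] bexI[of _ c]) (auto simp: m_comm)
qed

text \<open>Successive approximation of a by multiples of b. Modulo y the hypothesis yields a = c b
  + y e, and e inherits the divisibility hypothesis with the same t and b, because powers of y can
  be cancelled against powers of b. Repeating n times leaves the error y^n e.\<close>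

lemma cic_step_aux:
  assumes P: "primeideal J R" and y: "y \<in> m" "y \<notin> J" and P': "primeideal (adj J y) R"
    and cic: "cic (adj J y)" and b: "b \<in> carrier R - adj J y" and t: "t \<in> carrier R - adj J y"
    and "a \<in> carrier R" and "\<And>j::nat. \<exists>w\<in>carrier R. cg J (t \<otimes> a [^] j) (w \<otimes> b [^] j)"
  shows "\<exists>c\<in>carrier R. \<exists>e\<in>carrier R. cg J a (b \<otimes> c \<oplus> y [^] (n::nat) \<otimes> e)"
  using assms(8,9)
proof (induction n arbitrary: a)
  case 0
  have "a = b \<otimes> \<zero> \<oplus> y [^] (0::nat) \<otimes> a" using b 0 by simp
  then show ?case using cg_refl[OF primeideal_D(1)[OF P] "0"(1)] 0 by (metis zero_closed)
next
  case (Suc n)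
  note J = primeideal_D(1)[OF P]
  have yc: "y \<in> carrier R" using y m_carrier by simp
  have bt: "b \<in> carrier R" "t \<in> carrier R" using b t by auto
  note iJ' = ideal_adj[OF J yc]
  have "t \<otimes> a [^] j \<in> adj (adj J y) (b [^] j)" for j :: nat
  proof -
    have "t \<otimes> a [^] j \<in> adj J (b [^] j)" using Suc.prems(2)[of j] mem_adj_cg[OF J, of "b [^] j" "t \<otimes> a [^] j"] bt Suc.prems(1) by simp
    moreover have "adj J (b [^] j) \<subseteq> adj (adj J y) (b [^] j)" using subset_adj[OF J yc] bt by (intro adj_mono) auto
    ultimately show ?thesis by blast
  qed
  then have "a \<in> adj (adj J y) b" using cic b t Suc.prems(1) unfolding cic_def by blast
  then obtain c where c: "c \<in> carrier R" "cg (adj J y) a (c \<otimes> b)" using mem_adj_cg[OF iJ' bt(1) Suc.prems(1)] by blast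
  define a2 where "a2 = a \<ominus> c \<otimes> b"
  have a2: "a2 \<in> carrier R" "a2 \<in> adj J y" using c Suc.prems(1) bt unfolding a2_def by (auto simp: cg_def)
  then obtain e where e: "e \<in> carrier R" "cg J a2 (e \<otimes> y)" using mem_adj_cg[OF J yc] by blast
  \<comment> \<open>Each step replaces one factor a by a - c b. The mixed products a^i a2^j keep the
    expansion inside an induction on j with i arbitrary.\<close>
  have pw: "\<exists>w\<in>carrier R. cg J (t \<otimes> a [^] i \<otimes> a2 [^] j) (w \<otimes> b [^] (i + j))" for i j :: nat
  proof (induction j arbitrary: i)
    case 0 then show ?case using Suc.prems(2)[of i] Suc.prems(1) bt by simp
  next
    case (Suc j)
    obtain w1 where w1: "w1 \<in> carrier R" "cg J (t \<otimes> a [^] Suc i \<otimes> a2 [^] j) (w1 \<otimes> b [^] (Suc i + j))" using Suc[of "Suc i"] by blast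
    obtain w2 where w2: "w2 \<in> carrier R" "cg J (t \<otimes> a [^] i \<otimes> a2 [^] j) (w2 \<otimes> b [^] (i + j))" using Suc[of i] by blast
    define A A2 B where defs: "A = a [^] i" "A2 = a2 [^] j" "B = b [^] (i + j)"
    have k: "A \<in> carrier R" "A2 \<in> carrier R" "B \<in> carrier R" using \<open>a \<in> carrier R\<close> a2 bt by (auto simp: defs)
    have "cg J (t \<otimes> (A \<otimes> a) \<otimes> A2 \<ominus> (c \<otimes> b) \<otimes> (t \<otimes> A \<otimes> A2)) (w1 \<otimes> (B \<otimes> b) \<ominus> (c \<otimes> b) \<otimes> (w2 \<otimes> B))"
    proof (rule cg_minus[OF J])
      show "cg J (t \<otimes> (A \<otimes> a) \<otimes> A2) (w1 \<otimes> (B \<otimes> b))" using w1(2) by (simp add: defs)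
      show "cg J ((c \<otimes> b) \<otimes> (t \<otimes> A \<otimes> A2)) ((c \<otimes> b) \<otimes> (w2 \<otimes> B))"
        using w2(2) cg_mult[OF J cg_refl[OF J]] c(1) bt by (simp add: defs)
    qed
    moreover have "t \<otimes> (A \<otimes> a) \<otimes> A2 \<ominus> (c \<otimes> b) \<otimes> (t \<otimes> A \<otimes> A2) = t \<otimes> A \<otimes> (A2 \<otimes> a2)"
      unfolding a2_def using k bt c(1) \<open>a \<in> carrier R\<close> by algebra
    moreover have "w1 \<otimes> (B \<otimes> b) \<ominus> (c \<otimes> b) \<otimes> (w2 \<otimes> B) = (w1 \<ominus> c \<otimes> w2) \<otimes> (B \<otimes> b)"
      using k bt c(1) w1(1) w2(1) by algebra
    ultimately have "cg J (t \<otimes> a [^] i \<otimes> a2 [^] Suc j) ((w1 \<ominus> c \<otimes> w2) \<otimes> b [^] (i + Suc j))" by (simp add: defs)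
    then show ?case using w1(1) w2(1) c(1) by (intro bexI[of _ "w1 \<ominus> c \<otimes> w2"]) auto
  qed
  have "\<exists>w\<in>carrier R. cg J (t \<otimes> e [^] j) (w \<otimes> b [^] j)" for j :: nat
  proof -
    obtain w where w: "w \<in> carrier R" "cg J (t \<otimes> a2 [^] j) (w \<otimes> b [^] j)" using pw[of 0 j] bt a2 by auto
    have "cg J (t \<otimes> a2 [^] j) (t \<otimes> (e \<otimes> y) [^] j)" using cg_mult[OF J cg_refl[OF J bt(2)] cg_pow[OF J e(2)]] .
    then have "cg J (t \<otimes> (e \<otimes> y) [^] j) (w \<otimes> b [^] j)" using cg_trans[OF J cg_sym[OF J] w(2)] by blast
    moreover have "t \<otimes> (e \<otimes> y) [^] j = y [^] j \<otimes> (t \<otimes> e [^] j)" using bt e(1) yc by (simp add: nat_pow_distrib m_ac)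
    ultimately have "cg J (y [^] j \<otimes> (t \<otimes> e [^] j)) (w \<otimes> b [^] j)" by simp
    moreover have "b [^] j \<notin> adj J y" using primeideal_pow[OF P' bt(1)] b by blast
    ultimately show ?thesis using cg_cancel_pow[OF J P yc y(2) P', of "b [^] j" "t \<otimes> e [^] j" w j] bt e(1) w(1) by simp
  qed
  from Suc.IH[OF e(1) this] obtain c' e' where c': "c' \<in> carrier R" "e' \<in> carrier R" "cg J e (b \<otimes> c' \<oplus> y [^] n \<otimes> e')" by blast
  define W where "W = y [^] n"
  have W: "W \<in> carrier R" using yc by (simp add: W_def)
  have "a = c \<otimes> b \<oplus> a2" unfolding a2_def using Suc.prems(1) c(1) bt by algebra
  moreover have "cg J (c \<otimes> b \<oplus> a2) (c \<otimes> b \<oplus> (b \<otimes> c' \<oplus> W \<otimes> e') \<otimes> y)"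
    using c' c(1) bt yc unfolding W_def
    by (intro cg_add[OF J] cg_refl[OF J] cg_trans[OF J e(2)] cg_mult[OF J]) auto
  moreover have "c \<otimes> b \<oplus> (b \<otimes> c' \<oplus> W \<otimes> e') \<otimes> y = b \<otimes> (c \<oplus> c' \<otimes> y) \<oplus> (W \<otimes> y) \<otimes> e'"
    using c' c(1) bt yc W by algebra
  ultimately have "cg J a (b \<otimes> (c \<oplus> c' \<otimes> y) \<oplus> y [^] Suc n \<otimes> e')" by (simp add: W_def)
  then show ?case using c' c(1) yc by (intro bexI[of _ "c \<oplus> c' \<otimes> y"] bexI[of _ e']) auto
qed

text \<open>Split the largest powers of y off t, b and a. Comparing exponents for large n shows that
  a carries at least the power of y that b does; the rest is the approximation lemma, followed by
  Krull's intersection theorem modulo J + (b').\<close>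

lemma cic_step:
  assumes P: "primeideal J R" and y: "y \<in> m" "y \<notin> J" and P': "primeideal (adj J y) R"
    and cic: "cic (adj J y)"
  shows "cic J"
  unfolding cic_def
proof (intro ballI impI)
  note J = primeideal_D(1)[OF P]
  have yc: "y \<in> carrier R" using y m_carrier by simp
  have ypow: "y [^] n \<notin> J" for n :: nat using primeideal_pow[OF P yc] y(2) by blast
  fix a b t assume a: "a \<in> carrier R" and b: "b \<in> carrier R - J" and t: "t \<in> carrier R - J"
    and int: "\<forall>j::nat. t \<otimes> a [^] j \<in> adj J (b [^] j)"
  show "a \<in> adj J b"
  proof (cases "a \<in> J")
    case True then show ?thesis using subset_adj[OF J, of b] b by blast
  next
    case False
    obtain k t' where t': "t' \<in> carrier R" "t' \<notin> adj J y" "cg J t (y [^] (k::nat) \<otimes> t')" using ex_adic_order[OF J y(1)] t by blast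
    obtain l b' where b': "b' \<in> carrier R" "b' \<notin> adj J y" "cg J b (y [^] (l::nat) \<otimes> b')" using ex_adic_order[OF J y(1)] b by blast
    obtain s a' where a': "a' \<in> carrier R" "a' \<notin> adj J y" "cg J a (y [^] (s::nat) \<otimes> a')" using ex_adic_order[OF J y(1) a False] by blast
    have key: "\<exists>w\<in>carrier R. cg J (y [^] (k + s * n) \<otimes> (t' \<otimes> a' [^] n)) (y [^] (l * n) \<otimes> (w \<otimes> b' [^] n))" for n :: nat
    proof -
      obtain w where w: "w \<in> carrier R" "cg J (t \<otimes> a [^] n) (w \<otimes> b [^] n)"
        using int mem_adj_cg[OF J, of "b [^] n" "t \<otimes> a [^] n"] a b t by auto
      have 1: "cg J (t \<otimes> a [^] n) ((y [^] k \<otimes> t') \<otimes> (y [^] s \<otimes> a') [^] n)" by (intro cg_mult[OF J] cg_pow[OF J] t' a')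
      have 2: "cg J (w \<otimes> b [^] n) (w \<otimes> (y [^] l \<otimes> b') [^] n)" by (intro cg_mult[OF J] cg_pow[OF J] b' cg_refl[OF J] w)
      have "cg J ((y [^] k \<otimes> t') \<otimes> (y [^] s \<otimes> a') [^] n) (w \<otimes> (y [^] l \<otimes> b') [^] n)"
        using cg_trans[OF J cg_sym[OF J 1] cg_trans[OF J w(2) 2]] .
      moreover have "(y [^] k \<otimes> t') \<otimes> (y [^] s \<otimes> a') [^] n = y [^] (k + s * n) \<otimes> (t' \<otimes> a' [^] n)"
        using yc t' a' by (simp add: nat_pow_distrib nat_pow_pow nat_pow_mult[symmetric] m_ac)
      moreover have "w \<otimes> (y [^] l \<otimes> b') [^] n = y [^] (l * n) \<otimes> (w \<otimes> b' [^] n)"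
        using yc w b' by (simp add: nat_pow_distrib nat_pow_pow m_ac)
      ultimately show ?thesis using w(1) by auto
    qed
    have "l \<le> s"
    proof (rule ccontr)
      assume "\<not> l \<le> s"
      then obtain r where r: "l = s + Suc r" using less_imp_Suc_add[of s l] by auto
      \<comment> \<open>The least n that outweighs the exponent k coming from t: if l > s, then l n
        exceeds k + s n, and t' a'^n would lie in J + (y).\<close>
      define n where "n = Suc k"
      obtain w where w: "w \<in> carrier R" "cg J (y [^] (k + s * n) \<otimes> (t' \<otimes> a' [^] n)) (y [^] (l * n) \<otimes> (w \<otimes> b' [^] n))" using key by blast
      have ln: "l * n = (k + s * n) + Suc (r * n)" unfolding r n_def by (simp add: algebra_simps)
      have "y [^] (l * n) \<otimes> (w \<otimes> b' [^] n) = y [^] (k + s * n) \<otimes> ((y [^] (r * n) \<otimes> (w \<otimes> b' [^] n)) \<otimes> y)"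
        unfolding ln nat_pow_mult[OF yc, symmetric] using yc w b' by (simp add: m_ac)
      then have "cg J (t' \<otimes> a' [^] n) ((y [^] (r * n) \<otimes> (w \<otimes> b' [^] n)) \<otimes> y)"
        using w yc b' t' a' by - (rule cg_cancel[OF J P _ ypow[of "k + s * n"]], auto)
      then have "t' \<otimes> a' [^] n \<in> adj J y"
        using mem_adj_cg[OF J yc, of "t' \<otimes> a' [^] n"] t'(1) a'(1) w(1) yc b'(1)
        by (meson m_closed nat_pow_closed)
      then have "t' \<in> adj J y \<or> a' [^] n \<in> adj J y" using primeideal_D(4)[OF P', of t' "a' [^] n"] t' a' by auto
      then show False using t'(2) a'(2) primeideal_pow[OF P' a'(1)] by blast
    qed
    then obtain r where r: "s = l + r" using le_Suc_ex by blast
    define a2 where "a2 = y [^] r \<otimes> a'"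
    have a2: "a2 \<in> carrier R" using yc a' by (simp add: a2_def)
    have "\<exists>w\<in>carrier R. cg J (t' \<otimes> a2 [^] n) (w \<otimes> b' [^] n)" for n :: nat
    proof -
      obtain w where w: "w \<in> carrier R" "cg J (y [^] (k + s * n) \<otimes> (t' \<otimes> a' [^] n)) (y [^] (l * n) \<otimes> (w \<otimes> b' [^] n))" using key by blast
      have "y [^] (k + s * n) \<otimes> (t' \<otimes> a' [^] n) = y [^] (l * n) \<otimes> (y [^] k \<otimes> (t' \<otimes> a2 [^] n))"
        unfolding r a2_def using yc t' a'
        by (simp add: nat_pow_distrib nat_pow_pow nat_pow_mult[symmetric] add_mult_distrib m_ac)
      then have "cg J (y [^] k \<otimes> (t' \<otimes> a2 [^] n)) (w \<otimes> b' [^] n)"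
        using w yc b' t' a2 by - (rule cg_cancel[OF J P _ ypow[of "l * n"]], auto)
      moreover have "b' [^] n \<notin> adj J y" using primeideal_pow[OF P' b'(1)] b'(2) by blast
      ultimately show ?thesis using cg_cancel_pow[OF J P yc y(2) P', of "b' [^] n" "t' \<otimes> a2 [^] n" w k] b' t' a2 w(1) by simp
    qed
    then have ex: "\<exists>c\<in>carrier R. \<exists>e\<in>carrier R. cg J a2 (b' \<otimes> c \<oplus> y [^] n \<otimes> e)" for n :: nat
      using cic_step_aux[OF P y P' cic _ _ a2, of b' t'] b' t' by auto
    note ib = ideal_adj[OF J b'(1)]
    have "a2 \<in> adj J b'"
    proof (rule krull_intersection[OF ib y(1) a2])
      fix n :: nat
      obtain c e where ce: "c \<in> carrier R" "e \<in> carrier R" "cg J a2 (b' \<otimes> c \<oplus> y [^] n \<otimes> e)" using ex by blast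
      define W where "W = y [^] n"
      have W: "W \<in> carrier R" using yc by (simp add: W_def)
      have "a2 \<ominus> e \<otimes> W = (a2 \<ominus> (b' \<otimes> c \<oplus> W \<otimes> e)) \<oplus> c \<otimes> b'" using a2 ce(1,2) b'(1) W by algebra
      then have "cg (adj J b') a2 (e \<otimes> W)"
        using mem_adjI[OF b'(1), of "a2 \<ominus> (b' \<otimes> c \<oplus> W \<otimes> e)" J c] ce a2 W unfolding cg_def W_def by auto
      then show "a2 \<in> adj (adj J b') (y [^] n)" using mem_adj_cg[OF ib, of "y [^] n" a2] a2 ce(2) yc unfolding W_def by auto
    qed
    then obtain c where c: "c \<in> carrier R" "cg J a2 (c \<otimes> b')" using mem_adj_cg[OF J b'(1) a2] by blast
    define W where "W = y [^] l"
    have W: "W \<in> carrier R" using yc by (simp add: W_def)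
    have "y [^] s \<otimes> a' = W \<otimes> a2" unfolding r a2_def W_def using yc a' by (simp add: nat_pow_mult[symmetric] m_ac)
    then have c1: "cg J a (W \<otimes> a2)" using a'(3) by simp
    have "cg J (W \<otimes> a2) (W \<otimes> (c \<otimes> b'))" using c(2) W by (intro cg_mult[OF J] cg_refl[OF J])
    moreover have "W \<otimes> (c \<otimes> b') = c \<otimes> (W \<otimes> b')" using W c b' by (simp add: m_ac)
    ultimately have c2: "cg J (W \<otimes> a2) (c \<otimes> (W \<otimes> b'))" by simp
    have "cg J b (W \<otimes> b')" using b'(3) by (simp add: W_def)
    from cg_mult[OF J cg_refl[OF J c(1)] cg_sym[OF J this]] have c3: "cg J (c \<otimes> (W \<otimes> b')) (c \<otimes> b)" .
    have "cg J a (c \<otimes> b)" using cg_trans[OF J c1 cg_trans[OF J c2 c3]] .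
    then show ?thesis using mem_adj_cg[OF J _ a, of b] b c(1) by auto
  qed
qed

text \<open>The start of the lifting: modulo m every nonzero b is invertible.\<close>

lemma cic_m: "cic m"
  unfolding cic_def
proof (intro ballI impI)
  fix a b assume a: "a \<in> carrier R" and b: "b \<in> carrier R - m"
  obtain v where v: "v \<in> carrier R" "v \<otimes> b = \<one>" using ex_inverse[OF b] by blast
  have "a = \<zero> \<oplus> (a \<otimes> v) \<otimes> b" using a b v by (simp add: m_assoc)
  then show "a \<in> adj m b" using mem_adjI[of b \<zero> m "a \<otimes> v"] ideal_zero[OF m_ideal] a b v by auto
qed

lemma Idl_insert: 
  assumes "B \<subseteq> carrier R" "y \<in> carrier R" shows "Idl (insert y B) = adj (Idl B) y"
proof
  have ib: "ideal (Idl B) R" by (intro genideal_ideal assms)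
  show "Idl (insert y B) \<subseteq> adj (Idl B) y"
    using subset_adj[OF ib assms(2)] self_adj[OF ib assms(2)] genideal_self[OF assms(1)]
    by (intro genideal_minimal ideal_adj ib assms) auto
  show "adj (Idl B) y \<subseteq> Idl (insert y B)"
    using assms genideal_self[of "insert y B"] subset_Idl_subset[of "insert y B" B]
    by (intro adj_minimal genideal_ideal) (auto intro: subsetD[OF subset_Idl_subset])
qed

text \<open>Nonmembers have finite order modulo B and orders add, so their product is not a member.
  If x were in the ideal, m would be generated up to radical by fewer than d elements.\<close>

lemma prime_of_generators:
  assumes inf: "infinite (carrier (R Quot m))" and C: "prime_chain R C d"
    and B: "finite B" "card B + length ys < d"
    and m: "m = Idl (B \<union> insert x (set ys))" "B \<union> insert x (set ys) \<subseteq> m"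
  shows "primeideal (Idl B) R" "x \<notin> Idl B"
proof -
  have Bc: "B \<subseteq> carrier R" using m m_carrier by blast
  have ib: "ideal (Idl B) R" by (intro genideal_ideal Bc)
  have bm: "Idl B \<subseteq> m" using m(2) by (intro genideal_minimal m_ideal) auto
  show "primeideal (Idl B) R"
  proof (rule primeidealI[OF ib is_cring])
    show "carrier R \<noteq> Idl B" using bm primeideal_D(2)[OF m_prime] by auto
    fix a b assume a: "a \<in> carrier R" and b: "b \<in> carrier R" and ab: "a \<otimes> b \<in> Idl B"
    show "a \<in> Idl B \<or> b \<in> Idl B"
    proof (rule ccontr)
      assume n: "\<not> ?thesis"
      obtain p where p: "in_ord (Idl B) p a" "\<not> in_ord (Idl B) (Suc p) a" using ex_ord[OF ib a] n by blast
      obtain q where q: "in_ord (Idl B) q b" "\<not> in_ord (Idl B) (Suc q) b" using ex_ord[OF ib b] n by blast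
      have "in_ord (Idl B) (Suc (p + q)) (a \<otimes> b)"
        using ab a b ideal_zero[OF mpow_ideal[OF m_ideal]] unfolding in_ord_def by (auto simp: a_minus_def intro!: bexI[of _ \<zero>])
      then show False using order_mult_mod[OF inf C B m p q] by simp
    qed
  qed
  show "x \<notin> Idl B"
  proof
    assume x: "x \<in> Idl B"
    have "card (B \<union> set ys) < d" using card_Un_le[of B "set ys"] card_length[of ys] B(2) by linarith
    then obtain P' where P': "primeideal P' R" "B \<union> set ys \<subseteq> P'" "P' \<subseteq> m" "P' \<noteq> m"
      using ex_prime_below_m[OF C, of "B \<union> set ys"] B(1) m(2) by auto
    have "Idl B \<subseteq> P'" using P'(2) by (intro genideal_minimal primeideal_D(1)[OF P'(1)]) auto
    then have "m \<subseteq> P'" unfolding m(1) using P'(2) x by (intro genideal_minimal primeideal_D(1)[OF P'(1)]) auto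
    then show False using P' by blast
  qed
qed

text \<open>Induction on the generators not yet in B: moving one into B ends at m, and
  \<open>cic_step\<close> leads back. The next ideal is prime by \<open>prime_of_generators\<close>,
  or equals m when no generator remains.\<close>

lemma cic_of_generators:
  assumes inf: "infinite (carrier (R Quot m))" and C: "prime_chain R C d"
    and "finite B" "card B + length zs \<le> d"
    and "m = Idl (B \<union> set zs)" "B \<union> set zs \<subseteq> m"
  shows "cic (Idl B)"
  using assms(3-)
proof (induction zs arbitrary: B)
  case Nil
  then have "m = Idl B" by simp
  then show ?case using cic_m by simp
next
  case (Cons x ys)
  have B: "finite B" "card B + length ys < d" "m = Idl (B \<union> insert x (set ys))" "B \<union> insert x (set ys) \<subseteq> m"
    using Cons.prems by auto
  note pr = prime_of_generators[OF inf C B]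
  have Bx: "B \<subseteq> carrier R" "x \<in> carrier R" "x \<in> m" using B(4) m_carrier by auto
  have adj: "Idl (insert x B) = adj (Idl B) x" by (intro Idl_insert Bx)
  have card: "card (insert x B) \<le> Suc (card B)" using card_insert_le_m1 B(1) by (simp add: card_insert_if)
  have "cic (Idl (insert x B))" using B card by (intro Cons.IH) auto
  moreover have "primeideal (Idl (insert x B)) R"
  proof (cases ys)
    case Nil
    then have "Idl (insert x B) = m" using B(3) by simp
    then show ?thesis using m_prime by simp
  next
    case (Cons z zs)
    show ?thesis
      by (rule prime_of_generators(1)[OF inf C, of "insert x B" zs z]) (use B card Cons in \<open>auto simp: insert_commute\<close>)
  qed
  ultimately show ?case using cic_step[OF pr(1) Bx(3) pr(2)] unfolding adj by simp
qed

end

section \<open>Integral closure in a field\<close>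

locale ambient_field = field K for K (structure)
begin

lemma inv_closed: "a \<in> carrier K \<Longrightarrow> a \<noteq> \<zero> \<Longrightarrow> inv a \<in> carrier K"
  using field_Units by auto

lemma inv_l: "a \<in> carrier K \<Longrightarrow> a \<noteq> \<zero> \<Longrightarrow> inv a \<otimes> a = \<one>"
  using field_Units by auto

lemma inv_r: "a \<in> carrier K \<Longrightarrow> a \<noteq> \<zero> \<Longrightarrow> a \<otimes> inv a = \<one>"
  using field_Units by auto

lemma inv_nonzero: "a \<in> carrier K \<Longrightarrow> a \<noteq> \<zero> \<Longrightarrow> inv a \<noteq> \<zero>"
  using inv_l[of a] by auto

lemma inv_inverse: "a \<in> carrier K \<Longrightarrow> a \<noteq> \<zero> \<Longrightarrow> inv (inv a) = a"
  using field_Units by auto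

lemma inv_unique_eq: "a \<in> carrier K \<Longrightarrow> b \<in> carrier K \<Longrightarrow> a \<otimes> b = \<one> \<Longrightarrow> inv a = b"
  using comm_inv_char by simp

lemma inv_distrib:
  assumes "a \<in> carrier K" "a \<noteq> \<zero>" "b \<in> carrier K" "b \<noteq> \<zero>"
  shows "inv (a \<otimes> b) = inv a \<otimes> inv b"
proof (rule inv_unique_eq)
  have "(a \<otimes> b) \<otimes> (inv a \<otimes> inv b) = (a \<otimes> inv a) \<otimes> (b \<otimes> inv b)"
    using assms inv_closed by (simp add: m_ac)
  then show "(a \<otimes> b) \<otimes> (inv a \<otimes> inv b) = \<one>" using assms inv_r by simp
qed (use assms inv_closed in auto)

lemma nonzero_mult: "a \<in> carrier K \<Longrightarrow> a \<noteq> \<zero> \<Longrightarrow> b \<in> carrier K \<Longrightarrow> b \<noteq> \<zero> \<Longrightarrow> a \<otimes> b \<noteq> \<zero>"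
  using integral by blast

lemma nonzero_pow: "a \<in> carrier K \<Longrightarrow> a \<noteq> \<zero> \<Longrightarrow> a [^] (n::nat) \<noteq> \<zero>"
proof (induction n)
  case (Suc n) then show ?case using nonzero_mult[of "a [^] n" a] by simp
qed simp

lemma pow_inv: "a \<in> carrier K \<Longrightarrow> a \<noteq> \<zero> \<Longrightarrow> (inv a) [^] (n::nat) \<otimes> a [^] n = \<one>"
  using nat_pow_distrib[of "inv a" a n] inv_closed[of a] inv_l[of a] by simp

lemma inv_cancel: "a \<in> carrier K \<Longrightarrow> a \<noteq> \<zero> \<Longrightarrow> b \<in> carrier K \<Longrightarrow> inv a \<otimes> (a \<otimes> b) = b"
  using inv_closed[of a] inv_l[of a] by (simp add: m_assoc[symmetric])

lemma inv_cancel': "a \<in> carrier K \<Longrightarrow> a \<noteq> \<zero> \<Longrightarrow> b \<in> carrier K \<Longrightarrow> a \<otimes> (inv a \<otimes> b) = b"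
  using inv_closed[of a] inv_r[of a] by (simp add: m_assoc[symmetric])

lemma field_lcancel: "a \<in> carrier K \<Longrightarrow> a \<noteq> \<zero> \<Longrightarrow> b \<in> carrier K \<Longrightarrow> c \<in> carrier K \<Longrightarrow> a \<otimes> b = a \<otimes> c \<Longrightarrow> b = c"
  using m_lcancel[of a b c] by (rule iffD1)

lemma subring_pow: "subring A K \<Longrightarrow> a \<in> A \<Longrightarrow> a [^] (n::nat) \<in> A"
  by (induction n) (auto intro: subringE(3,6))

lemma subring_carrier: "subring A K \<Longrightarrow> a \<in> A \<Longrightarrow> a \<in> carrier K"
  using subringE(1) by blast

lemma subring_minus: "subring A K \<Longrightarrow> a \<in> A \<Longrightarrow> b \<in> A \<Longrightarrow> a \<ominus> b \<in> A"
  unfolding a_minus_def by (simp add: subringE(5) subringE(7))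

text \<open>Combinations of 1, z, ..., z^(n-1) with coefficients in A. The coefficient set is
  arbitrary, because clearing denominators uses one that need not be a ring.\<close>

primrec pspan :: "'a set \<Rightarrow> 'a \<Rightarrow> nat \<Rightarrow> 'a set" where
  "pspan A z 0 = {\<zero>}"
| "pspan A z (Suc n) = {u \<oplus> a \<otimes> z [^] n | u a. u \<in> pspan A z n \<and> a \<in> A}"

lemma pspan_SucI: "u \<in> pspan A z n \<Longrightarrow> a \<in> A \<Longrightarrow> u \<oplus> a \<otimes> z [^] n \<in> pspan A z (Suc n)"
  by auto

lemma pspan_mono_set: "A \<subseteq> B \<Longrightarrow> pspan A z n \<subseteq> pspan B z n"
  by (induction n) auto

lemma pspan_subring:
  assumes E: "subring E K" and "A \<subseteq> E" "z \<in> E" shows "pspan A z n \<subseteq> E"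
proof (induction n)
  case 0 then show ?case using subringE(2)[OF E] by simp
next
  case (Suc n) then show ?case using assms subring_pow[OF E assms(3)] by (auto intro!: subringE(6,7)[OF E])
qed

definition adjoin :: "'a set \<Rightarrow> 'a \<Rightarrow> 'a set" where
  "adjoin A z = (\<Union>n. pspan A z n)"

context
  fixes A z assumes A: "subring A K" and z: "z \<in> carrier K"
begin

lemma pspan_carrier: "u \<in> pspan A z n \<Longrightarrow> u \<in> carrier K"
  using pspan_subring[OF carrier_is_subring subringE(1)[OF A] z] by blast

lemma pspan_le_Suc: "pspan A z n \<subseteq> pspan A z (Suc n)"
proof
  fix u assume u: "u \<in> pspan A z n"
  then have "u = u \<oplus> \<zero> \<otimes> z [^] n" using pspan_carrier z by simp
  then show "u \<in> pspan A z (Suc n)" using pspan_SucI[OF u subringE(2)[OF A]] by simp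
qed

lemma pspan_mono: "n \<le> k \<Longrightarrow> pspan A z n \<subseteq> pspan A z k"
  using lift_Suc_mono_le[of "pspan A z", OF pspan_le_Suc] .

lemma pspan_zero: "\<zero> \<in> pspan A z n"
  using pspan_mono[of 0 n] by simp

lemma pspan_add: "u \<in> pspan A z n \<Longrightarrow> w \<in> pspan A z n \<Longrightarrow> u \<oplus> w \<in> pspan A z n"
proof (induction n arbitrary: u w)
  case (Suc n)
  obtain u' a where u: "u = u' \<oplus> a \<otimes> z [^] n" "u' \<in> pspan A z n" "a \<in> A" using Suc.prems(1) by auto
  obtain w' b where w: "w = w' \<oplus> b \<otimes> z [^] n" "w' \<in> pspan A z n" "b \<in> A" using Suc.prems(2) by auto
  define t where "t = z [^] n"
  have c: "u' \<in> carrier K" "w' \<in> carrier K" "a \<in> carrier K" "b \<in> carrier K" "t \<in> carrier K"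
    using u w pspan_carrier subring_carrier[OF A] z by (auto simp: t_def)
  have "u \<oplus> w = (u' \<oplus> w') \<oplus> (a \<oplus> b) \<otimes> t" unfolding u(1) w(1) t_def[symmetric] using c by algebra
  then show ?case unfolding t_def using pspan_SucI[OF Suc.IH[OF u(2) w(2)] subringE(7)[OF A u(3) w(3)]] by simp
qed simp

lemma pspan_scale: "u \<in> pspan A z n \<Longrightarrow> c \<in> A \<Longrightarrow> c \<otimes> u \<in> pspan A z n"
proof (induction n arbitrary: u)
  case 0 then show ?case using subring_carrier[OF A] by simp
next
  case (Suc n)
  obtain u' a where u: "u = u' \<oplus> a \<otimes> z [^] n" "u' \<in> pspan A z n" "a \<in> A" using Suc.prems(1) by auto
  define t where "t = z [^] n"
  have c: "u' \<in> carrier K" "a \<in> carrier K" "t \<in> carrier K" "c \<in> carrier K"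
    using u Suc.prems(2) pspan_carrier subring_carrier[OF A] z by (auto simp: t_def)
  have "c \<otimes> u = c \<otimes> u' \<oplus> (c \<otimes> a) \<otimes> t" unfolding u(1) t_def[symmetric] using c by algebra
  then show ?case unfolding t_def using pspan_SucI[OF Suc.IH[OF u(2) Suc.prems(2)] subringE(6)[OF A Suc.prems(2) u(3)]] by simp
qed

lemma pspan_neg: "u \<in> pspan A z n \<Longrightarrow> \<ominus> u \<in> pspan A z n"
proof -
  assume u: "u \<in> pspan A z n"
  have "\<ominus> u = (\<ominus> \<one>) \<otimes> u" using pspan_carrier[OF u] by (simp add: l_minus)
  then show ?thesis using pspan_scale[OF u subringE(5)[OF A subringE(3)[OF A]]] by simp
qed

lemma pspan_shift: "u \<in> pspan A z n \<Longrightarrow> z \<otimes> u \<in> pspan A z (Suc n)"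
proof (induction n arbitrary: u)
  case 0 then show ?case using z pspan_zero[of "Suc 0"] by simp
next
  case (Suc n)
  obtain u' a where u: "u = u' \<oplus> a \<otimes> z [^] n" "u' \<in> pspan A z n" "a \<in> A" using Suc.prems(1) by auto
  have "z \<otimes> u = z \<otimes> u' \<oplus> a \<otimes> z [^] Suc n"
    unfolding u(1) using pspan_carrier[OF u(2)] subring_carrier[OF A u(3)] z by (simp add: r_distr m_ac)
  then show ?case using pspan_SucI[OF Suc.IH[OF u(2)] u(3)] by simp
qed

lemma pspan_shift_pow: "u \<in> pspan A z n \<Longrightarrow> z [^] k \<otimes> u \<in> pspan A z (n + k)"
proof (induction k)
  case 0 then show ?case using pspan_carrier by simp
next
  case (Suc k)
  have "z [^] Suc k \<otimes> u = z \<otimes> (z [^] k \<otimes> u)" using z pspan_carrier[OF Suc.prems] by (simp add: m_ac)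
  then show ?case using pspan_shift[OF Suc.IH[OF Suc.prems]] by simp
qed

lemma pspan_coeff: "a \<in> A \<Longrightarrow> a \<in> pspan A z (Suc n)"
proof -
  assume a: "a \<in> A"
  then have "a = \<zero> \<oplus> a \<otimes> z [^] (0::nat)" using subring_carrier[OF A] by simp
  then have "a \<in> pspan A z (Suc 0)" using pspan_SucI[of \<zero> A z 0 a] a by simp
  then show ?thesis using pspan_mono[of "Suc 0" "Suc n"] by auto
qed

lemma pspan_pow: "a \<in> A \<Longrightarrow> a \<otimes> z [^] n \<in> pspan A z (Suc n)"
  using pspan_SucI[OF pspan_zero, of a n] subring_carrier[OF A] z by simp

lemma pspan_mult: "u \<in> pspan A z n \<Longrightarrow> w \<in> pspan A z k \<Longrightarrow> u \<otimes> w \<in> pspan A z (n + k)"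
proof (induction k arbitrary: w)
  case 0 then show ?case using pspan_carrier pspan_zero by simp
next
  case (Suc k)
  obtain w' b where w: "w = w' \<oplus> b \<otimes> z [^] k" "w' \<in> pspan A z k" "b \<in> A" using Suc.prems(2) by auto
  have c: "u \<in> carrier K" "w' \<in> carrier K" "b \<in> carrier K" using pspan_carrier Suc.prems(1) w subring_carrier[OF A] by auto
  have "u \<otimes> w = u \<otimes> w' \<oplus> b \<otimes> (z [^] k \<otimes> u)" unfolding w(1) using c z by (simp add: r_distr m_ac)
  moreover have "u \<otimes> w' \<in> pspan A z (n + Suc k)" using Suc.IH[OF Suc.prems(1) w(2)] pspan_mono[of "n + k" "n + Suc k"] by auto
  moreover have "b \<otimes> (z [^] k \<otimes> u) \<in> pspan A z (n + Suc k)"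
    using pspan_scale[OF pspan_shift_pow[OF Suc.prems(1)] w(3)] pspan_mono[of "n + k" "n + Suc k"] by auto
  ultimately show ?case using pspan_add[of "u \<otimes> w'" "n + Suc k"] by (simp only:)
qed

lemma adjoin_subring: "subring (adjoin A z) K"
proof (rule subringI)
  show "adjoin A z \<subseteq> carrier K" unfolding adjoin_def using pspan_carrier by blast
  show "\<one> \<in> adjoin A z" unfolding adjoin_def using pspan_coeff[OF subringE(3)[OF A]] by blast
  fix u assume "u \<in> adjoin A z"
  then obtain n where u: "u \<in> pspan A z n" by (auto simp: adjoin_def)
  then show "\<ominus> u \<in> adjoin A z" unfolding adjoin_def using pspan_neg by blast
  fix w assume "w \<in> adjoin A z"
  then obtain k where w: "w \<in> pspan A z k" by (auto simp: adjoin_def)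
  show "u \<otimes> w \<in> adjoin A z" unfolding adjoin_def using pspan_mult[OF u w] by blast
  have "u \<in> pspan A z (n + k)" "w \<in> pspan A z (n + k)" using u w pspan_mono[of n "n + k"] pspan_mono[of k "n + k"] by auto
  then show "u \<oplus> w \<in> adjoin A z" unfolding adjoin_def using pspan_add by blast
qed

lemma adjoin_superset: "A \<subseteq> adjoin A z"
  unfolding adjoin_def using pspan_coeff by blast

lemma adjoin_mem: "z \<in> adjoin A z"
  unfolding adjoin_def using pspan_pow[OF subringE(3)[OF A], of 1] z by (auto simp del: pspan.simps)

end

text \<open>Dividing by z^n reverses the list of coefficients: the powers z^0, ..., z^(n-1) become
  z^(-n), ..., z^(-1).\<close>

lemma pspan_reverse:
  assumes A: "subring A K" and z: "z \<in> carrier K" and nz: "z \<noteq> \<zero>"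
  shows "u \<in> pspan A z n \<Longrightarrow> \<exists>w\<in>pspan A (inv z) n. u \<otimes> (inv z) [^] n = inv z \<otimes> w"
proof (induction n arbitrary: u)
  case 0 then show ?case using inv_closed[OF z nz] by auto
next
  case (Suc n)
  note iz = inv_closed[OF z nz]
  obtain u' a where u: "u = u' \<oplus> a \<otimes> z [^] n" "u' \<in> pspan A z n" "a \<in> A" using Suc.prems(1) by auto
  obtain w where w: "w \<in> pspan A (inv z) n" "u' \<otimes> (inv z) [^] n = inv z \<otimes> w" using Suc.IH[OF u(2)] by blast
  have wc: "w \<in> carrier K" using pspan_subring[OF carrier_is_subring subringE(1)[OF A] iz] w(1) by blast
  have c: "u' \<in> carrier K" "a \<in> carrier K" using pspan_carrier[OF A z u(2)] subring_carrier[OF A u(3)] by auto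
  define p q where pq: "p = z [^] n" "q = (inv z) [^] n"
  have pqc: "p \<in> carrier K" "q \<in> carrier K" "q \<otimes> p = \<one>" using z iz pow_inv[OF z nz] by (auto simp: pq)
  have "u \<otimes> (inv z) [^] Suc n = inv z \<otimes> (u' \<otimes> q) \<oplus> inv z \<otimes> (a \<otimes> (q \<otimes> p))"
    unfolding u(1) nat_pow_Suc pq[symmetric] using c pqc(1,2) iz by algebra
  also have "\<dots> = inv z \<otimes> (inv z \<otimes> w \<oplus> a)" using w(2) pqc c iz wc by (simp add: pq r_distr)
  finally have "u \<otimes> (inv z) [^] Suc n = inv z \<otimes> (inv z \<otimes> w \<oplus> a)" .
  then show ?case
    using pspan_add[OF A iz pspan_shift[OF A iz w(1)] pspan_coeff[OF A iz u(3)]] by (intro bexI)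
qed

lemma eval_pspan:
  assumes "A \<subseteq> carrier K" "z \<in> carrier K"
  shows "set cs \<subseteq> A \<Longrightarrow> eval cs z \<in> pspan A z (length cs)"
proof (induction cs)
  case (Cons c cs)
  then have "eval cs z \<in> pspan A z (length cs)" by simp
  moreover have "eval cs z \<in> carrier K" using assms Cons.prems eval_in_carrier[of cs z] by auto
  ultimately show ?case using assms Cons.prems a_comm[of "c \<otimes> z [^] length cs" "eval cs z"] by auto
qed simp

lemma pspan_eval:
  assumes "A \<subseteq> carrier K" "z \<in> carrier K"
  shows "u \<in> pspan A z n \<Longrightarrow> \<exists>cs. length cs = n \<and> set cs \<subseteq> A \<and> eval cs z = u"
proof (induction n arbitrary: u)
  case (Suc n)
  then obtain u' a where u: "u = u' \<oplus> a \<otimes> z [^] n" "u' \<in> pspan A z n" "a \<in> A" by auto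
  then obtain cs where cs: "length cs = n" "set cs \<subseteq> A" "eval cs z = u'" using Suc.IH by blast
  have "u' \<in> carrier K" using cs assms eval_in_carrier[of cs z] by auto
  then have "eval (a # cs) z = u" using cs u assms by (auto simp: a_comm)
  then show ?case using cs u(3) by (intro exI[of _ "a # cs"]) auto
qed simp

text \<open>A monic equation solved for its leading power; later arguments work with spans in place
  of polynomials.\<close>

lemma integral_closure_iff:
  assumes A: "subring A K"
  shows "z \<in> integral_closure K A \<longleftrightarrow> z \<in> carrier K \<and> (\<exists>n. z [^] n \<in> pspan A z n)"
proof
  assume "z \<in> integral_closure K A"
  then obtain p where z: "z \<in> carrier K" and p: "polynomial A p" "p \<noteq> []" "lead_coeff p = \<one>" "eval p z = \<zero>"
    by (auto simp: integral_closure_def)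
  then obtain cs where cs: "p = \<one> # cs" by (cases p) auto
  have csA: "set cs \<subseteq> A" using p(1) cs by (auto simp: polynomial_def)
  then have "set cs \<subseteq> carrier K" using subringE(1)[OF A] by blast
  then have c: "eval cs z \<in> carrier K" using eval_in_carrier z by auto
  have "z [^] length cs \<oplus> eval cs z = \<zero>" using p(4) cs z by simp
  then have "z [^] length cs = \<ominus> eval cs z" using c z minus_equality[of "z [^] length cs" "eval cs z"] by simp
  moreover have "eval cs z \<in> pspan A z (length cs)" using eval_pspan[OF subringE(1)[OF A] z csA] .
  ultimately show "z \<in> carrier K \<and> (\<exists>n. z [^] n \<in> pspan A z n)" using pspan_neg[OF A z] z by metis
next
  assume "z \<in> carrier K \<and> (\<exists>n. z [^] n \<in> pspan A z n)"
  then obtain n where z: "z \<in> carrier K" and n: "z [^] n \<in> pspan A z n" by blast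
  obtain cs where cs: "length cs = n" "set cs \<subseteq> A" "eval cs z = \<ominus> (z [^] n)"
    using pspan_eval[OF subringE(1)[OF A] z pspan_neg[OF A z n]] by blast
  have "eval (\<one> # cs) z = \<zero>" using cs z by (simp add: r_neg)
  moreover have "polynomial A (\<one> # cs)" using cs(2) subringE(3)[OF A] by (auto simp: polynomial_def)
  ultimately show "z \<in> integral_closure K A" using z unfolding integral_closure_def by (intro CollectI conjI exI[of _ "\<one> # cs"]) auto
qed

lemma integral_closure_superset:
  assumes A: "subring A K" shows "A \<subseteq> integral_closure K A"
proof
  fix a assume a: "a \<in> A"
  then show "a \<in> integral_closure K A" unfolding integral_closure_iff[OF A]
    using subring_carrier[OF A a] pspan_coeff[OF A subring_carrier[OF A a] a, of 0] by (auto intro!: exI[of _ 1] simp del: pspan.simps)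
qed

lemma integral_closure_mono: 
  assumes "subring A K" "subring B K" "A \<subseteq> B"
  shows "integral_closure K A \<subseteq> integral_closure K B"
  using pspan_mono_set[OF assms(3)] unfolding integral_closure_iff[OF assms(1)] integral_closure_iff[OF assms(2)] subset_iff by blast

text \<open>Dividing a monic equation of degree n by z^(n-1) writes z as a polynomial in 1/z, and
  the computation can be reversed. Integrality thereby becomes membership in a ring.\<close>

lemma integral_iff_adjoin_inv:
  assumes A: "subring A K" and z: "z \<in> carrier K" "z \<noteq> \<zero>"
  shows "z \<in> integral_closure K A \<longleftrightarrow> z \<in> adjoin A (inv z)"
proof
  note iz = inv_closed[OF z]
  assume "z \<in> integral_closure K A"
  then obtain n where "z [^] n \<in> pspan A z n" unfolding integral_closure_iff[OF A] by blast
  then obtain w where w: "w \<in> pspan A (inv z) n" "z [^] n \<otimes> (inv z) [^] n = inv z \<otimes> w"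
    using pspan_reverse[OF A z] by blast
  have wc: "w \<in> carrier K" using pspan_carrier[OF A iz w(1)] .
  have "inv z \<otimes> w = \<one>" using w(2) pow_inv[OF z, of n] z iz by (simp add: m_comm)
  then have "z \<otimes> (inv z \<otimes> w) = z" using z by simp
  then have "z = w" using inv_cancel'[OF z wc] by simp
  then show "z \<in> adjoin A (inv z)" using w(1) by (auto simp: adjoin_def)
next
  note iz = inv_closed[OF z] note iz0 = inv_nonzero[OF z]
  assume "z \<in> adjoin A (inv z)"
  then obtain n where "z \<in> pspan A (inv z) n" by (auto simp: adjoin_def)
  then obtain w where w: "w \<in> pspan A z n" "z \<otimes> z [^] n = z \<otimes> w"
    using pspan_reverse[OF A iz iz0] inv_inverse[OF z] by metis
  have "z [^] n = w" using field_lcancel[OF z _ pspan_carrier[OF A z(1) w(1)] w(2)] z by simp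
  then show "z \<in> integral_closure K A" using w(1) z unfolding integral_closure_iff[OF A] by blast
qed

text \<open>The key step of Chevalley's extension theorem: if \<open>s\<^sup>-\<^sup>1 \<in> A\<close> is not a unit of \<open>A\<close>, it stays
  a nonunit in \<open>A[z]\<close> or in \<open>A[z\<^sup>-\<^sup>1]\<close>.\<close>

lemma chevalley_step:
  assumes A: "subring A K" and s: "s \<in> carrier K" "s \<noteq> \<zero>" "inv s \<in> A"
    and z: "z \<in> carrier K" "z \<noteq> \<zero>"
    and "s \<in> pspan A z (Suc n)" "s \<in> pspan A (inv z) (Suc m)"
  shows "s \<in> A"
  using z assms(7-)
proof (induction "n + m" arbitrary: z n m rule: less_induct)
  case less
  have reduce: "s \<in> pspan A z n" if z: "z \<in> carrier K" "z \<noteq> \<zero>"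
    and sn: "s \<in> pspan A z (Suc n)" and sm: "s \<in> pspan A (inv z) (Suc m)" and nm: "m \<le> n" "0 < n" for z n m
  proof -
    have iz: "inv z \<in> carrier K" using inv_closed[OF z] .
    \<comment> \<open>With b the constant coefficient of w as a polynomial in 1/z, the product (w -
      b) z^n involves only powers of z below n.\<close>
    have low: "\<exists>b\<in>A. (w \<ominus> b) \<otimes> z [^] n \<in> pspan A z n" if "w \<in> pspan A (inv z) (Suc k)" "k \<le> n" for w k
      using that
    proof (induction k arbitrary: w)
      case 0
      then obtain b where b: "b \<in> A" "w = \<zero> \<oplus> b \<otimes> (inv z) [^] (0::nat)" by auto
      have bc: "b \<in> carrier K" using subring_carrier[OF A b(1)] .
      have "w = b" using b bc by simp
      then have "(w \<ominus> b) \<otimes> z [^] n = \<zero>" using bc z by (simp add: a_minus_def r_neg)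
      then show ?case using b(1) pspan_zero[OF A z(1)] by (metis (no_types))
    next
      case (Suc k)
      obtain w' c where w: "w' \<in> pspan A (inv z) (Suc k)" "c \<in> A" "w = w' \<oplus> c \<otimes> (inv z) [^] Suc k"
        using Suc.prems(1) unfolding pspan.simps(2)[of A "inv z" "Suc k"] by blast
      obtain b where b: "b \<in> A" "(w' \<ominus> b) \<otimes> z [^] n \<in> pspan A z n" using Suc.IH[OF w(1)] Suc.prems(2) by auto
      obtain r where r: "n = Suc k + r" using Suc.prems(2) le_Suc_ex by blast
      define p q where pq: "p = z [^] n" "q = (inv z) [^] Suc k"
      have c: "w' \<in> carrier K" "b \<in> carrier K" "c \<in> carrier K" "p \<in> carrier K" "q \<in> carrier K"
        using pspan_carrier[OF A iz w(1)] subring_carrier[OF A] b w z iz by (auto simp: pq)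
      have "q \<otimes> p = ((inv z) [^] Suc k \<otimes> z [^] Suc k) \<otimes> z [^] r"
        unfolding pq r using z iz nat_pow_mult[OF z(1), of "Suc k" r, symmetric] by (simp add: m_assoc del: nat_pow_Suc)
      then have qp: "q \<otimes> p = z [^] r" using pow_inv[OF z, of "Suc k"] z by simp
      have "(w \<ominus> b) \<otimes> p = (w' \<ominus> b) \<otimes> p \<oplus> c \<otimes> (q \<otimes> p)" unfolding w(3) pq(2)[symmetric] using c by algebra
      moreover have "c \<otimes> (q \<otimes> p) \<in> pspan A z n"
        unfolding qp using pspan_pow[OF A z(1) w(2), of r] pspan_mono[OF A z(1), of "Suc r" n] r by auto
      ultimately have "(w \<ominus> b) \<otimes> z [^] n \<in> pspan A z n" using pspan_add[OF A z(1) b(2)] unfolding pq(1) by (simp only:)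
      then show ?case using b(1) by blast
    qed
    obtain b where b: "b \<in> A" "(s \<ominus> b) \<otimes> z [^] n \<in> pspan A z n" using low[OF sm nm(1)] by blast
    obtain u a where u: "s = u \<oplus> a \<otimes> z [^] n" "u \<in> pspan A z n" "a \<in> A" using sn by auto
    define y p where yp: "y = inv s" "p = z [^] n"
    have c: "u \<in> carrier K" "a \<in> carrier K" "b \<in> carrier K" "y \<in> carrier K" "p \<in> carrier K"
      using pspan_carrier[OF A z(1) u(2)] subring_carrier[OF A] u b s z by (auto simp: yp)
    have ys: "y \<otimes> s = \<one>" using inv_l[OF s(1,2)] by (simp add: yp)
    \<comment> \<open>Since y s = 1, the element 1 - y b equals y (s - b). In (1 - y b)(u + a z^n)
      the top term becomes a y (s - b) z^n, which has lower degree in z; this removes the term a z^n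
      from s.\<close>
    have "s \<ominus> b = (\<one> \<ominus> y \<otimes> b) \<otimes> s"
    proof -
      have "(\<one> \<ominus> y \<otimes> b) \<otimes> s = s \<ominus> b \<otimes> (y \<otimes> s)" using c s(1) by algebra
      then show ?thesis using ys c by simp
    qed
    also have "\<dots> = (\<one> \<ominus> y \<otimes> b) \<otimes> u \<oplus> a \<otimes> ((\<one> \<ominus> y \<otimes> b) \<otimes> p)"
      unfolding u(1)[folded yp(2)] using c by algebra
    also have "\<one> \<ominus> y \<otimes> b = y \<otimes> (s \<ominus> b)"
    proof -
      have "y \<otimes> (s \<ominus> b) = y \<otimes> s \<ominus> y \<otimes> b" using c s(1) by algebra
      then show ?thesis using ys by simp
    qed
    finally have "s \<ominus> b = (y \<otimes> (s \<ominus> b)) \<otimes> u \<oplus> a \<otimes> ((y \<otimes> (s \<ominus> b)) \<otimes> p)" .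
    moreover have "y \<otimes> (s \<ominus> b) = \<one> \<ominus> y \<otimes> b"
    proof -
      have "y \<otimes> (s \<ominus> b) = y \<otimes> s \<ominus> y \<otimes> b" using c s(1) by algebra
      then show ?thesis using ys by simp
    qed
    ultimately have "s \<ominus> b = (\<one> \<ominus> y \<otimes> b) \<otimes> u \<oplus> a \<otimes> ((y \<otimes> (s \<ominus> b)) \<otimes> p)" by simp
    then have "s = b \<oplus> ((\<one> \<ominus> y \<otimes> b) \<otimes> u \<oplus> (a \<otimes> y) \<otimes> ((s \<ominus> b) \<otimes> p))"
      using c s(1) by (smt (verit) a_comm a_minus_def add.inv_solve_right' m_assoc minus_closed m_closed add.m_closed one_closed)
    moreover have "b \<in> pspan A z n" using pspan_coeff[OF A z(1) b(1), of "n - 1"] nm(2) by (simp del: pspan.simps)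
    moreover have "(\<one> \<ominus> y \<otimes> b) \<otimes> u \<in> pspan A z n"
      using s(3) b(1) by (intro pspan_scale[OF A z(1) u(2)] subring_minus[OF A] subringE(3,6)[OF A]) (simp add: yp)
    moreover have "(a \<otimes> y) \<otimes> ((s \<ominus> b) \<otimes> p) \<in> pspan A z n"
      using pspan_scale[OF A z(1) b(2) subringE(6)[OF A u(3) s(3)]] unfolding yp .
    ultimately show ?thesis using pspan_add[OF A z(1)] by metis
  qed
  have triv: "s \<in> A" if "s \<in> pspan A w (Suc 0)" for w
    using that subring_carrier[OF A] by auto
  note iz = inv_closed[OF less.prems(1,2)] note iz0 = inv_nonzero[OF less.prems(1,2)]
  show ?case
  proof (cases "n = 0 \<or> m = 0")
    case True then show ?thesis using triv[of z] triv[of "inv z"] less.prems(3,4) by (elim disjE) (simp_all only:)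
  next
    case False
    then obtain n' m' where nm: "n = Suc n'" "m = Suc m'" using not0_implies_Suc by meson
    show ?thesis
    proof (cases "m \<le> n")
      case True
      have "s \<in> pspan A z (Suc n')" using reduce[OF less.prems True] nm by (simp del: pspan.simps)
      then show ?thesis using less.hyps[of n' m z] less.prems nm by simp
    next
      case False
      have "s \<in> pspan A (inv z) (Suc m')"
        using reduce[OF iz iz0 less.prems(4), of n] less.prems(3) inv_inverse[OF less.prems(1,2)] False nm by (simp del: pspan.simps)
      then show ?thesis using less.hyps[of n m' z] less.prems nm by simp
    qed
  qed
qed

text \<open>One of A[z] and A[1/z] avoids s by Chevalley's step, and both contain z, the second
  because z is integral over B.\<close>

lemma extend_avoiding:
  assumes A: "subring A K" and s: "s \<in> carrier K" "s \<noteq> \<zero>" "inv s \<in> A" "s \<notin> A"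
    and B: "subring B K" "B \<subseteq> A" and z: "z \<in> integral_closure K B"
  obtains A' where "subring A' K" "A \<subseteq> A'" "z \<in> A'" "s \<notin> A'"
proof -
  have zc: "z \<in> carrier K" using z unfolding integral_closure_iff[OF B(1)] by blast
  show ?thesis
  proof (cases "z = \<zero>")
    case True then show ?thesis using that[OF A order.refl] s(4) subringE(2)[OF A] by simp
  next
    case False
    note iz = inv_closed[OF zc False]
    show ?thesis
    proof (cases "s \<in> adjoin A z")
      case False
      then show ?thesis using that[OF adjoin_subring[OF A zc] adjoin_superset[OF A zc] adjoin_mem[OF A zc]] by blast
    next
      case True
      then obtain n where n: "s \<in> pspan A z n" by (auto simp: adjoin_def)
      have "s \<notin> adjoin A (inv z)"
      proof
        assume "s \<in> adjoin A (inv z)"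
        then obtain m where m: "s \<in> pspan A (inv z) m" by (auto simp: adjoin_def)
        have "s \<in> pspan A z (Suc n)" "s \<in> pspan A (inv z) (Suc m)"
          using n m pspan_le_Suc[OF A zc, of n] pspan_le_Suc[OF A iz, of m] by blast+
        then show False using chevalley_step[OF A s(1-3) zc False] s(4) by blast
      qed
      moreover have "z \<in> adjoin A (inv z)"
      proof -
        have "z \<in> adjoin B (inv z)" using integral_iff_adjoin_inv[OF B(1) zc False] z by blast
        then show ?thesis unfolding adjoin_def using pspan_mono_set[OF B(2)] by blast
      qed
      ultimately show ?thesis using that[OF adjoin_subring[OF A iz] adjoin_superset[OF A iz]] by blast
    qed
  qed
qed

text \<open>If s were not integral, B[1/s] would avoid s; adding z and then w while still avoiding s
  contradicts that s lies in every ring containing both. Closure of the integral elements under the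
  ring operations follows.\<close>

lemma integral_closure_generated:
  assumes B: "subring B K" and z: "z \<in> integral_closure K B" and w: "w \<in> integral_closure K B"
    and s: "s \<in> carrier K" "\<And>A. subring A K \<Longrightarrow> z \<in> A \<Longrightarrow> w \<in> A \<Longrightarrow> s \<in> A"
  shows "s \<in> integral_closure K B"
proof (rule ccontr)
  assume n: "s \<notin> integral_closure K B"
  have s0: "s \<noteq> \<zero>" using n integral_closure_superset[OF B] subringE(2)[OF B] by blast
  note invs = inv_closed[OF s(1) s0]
  let ?A = "adjoin B (inv s)"
  have A: "subring ?A K" "B \<subseteq> ?A" "inv s \<in> ?A" using adjoin_subring[OF B invs] adjoin_superset[OF B invs] adjoin_mem[OF B invs] by auto
  have sA: "s \<notin> ?A" using n integral_iff_adjoin_inv[OF B s(1) s0] by blast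
  obtain A1 where A1: "subring A1 K" "?A \<subseteq> A1" "z \<in> A1" "s \<notin> A1"
    using extend_avoiding[OF A(1) s(1) s0 A(3) sA B A(2) z] by blast
  have "inv s \<in> A1" "B \<subseteq> A1" using A A1(2) by auto
  then obtain A2 where A2: "subring A2 K" "A1 \<subseteq> A2" "w \<in> A2" "s \<notin> A2"
    using extend_avoiding[OF A1(1) s(1) s0 _ A1(4) B _ w] by blast
  then show False using s(2)[OF A2(1)] A1(3) by blast
qed

lemma integral_closure_subring:
  assumes B: "subring B K" shows "subring (integral_closure K B) K"
proof (rule subringI)
  have c: "z \<in> carrier K" if "z \<in> integral_closure K B" for z using that unfolding integral_closure_iff[OF B] by blast
  show "integral_closure K B \<subseteq> carrier K" using c by blast
  show "\<one> \<in> integral_closure K B" using integral_closure_superset[OF B] subringE(3)[OF B] by blast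
  show "\<ominus> z \<in> integral_closure K B" if z: "z \<in> integral_closure K B" for z
    by (rule integral_closure_generated[OF B z z]) (use c[OF z] subringE(5) in auto)
  show "z \<otimes> w \<in> integral_closure K B" if z: "z \<in> integral_closure K B" "w \<in> integral_closure K B" for z w
    by (rule integral_closure_generated[OF B z]) (use c z subringE(6) in auto)
  show "z \<oplus> w \<in> integral_closure K B" if z: "z \<in> integral_closure K B" "w \<in> integral_closure K B" for z w
    by (rule integral_closure_generated[OF B z]) (use c z subringE(7) in auto)
qed

text \<open>Integral closure commutes with localisation at M: after choosing a common denominator s
  of the coefficients, multiplying the equation of degree n by s^n gives one for s z over A.\<close>

lemma integral_clear_denominators:
  assumes A: "subring A K" and B: "subring B K" and M: "M \<subseteq> A" "\<one> \<in> M" "\<And>s t. s \<in> M \<Longrightarrow> t \<in> M \<Longrightarrow> s \<otimes> t \<in> M"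
    and BA: "\<And>b. b \<in> B \<Longrightarrow> \<exists>s\<in>M. s \<otimes> b \<in> A" and z: "z \<in> integral_closure K B"
  shows "\<exists>s\<in>M. s \<otimes> z \<in> integral_closure K A"
proof -
  obtain n where zc: "z \<in> carrier K" and n: "z [^] n \<in> pspan B z n" using z unfolding integral_closure_iff[OF B] by blast
  have Mc: "s \<in> carrier K" if "s \<in> M" for s using that M(1) subring_carrier[OF A] by blast
  let ?D = "\<lambda>s. {b \<in> carrier K. s \<otimes> b \<in> A}"
  have common: "\<exists>s\<in>M. u \<in> pspan (?D s) z k" if "u \<in> pspan B z k" for u k
    using that
  proof (induction k arbitrary: u)
    case 0 then show ?case using M(2) by auto
  next
    case (Suc k)
    then obtain u' b where u: "u = u' \<oplus> b \<otimes> z [^] k" "u' \<in> pspan B z k" "b \<in> B" by auto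
    obtain s where s: "s \<in> M" "u' \<in> pspan (?D s) z k" using Suc.IH[OF u(2)] by blast
    obtain t where t: "t \<in> M" "t \<otimes> b \<in> A" using BA[OF u(3)] by blast
    have bc: "b \<in> carrier K" using subring_carrier[OF B u(3)] .
    have 1: "?D s \<subseteq> ?D (s \<otimes> t)"
    proof
      fix c assume "c \<in> ?D s"
      then have c: "c \<in> carrier K" "s \<otimes> c \<in> A" by auto
      have "(s \<otimes> t) \<otimes> c = t \<otimes> (s \<otimes> c)" using Mc s(1) t(1) c by (simp add: m_ac)
      then show "c \<in> ?D (s \<otimes> t)" using c subringE(6)[OF A _ c(2), of t] t(1) M(1) by auto
    qed
    have "(s \<otimes> t) \<otimes> b = s \<otimes> (t \<otimes> b)" using Mc s(1) t(1) bc by (simp add: m_ac)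
    then have "b \<in> ?D (s \<otimes> t)" using bc subringE(6)[OF A _ t(2), of s] s(1) M(1) by auto
    then have "u \<in> pspan (?D (s \<otimes> t)) z (Suc k)" unfolding u(1) using s(2) pspan_mono_set[OF 1] by (intro pspan_SucI) auto
    then show ?case using M(3)[OF s(1) t(1)] by blast
  qed
  obtain s where s: "s \<in> M" "z [^] n \<in> pspan (?D s) z n" using common[OF n] by blast
  have sc: "s \<in> carrier K" and sA: "s \<in> A" using Mc s(1) M(1) by auto
  have szc: "s \<otimes> z \<in> carrier K" using sc zc by simp
  have "s [^] k \<otimes> u \<in> pspan A (s \<otimes> z) k" if "u \<in> pspan (?D s) z k" for u k
    using that
  proof (induction k arbitrary: u)
    case 0 then show ?case using sc by simp
  next
    case (Suc k)
    then obtain u' b where u: "u = u' \<oplus> b \<otimes> z [^] k" "u' \<in> pspan (?D s) z k" "b \<in> carrier K" "s \<otimes> b \<in> A" by auto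
    have "?D s \<subseteq> carrier K" by blast
    from pspan_subring[OF carrier_is_subring this zc] have u'c: "u' \<in> carrier K" using u(2) by blast
    have "s [^] Suc k \<otimes> u = s \<otimes> (s [^] k \<otimes> u') \<oplus> (s \<otimes> b) \<otimes> (s \<otimes> z) [^] k"
      unfolding u(1) using u'c u(3) sc zc by (simp add: r_distr nat_pow_distrib m_ac)
    then show ?case using pspan_SucI[OF pspan_scale[OF A szc Suc.IH[OF u(2)] sA] u(4)] by simp
  qed
  from this[OF s(2)] have "(s \<otimes> z) [^] n \<in> pspan A (s \<otimes> z) n" using sc zc by (simp add: nat_pow_distrib)
  then show ?thesis using s(1) szc unfolding integral_closure_iff[OF A] by blast
qed

lemma integral_imp_almost_integral:
  assumes A: "subring A K" and ab: "a \<in> A" "b \<in> A" "b \<noteq> \<zero>" and z: "a \<otimes> inv b \<in> integral_closure K A"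
  shows "\<exists>t\<in>A. t \<noteq> \<zero> \<and> (\<forall>j::nat. t \<otimes> (a \<otimes> inv b) [^] j \<in> A)"
proof -
  define z where "z = a \<otimes> inv b"
  have c: "a \<in> carrier K" "b \<in> carrier K" using ab subring_carrier[OF A] by auto
  have zc: "z \<in> carrier K" unfolding z_def using c inv_closed ab(3) by simp
  have bz: "b \<otimes> z = a" unfolding z_def using c ab(3) inv_closed[OF c(2) ab(3)] inv_r[OF c(2) ab(3)] by (simp add: m_lcomm)
  obtain n where n: "z [^] n \<in> pspan A z n" using z unfolding z_def integral_closure_iff[OF A] by blast
  define t where "t = b [^] n"
  have t: "t \<in> A" "t \<noteq> \<zero>" "t \<in> carrier K" unfolding t_def using subring_pow[OF A ab(2)] nonzero_pow[OF c(2) ab(3)] c by auto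
  have lin: "t \<otimes> (z [^] l \<otimes> u) \<in> A" if "u \<in> pspan A z k" "\<And>i. i < k \<Longrightarrow> t \<otimes> z [^] (l + i) \<in> A" for u k and l :: nat
    using that
  proof (induction k arbitrary: u)
    case 0 then show ?case using t zc subringE(2)[OF A] by simp
  next
    case (Suc k)
    then obtain u' e where u: "u = u' \<oplus> e \<otimes> z [^] k" "u' \<in> pspan A z k" "e \<in> A" by auto
    have k: "u' \<in> carrier K" "e \<in> carrier K" using pspan_carrier[OF A zc u(2)] subring_carrier[OF A u(3)] by auto
    have "t \<otimes> (z [^] l \<otimes> u) = t \<otimes> (z [^] l \<otimes> u') \<oplus> e \<otimes> (t \<otimes> z [^] (l + k))"
      unfolding u(1) using k t(3) zc by (simp add: r_distr nat_pow_mult[symmetric] m_ac)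
    then show ?case using Suc.IH[OF u(2)] Suc.prems(2) subringE(6,7)[OF A] u(3) by simp
  qed
  have "t \<otimes> z [^] j \<in> A" for j :: nat
  proof (induction j rule: less_induct)
    case (less j)
    show ?case
    proof (cases "j \<le> n")
      case True
      then obtain r where r: "n = r + j" using le_Suc_ex by (metis add.commute)
      have "t \<otimes> z [^] j = b [^] r \<otimes> (b \<otimes> z) [^] j" unfolding t_def r using c zc by (simp add: nat_pow_mult[symmetric] nat_pow_distrib m_assoc)
      then show ?thesis unfolding bz using subringE(6)[OF A] subring_pow[OF A] ab by simp
    next
      case False
      then obtain l where l: "j = l + n" using le_Suc_ex by (metis add.commute nat_le_linear)
      have "t \<otimes> z [^] j = t \<otimes> (z [^] l \<otimes> z [^] n)" unfolding l using zc by (simp add: nat_pow_mult)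
      moreover have "t \<otimes> (z [^] l \<otimes> z [^] n) \<in> A" using lin[OF n] less l by simp
      ultimately show ?thesis by simp
    qed
  qed
  then show ?thesis using t z_def by blast
qed

end

section \<open>Discrete valuation rings\<close>

context ambient_field
begin

lemma subring_noetherian_local:
  assumes A: "subring A K" and "noetherian_ring (K\<lparr>carrier := A\<rparr>)" "local_ring (K\<lparr>carrier := A\<rparr>) m"
  shows "noetherian_local (K\<lparr>carrier := A\<rparr>) m"
  unfolding noetherian_local_def noetherian_cring_def noetherian_local_axioms_def
  using assms by (simp add: local_ring_def)

section \<open>Valuation rings of the field and their centers on subrings\<close>

definition valring :: "'a set \<Rightarrow> bool" where
  "valring W \<longleftrightarrow> subring W K \<and> (\<forall>z\<in>carrier K - {\<zero>}. z \<in> W \<or> inv z \<in> W)"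

definition nonunits :: "'a set \<Rightarrow> 'a set" where
  "nonunits W = {w \<in> W. w = \<zero> \<or> inv w \<notin> W}"

text \<open>Rank at most one, stated without a valuation: the powers of a nonunit are eventually
  divisible by any given nonzero element.\<close>

definition archimedean :: "'a set \<Rightarrow> bool" where
  "archimedean W \<longleftrightarrow> (\<forall>a\<in>W - {\<zero>}. \<forall>b\<in>nonunits W. \<exists>k::nat. b [^] k \<otimes> inv a \<in> W)"

context
  fixes W assumes W: "valring W"
begin

lemma valring_subring: "subring W K" using W by (simp add: valring_def)

lemma valring_cases: "z \<in> carrier K \<Longrightarrow> z \<noteq> \<zero> \<Longrightarrow> z \<in> W \<or> inv z \<in> W"
  using W by (simp add: valring_def)

lemma valring_carrier: "z \<in> W \<Longrightarrow> z \<in> carrier K"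
  using subring_carrier[OF valring_subring] .

lemma zero_nonunit: "\<zero> \<in> nonunits W"
  using subringE(2)[OF valring_subring] by (simp add: nonunits_def)

lemma one_not_nonunit: "\<one> \<notin> nonunits W"
  using subringE(3)[OF valring_subring] by (simp add: nonunits_def)

lemma nonunits_subset: "nonunits W \<subseteq> W" by (auto simp: nonunits_def)

lemma nonunit_iff: "a \<in> W \<Longrightarrow> a \<notin> nonunits W \<longleftrightarrow> a \<noteq> \<zero> \<and> inv a \<in> W"
  by (auto simp: nonunits_def)

lemma nonunits_mult:
  assumes "a \<in> nonunits W" "b \<in> W" shows "b \<otimes> a \<in> nonunits W"
proof (rule ccontr)
  assume n: "b \<otimes> a \<notin> nonunits W"
  have c: "a \<in> W" "a \<in> carrier K" "b \<in> carrier K" using assms nonunits_subset valring_carrier by auto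
  have "b \<otimes> a \<in> W" using subringE(6)[OF valring_subring assms(2) c(1)] .
  then have u: "b \<otimes> a \<noteq> \<zero>" "inv (b \<otimes> a) \<in> W" using n nonunit_iff by auto
  then have nz: "a \<noteq> \<zero>" "b \<noteq> \<zero>" using c by auto
  have "inv a = b \<otimes> inv (b \<otimes> a)" using c nz inv_closed inv_cancel'[of b "inv a"] inv_distrib[of b a] by simp
  then have "inv a \<in> W" using subringE(6)[OF valring_subring assms(2) u(2)] by simp
  then show False using assms(1) nz by (simp add: nonunits_def)
qed

lemma nonunits_add:
  assumes "a \<in> nonunits W" "b \<in> nonunits W" shows "a \<oplus> b \<in> nonunits W"
proof -
  have *: "a \<oplus> b \<in> nonunits W" if ab: "a \<in> nonunits W" "b \<in> nonunits W" "b \<noteq> \<zero>" "a \<otimes> inv b \<in> W" for a b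
  proof -
    have c: "a \<in> carrier K" "b \<in> carrier K" using ab nonunits_subset valring_carrier by auto
    have ib: "inv b \<in> carrier K" using inv_closed c ab by simp
    have "(\<one> \<oplus> a \<otimes> inv b) \<otimes> b = b \<oplus> a \<otimes> (inv b \<otimes> b)" using c ib by algebra
    then have "a \<oplus> b = (\<one> \<oplus> a \<otimes> inv b) \<otimes> b" using c inv_l[OF c(2) ab(3)] by (simp add: a_comm)
    moreover have "\<one> \<oplus> a \<otimes> inv b \<in> W" using ab(4) subringE(3,7)[OF valring_subring] by simp
    ultimately show ?thesis using nonunits_mult[OF ab(2)] by simp
  qed
  have c: "a \<in> carrier K" "b \<in> carrier K" using assms nonunits_subset valring_carrier by auto
  show ?thesis
  proof (cases "a = \<zero> \<or> b = \<zero>")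
    case True then show ?thesis using assms c by auto
  next
    case False
    then have nz: "a \<noteq> \<zero>" "b \<noteq> \<zero>" by auto
    have q: "a \<otimes> inv b \<in> carrier K" "a \<otimes> inv b \<noteq> \<zero>" "inv (a \<otimes> inv b) = b \<otimes> inv a"
      using c nz inv_closed inv_nonzero nonzero_mult inv_distrib[of a "inv b"] inv_inverse by (auto simp: m_comm)
    show ?thesis using valring_cases[OF q(1,2)] *[OF assms nz(2)] *[OF assms(2,1) nz(1)] q(3) c by (auto simp: a_comm)
  qed
qed

lemma nonunits_prime:
  assumes "a \<in> W" "b \<in> W" "a \<otimes> b \<in> nonunits W" shows "a \<in> nonunits W \<or> b \<in> nonunits W"
proof (rule ccontr)
  assume "\<not> ?thesis"
  then have u: "a \<noteq> \<zero>" "inv a \<in> W" "b \<noteq> \<zero>" "inv b \<in> W" using assms nonunit_iff by auto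
  have c: "a \<in> carrier K" "b \<in> carrier K" using assms valring_carrier by auto
  have "inv (a \<otimes> b) \<in> W" unfolding inv_distrib[OF c(1) u(1) c(2) u(3)] using subringE(6)[OF valring_subring u(2,4)] .
  then show False using assms(3) nonzero_mult[OF c(1) u(1) c(2) u(3)] by (simp add: nonunits_def)
qed

lemma nonunits_pow: "a \<in> W \<Longrightarrow> a [^] (n::nat) \<in> nonunits W \<Longrightarrow> a \<in> nonunits W"
proof (induction n)
  case 0 then show ?case using one_not_nonunit by simp
next
  case (Suc n) then show ?case using nonunits_prime[OF subring_pow[OF valring_subring, of a n]] by auto
qed

text \<open>An integral z outside W has 1/z in W, but then z lies in W[1/z], which is W.\<close>

lemma valring_integrally_closed: "integral_closure K W \<subseteq> W"
proof
  fix z assume z: "z \<in> integral_closure K W"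
  then have zc: "z \<in> carrier K" by (simp add: integral_closure_def)
  show "z \<in> W"
  proof (cases "z = \<zero>")
    case True then show ?thesis using subringE(2)[OF valring_subring] by simp
  next
    case False
    show ?thesis
    proof (rule ccontr)
      assume n: "z \<notin> W"
      then have "inv z \<in> W" using valring_cases[OF zc False] by blast
      then have "adjoin W (inv z) \<subseteq> W" unfolding adjoin_def using pspan_subring[OF valring_subring] by blast
      then show False using z n integral_iff_adjoin_inv[OF valring_subring zc False] by blast
    qed
  qed
qed

lemma center_prime:
  assumes B: "subring B K" "B \<subseteq> W"
  shows "primeideal (nonunits W \<inter> B) (K\<lparr>carrier := B\<rparr>)"
proof -
  interpret B: domain "K\<lparr>carrier := B\<rparr>" by (rule subring_is_domain[OF B(1)])
  show ?thesis
  proof (rule primeidealI)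
    show "ideal (nonunits W \<inter> B) (K\<lparr>carrier := B\<rparr>)"
      by (rule B.ideal_intro_comm) (use B zero_nonunit subringE(2,6,7)[OF B(1)] nonunits_add nonunits_mult in auto)
    show "cring (K\<lparr>carrier := B\<rparr>)" by (rule B.is_cring)
    show "carrier (K\<lparr>carrier := B\<rparr>) \<noteq> nonunits W \<inter> B" using one_not_nonunit subringE(3)[OF B(1)] by auto
    show "a \<in> nonunits W \<inter> B \<or> b \<in> nonunits W \<inter> B"
      if "a \<in> carrier (K\<lparr>carrier := B\<rparr>)" "b \<in> carrier (K\<lparr>carrier := B\<rparr>)" "a \<otimes>\<^bsub>K\<lparr>carrier := B\<rparr>\<^esub> b \<in> nonunits W \<inter> B" for a b
      using that B(2) nonunits_prime[of a b] by auto
  qed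
qed

lemma center_localization:
  assumes B: "subring B K" "B \<subseteq> W" and WB: "\<And>w. w \<in> W \<Longrightarrow> \<exists>a\<in>B. \<exists>b\<in>B - nonunits W. w = a \<otimes> inv b"
  shows "localization_at K B (nonunits W \<inter> B) = W"
proof
  show "localization_at K B (nonunits W \<inter> B) \<subseteq> W"
  proof
    fix z assume "z \<in> localization_at K B (nonunits W \<inter> B)"
    then obtain a b where ab: "a \<in> B" "b \<in> B" "b \<notin> nonunits W" "z = a \<otimes> inv b" by (auto simp: localization_at_def)
    then have "inv b \<in> W" using B(2) nonunit_iff by auto
    then show "z \<in> W" using ab B(2) subringE(6)[OF valring_subring] by auto
  qed
  show "W \<subseteq> localization_at K B (nonunits W \<inter> B)"
    using WB unfolding localization_at_def by blast
qed

text \<open>For a nonzero a in a prime below the center and b in the center, some b^j is a multiple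
  of a in W; clearing the denominator s, a unit of W, gives s b^j in that prime. So the prime
  contains b. The element x makes the center nonzero.\<close>

lemma center_height:
  assumes B: "subring B K" "B \<subseteq> W" and WB: "\<And>w. w \<in> W \<Longrightarrow> \<exists>a\<in>B. \<exists>b\<in>B - nonunits W. w = a \<otimes> inv b"
    and arch: "archimedean W" and x: "x \<in> nonunits W \<inter> B" "x \<noteq> \<zero>"
  shows "prime_height (K\<lparr>carrier := B\<rparr>) (nonunits W \<inter> B) = 1"
proof -
  let ?B = "K\<lparr>carrier := B\<rparr>" and ?Q = "nonunits W \<inter> B"
  interpret B: domain ?B by (rule subring_is_domain[OF B(1)])
  have Q: "primeideal ?Q ?B" by (rule center_prime[OF B])
  have zero: "primeideal {\<zero>} ?B" using B.zeroprimeideal by simp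
  have small: "n \<le> 1" if ch: "prime_chain ?B P n" "P n = ?Q" for P n
  proof (rule ccontr)
    assume "\<not> n \<le> 1"
    then obtain k where k: "n = Suc (Suc k)" by (metis One_nat_def Suc_le_mono less_eq_nat.simps(1) not0_implies_Suc)
    have pr: "primeideal (P (Suc k)) ?B" and sub: "P k \<subset> P (Suc k)" "P (Suc k) \<subset> ?Q" and pr0: "primeideal (P k) ?B"
      using ch k by (auto simp: prime_chain_def)
    note D = B.primeideal_D[OF pr]
    have "\<zero> \<in> P k" using B.ideal_zero[OF B.primeideal_D(1)[OF pr0]] by simp
    then obtain a where a: "a \<in> P (Suc k)" "a \<noteq> \<zero>" using sub(1) by blast
    obtain b where b: "b \<in> nonunits W" "b \<in> B" "b \<notin> P (Suc k)" using sub(2) by blast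
    have aB: "a \<in> B" using a D(3) by auto
    have ac: "a \<in> carrier K" "b \<in> carrier K" using aB b B(2) valring_carrier by auto
    obtain j where j: "b [^] (j::nat) \<otimes> inv a \<in> W" using arch a(2) aB B(2) b(1) unfolding archimedean_def by blast
    obtain c s where cs: "c \<in> B" "s \<in> B" "s \<notin> nonunits W" "b [^] j \<otimes> inv a = c \<otimes> inv s" using WB[OF j] by blast
    have s: "s \<in> carrier K" "s \<noteq> \<zero>" "c \<in> carrier K" using cs B(2) valring_carrier zero_nonunit by auto
    have "s \<otimes> b [^] j = s \<otimes> ((b [^] j \<otimes> inv a) \<otimes> a)" using ac a(2) inv_closed inv_l by (simp add: m_assoc)
    also have "\<dots> = s \<otimes> (inv s \<otimes> (c \<otimes> a))" unfolding cs(4) using s ac inv_closed[OF s(1,2)] by (simp add: m_ac)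
    also have "\<dots> = c \<otimes> a" using inv_cancel'[OF s(1,2)] s ac by simp
    finally have "s \<otimes> b [^] j \<in> P (Suc k)" using B.ideal_lmult[OF D(1) a(1)] cs(1) by simp
    moreover have "b [^] j \<in> B" using subring_pow[OF B(1) b(2)] .
    ultimately have "s \<in> P (Suc k) \<or> b [^] j \<in> P (Suc k)" using D(4)[of s "b [^] j"] cs(2) by simp
    moreover have "b [^]\<^bsub>?B\<^esub> j = b [^] j" using nat_pow_consistent[of b j B] by simp
    ultimately have "s \<in> P (Suc k)" using B.primeideal_pow[OF pr, of b j] b by auto
    then show False using sub(2) cs(3) by blast
  qed
  have one: "prime_chain ?B (\<lambda>i. if i = 0 then {\<zero>} else ?Q) 1"
    unfolding prime_chain_def using zero Q zero_nonunit subringE(2)[OF B(1)] x by auto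
  have "{enat n | n. \<exists>P. prime_chain ?B P n \<and> P n = ?Q} \<subseteq> {..1}"
    using small by (auto simp: one_enat_def)
  moreover have "1 \<in> {enat n | n. \<exists>P. prime_chain ?B P n \<and> P n = ?Q}"
    using one by (auto simp: one_enat_def intro!: exI[of _ "\<lambda>i. if i = 0 then {\<zero>} else ?Q"])
  ultimately show ?thesis unfolding prime_height_def
    by (intro antisym Sup_least Sup_upper) auto
qed

end

text \<open>A generator g of the ideal (a, b) satisfies a = a' g and b = b' g with r a' + s b' = 1,
  so a' or b' is a unit of the local ring and one of a, b divides the other. The Archimedean
  property is Krull's intersection theorem for the zero ideal.\<close>

lemma dvr_valring:
  assumes W: "subring W K" and dvr: "dvr (K\<lparr>carrier := W\<rparr>)"
    and frac: "\<And>z. z \<in> carrier K \<Longrightarrow> \<exists>a\<in>W. \<exists>b\<in>W - {\<zero>}. z = a \<otimes> inv b"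
  shows "valring W" "archimedean W"
proof -
  let ?W = "K\<lparr>carrier := W\<rparr>"
  interpret P: principal_domain ?W using dvr by (simp add: dvr_def)
  obtain m where m: "local_ring ?W m" using dvr by (auto simp: dvr_def)
  interpret L: noetherian_local ?W m by (rule subring_noetherian_local[OF W P.noetherian_ring_axioms m])
  have unit: "inv u \<in> W" if u: "u \<in> W" "u \<notin> m" for u
  proof -
    obtain v where v: "v \<in> W" "v \<otimes> u = \<one>" using L.ex_inverse[of u] u by auto
    then have "inv u = v" using u subring_carrier[OF W] by (intro inv_unique_eq) (auto simp: m_comm)
    then show ?thesis using v by simp
  qed
  have dv: "b \<otimes> inv a \<in> W \<or> a \<otimes> inv b \<in> W" if ab: "a \<in> W" "b \<in> W" "a \<noteq> \<zero>" "b \<noteq> \<zero>" for a b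
  proof -
    have c: "a \<in> carrier K" "b \<in> carrier K" using ab subring_carrier[OF W] by auto
    have iPa: "ideal (PIdl\<^bsub>?W\<^esub> a) ?W" using P.cgenideal_ideal ab by simp
    have iJ: "ideal (P.adj (PIdl\<^bsub>?W\<^esub> a) b) ?W" using P.ideal_adj[OF iPa] ab by simp
    then obtain g where g: "g \<in> W" "P.adj (PIdl\<^bsub>?W\<^esub> a) b = PIdl\<^bsub>?W\<^esub> g" using P.exists_gen by auto
    have gc: "g \<in> carrier K" using g subring_carrier[OF W] by auto
    have "a \<in> P.adj (PIdl\<^bsub>?W\<^esub> a) b" using P.subset_adj[OF iPa, of b] P.cgenideal_self[of a] ab by auto
    then obtain a' where a': "a' \<in> W" "a = a' \<otimes> g" unfolding g(2) by (auto simp: cgenideal_def)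
    have "b \<in> P.adj (PIdl\<^bsub>?W\<^esub> a) b" using P.self_adj[OF iPa, of b] ab by auto
    then obtain b' where b': "b' \<in> W" "b = b' \<otimes> g" unfolding g(2) by (auto simp: cgenideal_def)
    have "g \<in> P.adj (PIdl\<^bsub>?W\<^esub> a) b" unfolding g(2) using P.cgenideal_self[of g] g by auto
    then obtain r s where rs: "r \<in> W" "s \<in> W" "g = r \<otimes> a \<oplus> s \<otimes> b"
      using P.mem_adj[of b g "PIdl\<^bsub>?W\<^esub> a"] ab by (auto simp: cgenideal_def)
    have k: "a' \<in> carrier K" "b' \<in> carrier K" "r \<in> carrier K" "s \<in> carrier K" using a'(1) b'(1) rs(1,2) subring_carrier[OF W] by simp_all
    have g0: "g \<noteq> \<zero>" using a'(2) ab(3) k(1) by auto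
    have "g \<otimes> (r \<otimes> a' \<oplus> s \<otimes> b') = r \<otimes> (a' \<otimes> g) \<oplus> s \<otimes> (b' \<otimes> g)" using k gc by algebra
    also have "\<dots> = g \<otimes> \<one>" using rs(3) a'(2) b'(2) gc by simp
    finally have e: "r \<otimes> a' \<oplus> s \<otimes> b' = \<one>" using field_lcancel[OF gc g0] k by simp
    have "a' \<notin> m \<or> b' \<notin> m"
    proof (rule ccontr)
      assume "\<not> ?thesis"
      then have "\<one> \<in> m" using P.ideal_add[OF L.m_ideal P.ideal_lmult[OF L.m_ideal] P.ideal_lmult[OF L.m_ideal], of a' r b' s] rs(1,2) e by simp
      then show False using P.primeideal_D(2)[OF L.m_prime] by simp
    qed
    moreover have "q \<otimes> inv p \<in> W" if p: "p' \<in> W" "p = p' \<otimes> g" "p' \<notin> m" "p \<noteq> \<zero>" and q: "q' \<in> W" "q = q' \<otimes> g" for p p' q q'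
    proof -
      have kc: "p' \<in> carrier K" "q' \<in> carrier K" using p q subring_carrier[OF W] by auto
      have p0: "p' \<noteq> \<zero>" using p kc gc by auto
      have "q \<otimes> inv p = q' \<otimes> inv p' \<otimes> (inv g \<otimes> g)" unfolding p(2) q(2) inv_distrib[OF kc(1) p0 gc g0]
        using kc gc inv_closed[OF gc g0] inv_closed[OF kc(1) p0] by (simp add: m_ac)
      then have "q \<otimes> inv p = q' \<otimes> inv p'" using inv_l[OF gc g0] kc inv_closed[OF kc(1) p0] by simp
      then show ?thesis using subringE(6)[OF W q(1) unit[OF p(1,3)]] by simp
    qed
    ultimately show ?thesis using a' b' ab by blast
  qed
  show vr: "valring W" unfolding valring_def
  proof (intro conjI ballI W)
    fix z assume z: "z \<in> carrier K - {\<zero>}"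
    obtain a b where ab: "a \<in> W" "b \<in> W" "b \<noteq> \<zero>" "z = a \<otimes> inv b" using frac z by blast
    have c: "a \<in> carrier K" "b \<in> carrier K" "inv b \<in> carrier K" using ab subring_carrier[OF W] inv_closed by auto
    have a0: "a \<noteq> \<zero>" using ab z c by auto
    have "inv z = inv a \<otimes> b" unfolding ab(4) using inv_distrib[OF c(1) a0 c(3) inv_nonzero[OF c(2) ab(3)]] inv_inverse[OF c(2) ab(3)] by simp
    then have "inv z = b \<otimes> inv a" using c inv_closed[OF c(1) a0] by (simp add: m_comm)
    then show "z \<in> W \<or> inv z \<in> W" using dv[OF ab(1,2) a0 ab(3)] ab(4) by auto
  qed
  show "archimedean W" unfolding archimedean_def
  proof (intro ballI)
    fix a b assume a: "a \<in> W - {\<zero>}" and b: "b \<in> nonunits W"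
    have bW: "b \<in> W" using b by (simp add: nonunits_def)
    have c: "a \<in> carrier K" "b \<in> carrier K" using a bW subring_carrier[OF W] by auto
    show "\<exists>k::nat. b [^] k \<otimes> inv a \<in> W"
    proof (cases "b = \<zero>")
      case True
      then have "b [^] (1::nat) \<otimes> inv a = \<zero>" using inv_closed a c by simp
      then show ?thesis using subringE(2)[OF W] by metis
    next
      case False
      have bm: "b \<in> m"
      proof (rule ccontr)
        assume "b \<notin> m"
        then have "inv b \<in> W" using unit bW by blast
        then show False using b False by (simp add: nonunits_def)
      qed
      have iz: "ideal {\<zero>} ?W" using P.zeroideal by simp
      obtain k where k: "a \<notin> P.adj {\<zero>} (b [^]\<^bsub>?W\<^esub> (k::nat))" using L.krull_intersection[OF iz bm, of a] a by auto
      have bk: "b [^]\<^bsub>?W\<^esub> k = b [^] k" using nat_pow_consistent[of b k W] by simp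
      have bkW: "b [^] k \<in> W" using subring_pow[OF W bW] .
      have bk0: "b [^] k \<noteq> \<zero>" "b [^] k \<in> carrier K" using nonzero_pow c False by auto
      have "a \<otimes> inv (b [^] k) \<notin> W"
      proof
        assume w: "a \<otimes> inv (b [^] k) \<in> W"
        have "a = \<zero> \<oplus> (a \<otimes> inv (b [^] k)) \<otimes> b [^] k" using c bk0 inv_closed inv_l by (simp add: m_assoc)
        then have "a \<in> P.adj {\<zero>} (b [^]\<^bsub>?W\<^esub> k)" using P.mem_adj[of "b [^] k" a "{\<zero>}"] w bkW unfolding bk by auto
        then show False using k by simp
      qed
      then show ?thesis using dv[of a "b [^] k"] a bkW bk0 by blast
    qed
  qed
qed

section \<open>Normalized valuations\<close>

context
  fixes v assumes v: "normalized_valuation K v"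
begin

lemma val_mult:
  assumes "a \<in> carrier K" "a \<noteq> \<zero>" "b \<in> carrier K" "b \<noteq> \<zero>" shows "v (a \<otimes> b) = v a + v b"
proof -
  have "v \<in> hom (mult_of K) integer_group" using v by (simp add: normalized_valuation_def epi_def)
  from hom_mult[OF this, of a b] assms show ?thesis by simp
qed

lemma val_one: "v \<one> = 0"
  using val_mult[of \<one> \<one>] by simp

lemma val_inv: "a \<in> carrier K \<Longrightarrow> a \<noteq> \<zero> \<Longrightarrow> v (inv a) = - v a"
  using val_mult[of a "inv a"] val_one inv_r[of a] inv_closed[of a] inv_nonzero[of a] by simp

lemma val_pow: "a \<in> carrier K \<Longrightarrow> a \<noteq> \<zero> \<Longrightarrow> v (a [^] (n::nat)) = int n * v a"
proof (induction n)
  case 0 then show ?case using val_one by simp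
next
  case (Suc n) then show ?case using val_mult[of "a [^] n" a] nonzero_pow[of a n] by (simp add: algebra_simps)
qed

lemma val_add:
  "a \<in> carrier K \<Longrightarrow> a \<noteq> \<zero> \<Longrightarrow> b \<in> carrier K \<Longrightarrow> b \<noteq> \<zero> \<Longrightarrow> a \<oplus> b \<noteq> \<zero> \<Longrightarrow> min (v a) (v b) \<le> v (a \<oplus> b)"
  using v by (simp add: normalized_valuation_def)

lemma val_neg: "a \<in> carrier K \<Longrightarrow> a \<noteq> \<zero> \<Longrightarrow> v (\<ominus> a) = v a"
proof -
  assume a: "a \<in> carrier K" "a \<noteq> \<zero>"
  have m: "\<ominus> \<one> \<noteq> \<zero>" using minus_minus[OF one_closed] by (metis minus_zero one_not_zero)
  have "(\<ominus> \<one>) \<otimes> (\<ominus> \<one>) = \<one>" by (simp add: l_minus)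
  then have "v (\<ominus> \<one>) = 0" using val_mult[of "\<ominus> \<one>" "\<ominus> \<one>"] m val_one by simp
  moreover have "\<ominus> a = (\<ominus> \<one>) \<otimes> a" using a by (simp add: l_minus)
  ultimately show ?thesis using val_mult[of "\<ominus> \<one>" a] m a by simp
qed

lemma val_uniformizer: obtains a where "a \<in> carrier K" "a \<noteq> \<zero>" "v a = 1"
proof -
  have "v ` carrier (mult_of K) = UNIV" using v by (simp add: normalized_valuation_def epi_def)
  then have "1 \<in> v ` carrier (mult_of K)" by simp
  then obtain a where "1 = v a" "a \<in> carrier (mult_of K)" by (rule imageE)
  then show ?thesis using that[of a] by simp
qed

lemma valuation_ring_subring: "subring (valuation_ring K v) K"
proof (rule subringI)
  show "valuation_ring K v \<subseteq> carrier K" by (auto simp: valuation_ring_def)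
  show "\<one> \<in> valuation_ring K v" by (simp add: valuation_ring_def val_one)
  show "\<ominus> a \<in> valuation_ring K v" if "a \<in> valuation_ring K v" for a
    using that val_neg[of a] by (auto simp: valuation_ring_def)
  show "a \<otimes> b \<in> valuation_ring K v" if "a \<in> valuation_ring K v" "b \<in> valuation_ring K v" for a b
    using that val_mult[of a b] by (cases "a = \<zero> \<or> b = \<zero>") (auto simp: valuation_ring_def)
  show "a \<oplus> b \<in> valuation_ring K v" if "a \<in> valuation_ring K v" "b \<in> valuation_ring K v" for a b
    using that val_add[of a b] by (cases "a = \<zero> \<or> b = \<zero>") (auto simp: valuation_ring_def)
qed

lemma valuation_ring_valring: "valring (valuation_ring K v)"
  unfolding valring_def
proof (intro conjI ballI valuation_ring_subring)
  fix z assume "z \<in> carrier K - {\<zero>}"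
  then show "z \<in> valuation_ring K v \<or> inv z \<in> valuation_ring K v"
    using val_inv[of z] inv_closed[of z] by (auto simp: valuation_ring_def)
qed

lemma valuation_ring_nonunits:
  "nonunits (valuation_ring K v) = {a \<in> carrier K. a = \<zero> \<or> 0 < v a}"
proof -
  have "a \<in> nonunits (valuation_ring K v) \<longleftrightarrow> a \<in> carrier K \<and> (a = \<zero> \<or> 0 < v a)" for a
  proof (cases "a \<in> carrier K \<and> a \<noteq> \<zero>")
    case True
    then show ?thesis using val_inv[of a] inv_closed[of a] inv_nonzero[of a]
      by (auto simp: nonunits_def valuation_ring_def)
  qed (auto simp: nonunits_def valuation_ring_def)
  then show ?thesis by blast
qed

lemma valuation_ring_dvr: "dvr (K\<lparr>carrier := valuation_ring K v\<rparr>)"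
proof -
  let ?V = "valuation_ring K v" let ?R = "K\<lparr>carrier := ?V\<rparr>"
  note sub = valuation_ring_subring
  interpret V: domain ?R by (rule subring_is_domain[OF sub])
  have carr: "a \<in> ?V \<longleftrightarrow> a \<in> carrier K \<and> (a = \<zero> \<or> 0 \<le> v a)" for a by (auto simp: valuation_ring_def)
  have "principal_domain ?R"
  proof
    fix I assume I: "ideal I ?R"
    show "\<exists>a\<in>carrier ?R. I = PIdl\<^bsub>?R\<^esub> a"
    proof (cases "I \<subseteq> {\<zero>}")
      case True
      then have "I = PIdl\<^bsub>?R\<^esub> \<zero>" using V.ideal_zero[OF I] carr V.cgenideal_self[of \<zero>] by (auto simp: cgenideal_def)
      then show ?thesis using subringE(2)[OF sub] by auto
    next
      case False
      define N where "N = (\<lambda>a. nat (v a)) ` (I - {\<zero>})"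
      have "N \<noteq> {}" using False by (auto simp: N_def)
      then have "(LEAST n. n \<in> N) \<in> N" by (meson LeastI ex_in_conv)
      then obtain a where "(LEAST n. n \<in> N) = nat (v a)" "a \<in> I - {\<zero>}" unfolding N_def by (rule imageE)
      then have a: "a \<in> I" "a \<noteq> \<zero>" "nat (v a) = (LEAST n. n \<in> N)" by auto
      have Ic: "b \<in> ?V" if "b \<in> I" for b using V.ideal_carrier[OF I that] by simp
      have ac: "a \<in> carrier K" "0 \<le> v a" using Ic[OF a(1)] a(2) by (auto simp: carr)
      have "I \<subseteq> PIdl\<^bsub>?R\<^esub> a"
      proof
        fix b assume b: "b \<in> I"
        have bc: "b \<in> carrier K" using Ic[OF b] by (simp add: carr)
        have "b \<otimes> inv a \<in> ?V"
        proof (cases "b = \<zero>")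
          case True then show ?thesis using inv_closed[OF ac(1) a(2)] subringE(2)[OF sub] by simp
        next
          case False
          then have "nat (v a) \<le> nat (v b)" unfolding a(3) using b by (intro Least_le) (auto simp: N_def)
          moreover have "0 \<le> v b" using Ic[OF b] False by (simp add: carr)
          ultimately have "v a \<le> v b" using ac(2) by simp
          then show ?thesis
            using val_mult[OF bc False inv_closed[OF ac(1) a(2)] inv_nonzero[OF ac(1) a(2)]] val_inv[OF ac(1) a(2)] bc
              inv_closed[OF ac(1) a(2)] by (simp add: carr)
        qed
        moreover have "b = (b \<otimes> inv a) \<otimes> a" using bc ac a(2) inv_closed inv_l by (simp add: m_assoc)
        ultimately show "b \<in> PIdl\<^bsub>?R\<^esub> a" by (auto simp: cgenideal_def)
      qed
      then show ?thesis using V.cgenideal_minimal[OF I a(1)] Ic[OF a(1)] by auto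
    qed
  qed
  moreover have "local_ring ?R (nonunits ?V)" unfolding local_ring_def
  proof (intro conjI allI V.is_cring)
    note vr = valuation_ring_valring
    have pn: "primeideal (nonunits ?V \<inter> ?V) ?R" by (rule center_prime[OF vr sub order.refl])
    have "nonunits ?V \<inter> ?V = nonunits ?V" using nonunits_subset[OF vr] by blast
    then have iN: "ideal (nonunits ?V) ?R" using V.primeideal_D(1)[OF pn] by simp
    have full: "J = ?V" if J: "ideal J ?R" "u \<in> J" "u \<notin> nonunits ?V" for J u
    proof -
      have uV: "u \<in> ?V" using V.ideal_carrier[OF J(1,2)] by simp
      then have u: "u \<noteq> \<zero>" "inv u \<in> ?V" "u \<in> carrier K" using nonunit_iff[OF vr] J(3) by (auto simp: carr)
      have "inv u \<otimes> u \<in> J" using V.ideal_lmult[OF J(1,2), of "inv u"] u by simp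
      then have "\<one> \<in> J" using inv_l u by simp
      then show ?thesis using ideal.one_imp_carrier[OF J(1)] by simp
    qed
    fix M
    show "maximalideal M ?R \<longleftrightarrow> M = nonunits ?V"
    proof
      assume M: "maximalideal M ?R"
      have iM: "ideal M ?R" "M \<noteq> ?V" using maximalideal.axioms(1)[OF M] maximalideal.I_notcarr[OF M] by auto
      have "M \<subseteq> nonunits ?V" using full[OF iM(1)] iM(2) by blast
      moreover have "nonunits ?V \<subseteq> carrier ?R" using nonunits_subset[OF vr] by simp
      ultimately have "nonunits ?V = M \<or> nonunits ?V = ?V" using maximalideal.I_maximal[OF M iN] by simp
      then show "M = nonunits ?V" using one_not_nonunit[OF vr] subringE(3)[OF sub] by auto
    next
      assume M: "M = nonunits ?V"
      show "maximalideal M ?R"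
      proof (rule maximalidealI)
        show "ideal M ?R" using iN M by simp
        show "carrier ?R \<noteq> M" using M one_not_nonunit[OF vr] subringE(3)[OF sub] by auto
        show "J = M \<or> J = carrier ?R" if "ideal J ?R" "M \<subseteq> J" "J \<subseteq> carrier ?R" for J
          using full[OF that(1)] that(2) M by auto
      qed
    qed
  qed
  moreover have "\<not> field ?R"
  proof
    assume "field ?R"
    then interpret F: field ?R .
    obtain a where a: "a \<in> carrier K" "a \<noteq> \<zero>" "v a = 1" using val_uniformizer .
    then have "a \<in> carrier ?R - {\<zero>\<^bsub>?R\<^esub>}" by (simp add: carr)
    then have "a \<in> Units ?R" using F.field_Units by blast
    then obtain b where b: "b \<in> ?V" "b \<otimes> a = \<one>" by (auto simp: Units_def)
    have bc: "b \<in> carrier K" "b \<noteq> \<zero>" using b a by (auto simp: carr)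
    then have "0 \<le> v b" using b by (simp add: carr)
    then show False using val_mult[OF bc a(1,2)] b(2) a(3) val_one by simp
  qed
  ultimately show ?thesis unfolding dvr_def by blast
qed

end

text \<open>Comparing z with a power of an element of w-value one gives v as a multiple of w;
  surjectivity of v forces the factor to be one.\<close>

lemma valuation_unique:
  assumes v: "normalized_valuation K v" and w: "normalized_valuation K w" and eq: "valuation_ring K v = valuation_ring K w"
  shows "v = w"
proof -
  have nn: "0 \<le> v z \<longleftrightarrow> 0 \<le> w z" if "z \<in> carrier K" "z \<noteq> \<zero>" for z
    using eq that by (auto simp: valuation_ring_def set_eq_iff)
  obtain a where a: "a \<in> carrier K" "a \<noteq> \<zero>" "w a = 1" using val_uniformizer[OF w] .
  have lin: "v z = w z * v a" if z: "z \<in> carrier K" "z \<noteq> \<zero>" "0 \<le> w z" for z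
  proof -
    define n where "n = nat (w z)"
    define y where "y = z \<otimes> inv (a [^] n)"
    have an: "a [^] n \<in> carrier K" "a [^] n \<noteq> \<zero>" "inv (a [^] n) \<in> carrier K" "inv (a [^] n) \<noteq> \<zero>"
      using a nonzero_pow inv_closed inv_nonzero by auto
    have y: "y \<in> carrier K" "y \<noteq> \<zero>" unfolding y_def using z an nonzero_mult by auto
    have u: "u y = u z - int n * u a" if u: "normalized_valuation K u" for u
      unfolding y_def using val_mult[OF u z(1,2) an(3,4)] val_inv[OF u an(1,2)] val_pow[OF u a(1,2)] by simp
    have "w y = 0" using u[OF w] a(3) z(3) by (simp add: n_def)
    then have "0 \<le> v y" "0 \<le> v (inv y)" using nn[OF y] nn[of "inv y"] val_inv[OF w y] inv_closed[OF y] inv_nonzero[OF y] by auto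
    then have "v y = 0" using val_inv[OF v y] by simp
    then show ?thesis using u[OF v] z(3) by (simp add: n_def)
  qed
  have lin': "v z = w z * v a" if z: "z \<in> carrier K" "z \<noteq> \<zero>" for z
  proof (cases "0 \<le> w z")
    case False
    then show ?thesis using lin[of "inv z"] val_inv[OF w z] val_inv[OF v z] inv_closed[OF z] inv_nonzero[OF z] by simp
  qed (use lin z in blast)
  obtain b where b: "b \<in> carrier K" "b \<noteq> \<zero>" "v b = 1" using val_uniformizer[OF v] .
  have "w b * v a = 1" using lin'[OF b(1,2)] b(3) by simp
  moreover have "0 \<le> v a" using nn[OF a(1,2)] a(3) by simp
  ultimately have "v a = 1" using zmult_eq_1_iff[of "w b" "v a"] by auto
  then have "v z = w z" if "z \<in> carrier (mult_of K)" for z using lin' that by simp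
  then show ?thesis using v w unfolding normalized_valuation_def by (intro extensionalityI[of v "carrier (mult_of K)" w]) auto
qed

end

section \<open>The order valuation of a regular local ring\<close>

locale regular_local = ambient_field K for K (structure) +
  fixes R m :: "'a set" and x :: 'a and d :: nat
  assumes fraction: "fraction_field_of K R"
    and dim_pos: "0 < d"
    and regular: "regular_local_ring (K\<lparr>carrier := R\<rparr>) m d"
    and infinite_residue: "infinite (carrier (K\<lparr>carrier := R\<rparr> Quot m))"
    and x_mem: "x \<in> m - m [^]\<^bsub>ideals_set (K\<lparr>carrier := R\<rparr>)\<^esub> (2::nat)"
begin

lemma R_subring: "subring R K" using fraction by (simp add: fraction_field_of_def)

lemma fraction_rep: "z \<in> carrier K \<Longrightarrow> \<exists>a\<in>R. \<exists>b\<in>R - {\<zero>}. z = a \<otimes> inv b"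
  using fraction unfolding fraction_field_of_def by blast

end

sublocale regular_local \<subseteq> A: noetherian_local "K\<lparr>carrier := R\<rparr>" m
  using subring_noetherian_local[OF R_subring] regular by (simp add: regular_local_ring_def)

sublocale regular_local \<subseteq> A: domain "K\<lparr>carrier := R\<rparr>"
  by (rule subring_is_domain[OF R_subring])

context regular_local
begin

abbreviation mp :: "nat \<Rightarrow> 'a set" where "mp n \<equiv> A.mpow m n"

lemma R_carrier: "a \<in> R \<Longrightarrow> a \<in> carrier K" using subring_carrier[OF R_subring] .

lemma R_pow: "b [^]\<^bsub>K\<lparr>carrier := R\<rparr>\<^esub> (n::nat) = b [^] n"
  using nat_pow_consistent[of b n R] by simp

lemma m_R: "a \<in> m \<Longrightarrow> a \<in> R" using A.m_carrier by simp

lemma mp_R: "a \<in> mp n \<Longrightarrow> a \<in> R"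
  using A.ideal_carrier[OF A.mpow_ideal[OF A.m_ideal]] by simp

lemma mp_1: "mp 1 = m" using A.mpow_1[OF A.m_ideal] .

lemma x_facts: "x \<in> m" "x \<notin> mp 2" "x \<in> R" "x \<in> carrier K" "x \<noteq> \<zero>"
proof -
  show x: "x \<in> m" "x \<notin> mp 2" using x_mem by (auto simp: A.mpow_def)
  show "x \<in> R" using m_R x by blast
  then show "x \<in> carrier K" by (rule R_carrier)
  show "x \<noteq> \<zero>" using x(2) A.ideal_zero[OF A.mpow_ideal[OF A.m_ideal, of 2]] by auto
qed

text \<open>The order lemma singles out one generator. It is \<open>y\<close> here and need not be
  the \<open>x\<close> of the chart, which has not been extended to a system of generators.\<close>

lemma ex_generators:
  obtains y ys where "m = Idl\<^bsub>K\<lparr>carrier := R\<rparr>\<^esub> (insert y (set ys))" "insert y (set ys) \<subseteq> m" "Suc (length ys) = d"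
proof -
  obtain G where G: "G \<subseteq> R" "finite G" "card G = d" "m = Idl\<^bsub>K\<lparr>carrier := R\<rparr>\<^esub> G"
    using regular by (auto simp: regular_local_ring_def)
  obtain xs where xs: "set xs = G" "distinct xs" using finite_distinct_list[OF G(2)] by blast
  have "length xs = d" using distinct_card[OF xs(2)] xs(1) G(3) by simp
  then obtain y ys where ys: "xs = y # ys" using dim_pos by (cases xs) auto
  have "G \<subseteq> m" unfolding G(4) using A.genideal_self[of G] G(1) by simp
  then show ?thesis using that[of y ys] xs ys G(4) \<open>length xs = d\<close> by auto
qed

text \<open>A finite supremum of natural numbers is attained; if it were not, all lengths would be
  at most d - 1, which is below d because d is positive.\<close>

lemma ex_chain: "\<exists>C. prime_chain (K\<lparr>carrier := R\<rparr>) C d"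
proof (rule ccontr)
  let ?S = "{enat n | n. \<exists>P. prime_chain (K\<lparr>carrier := R\<rparr>) P n}"
  assume no: "\<not> ?thesis"
  have sup: "Sup ?S = enat d" using regular by (simp add: regular_local_ring_def krull_dim_def)
  have "s \<le> enat (d - 1)" if s: "s \<in> ?S" for s
  proof -
    obtain n where n: "s = enat n" "\<exists>P. prime_chain (K\<lparr>carrier := R\<rparr>) P n" using s by blast
    have "s \<le> enat d" using Sup_upper[OF s] sup by simp
    moreover have "n \<noteq> d" using n no by auto
    ultimately show ?thesis using n by simp
  qed
  then have "Sup ?S \<le> enat (d - 1)" by (rule Sup_least)
  then show False using sup dim_pos by simp
qed

lemma Idl_empty: "Idl\<^bsub>K\<lparr>carrier := R\<rparr>\<^esub> {} = {\<zero>}"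
  using A.genideal_minimal[OF A.zeroideal, of "{}"] A.ideal_zero[OF A.genideal_ideal[of "{}"]] by auto

lemma in_ord_zero: "z \<in> R \<Longrightarrow> A.in_ord {\<zero>} n z \<longleftrightarrow> z \<in> mp n"
proof -
  assume z: "z \<in> R"
  have "z \<ominus>\<^bsub>K\<lparr>carrier := R\<rparr>\<^esub> h = \<zero> \<longleftrightarrow> z = h" if "h \<in> mp n" for h
    using A.r_right_minus_eq[of z h] z mp_R[OF that] by simp
  then show ?thesis using z unfolding A.in_ord_def by auto
qed

lemma mp_antimono: "n \<le> k \<Longrightarrow> mp k \<subseteq> mp n" using A.mpow_antimono[OF A.m_ideal] .

section \<open>The order function and its extension to a normalized valuation\<close>

definition oR :: "'a \<Rightarrow> nat" where
  "oR a = (THE n. a \<in> mp n \<and> a \<notin> mp (Suc n))"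

lemma oR_eq:
  assumes "a \<in> mp n" "a \<notin> mp (Suc n)" shows "oR a = n"
  unfolding oR_def
proof (rule the_equality)
  show "a \<in> mp n \<and> a \<notin> mp (Suc n)" using assms by simp
  fix k assume k: "a \<in> mp k \<and> a \<notin> mp (Suc k)"
  show "k = n"
  proof (rule ccontr)
    assume "k \<noteq> n"
    then consider "Suc k \<le> n" | "Suc n \<le> k" by linarith
    then show False using mp_antimono[of "Suc k" n] mp_antimono[of "Suc n" k] assms k by cases auto
  qed
qed

lemma oR_spec:
  assumes "a \<in> R" "a \<noteq> \<zero>" shows "a \<in> mp (oR a)" "a \<notin> mp (Suc (oR a))"
proof -
  have "\<exists>n. A.in_ord {\<zero>} n a \<and> \<not> A.in_ord {\<zero>} (Suc n) a" using A.ex_ord[OF A.zeroideal, of a] assms by auto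
  then obtain n where n: "a \<in> mp n" "a \<notin> mp (Suc n)" using in_ord_zero[OF assms(1)] by auto
  then show "a \<in> mp (oR a)" "a \<notin> mp (Suc (oR a))" using oR_eq[OF n] by auto
qed

lemma mem_mp_iff: "a \<in> R \<Longrightarrow> a \<noteq> \<zero> \<Longrightarrow> a \<in> mp n \<longleftrightarrow> n \<le> oR a"
  using oR_spec[of a] mp_antimono[of n "oR a"] mp_antimono[of "Suc (oR a)" n] by (auto simp: not_le[symmetric] Suc_le_eq)

text \<open>The case \<open>B = {}\<close> of \<open>A.order_mult_mod\<close>, where the ideal
  generated by B is zero.\<close>

lemma oR_mult:
  assumes a: "a \<in> R" "a \<noteq> \<zero>" and b: "b \<in> R" "b \<noteq> \<zero>" shows "oR (a \<otimes> b) = oR a + oR b"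
proof (rule oR_eq)
  show "a \<otimes> b \<in> mp (oR a + oR b)" using A.mpow_add_mem[OF A.m_ideal oR_spec(1)[OF a] oR_spec(1)[OF b]] by simp
  obtain y ys where g: "m = Idl\<^bsub>K\<lparr>carrier := R\<rparr>\<^esub> ({} \<union> insert y (set ys))" "{} \<union> insert y (set ys) \<subseteq> m" "length ys < d"
    using ex_generators by (metis Un_empty_left lessI)
  obtain C where C: "prime_chain (K\<lparr>carrier := R\<rparr>) C d" using ex_chain by blast
  have "\<not> A.in_ord {\<zero>} (Suc (oR a + oR b)) (a \<otimes>\<^bsub>K\<lparr>carrier := R\<rparr>\<^esub> b)"
    using A.order_mult_mod[OF infinite_residue C _ _ g(1,2), of "oR a" a "oR b" b] g(3)
      oR_spec[OF a] oR_spec[OF b] a b unfolding Idl_empty by (simp add: in_ord_zero)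
  then show "a \<otimes> b \<notin> mp (Suc (oR a + oR b))" using in_ord_zero[of "a \<otimes> b"] subringE(6)[OF R_subring a(1) b(1)] by simp
qed

lemma oR_add:
  assumes a: "a \<in> R" "a \<noteq> \<zero>" and b: "b \<in> R" "b \<noteq> \<zero>" and ab: "a \<oplus> b \<noteq> \<zero>" shows "min (oR a) (oR b) \<le> oR (a \<oplus> b)"
proof -
  have "a \<in> mp (min (oR a) (oR b))" "b \<in> mp (min (oR a) (oR b))" using a b by (simp_all add: mem_mp_iff)
  then have "a \<oplus> b \<in> mp (min (oR a) (oR b))" using A.ideal_add[OF A.mpow_ideal[OF A.m_ideal]] by simp
  then show ?thesis using mem_mp_iff ab subringE(7)[OF R_subring a(1) b(1)] by simp
qed

lemma ideal_order_eq:
  assumes "I \<subseteq> mp n" "\<not> I \<subseteq> mp (Suc n)" shows "ideal_order (K\<lparr>carrier := R\<rparr>) m I = n"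
  unfolding ideal_order_def A.mpow_def[symmetric]
proof (rule the_equality)
  show "I \<subseteq> mp n \<and> \<not> I \<subseteq> mp (Suc n)" using assms by simp
  fix k assume k: "I \<subseteq> mp k \<and> \<not> I \<subseteq> mp (Suc k)"
  show "k = n"
  proof (rule ccontr)
    assume "k \<noteq> n"
    then consider "Suc k \<le> n" | "Suc n \<le> k" by linarith
    then show False using mp_antimono[of "Suc k" n] mp_antimono[of "Suc n" k] assms k by cases auto
  qed
qed

lemma ideal_order_PIdl:
  assumes a: "a \<in> R" "a \<noteq> \<zero>" shows "ideal_order (K\<lparr>carrier := R\<rparr>) m (PIdl\<^bsub>K\<lparr>carrier := R\<rparr>\<^esub> a) = oR a"
proof (rule ideal_order_eq)
  show "PIdl\<^bsub>K\<lparr>carrier := R\<rparr>\<^esub> a \<subseteq> mp (oR a)"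
    using A.cgenideal_minimal[OF A.mpow_ideal[OF A.m_ideal] oR_spec(1)[OF a]] .
  show "\<not> PIdl\<^bsub>K\<lparr>carrier := R\<rparr>\<^esub> a \<subseteq> mp (Suc (oR a))"
    using A.cgenideal_self[of a] a oR_spec(2)[OF a] by auto
qed

abbreviation v0 :: "'a \<Rightarrow> int" where "v0 \<equiv> order_valuation K R m"
abbreviation V0 :: "'a set" where "V0 \<equiv> valuation_ring K v0"

text \<open>Independence of the representation: cross-multiplying two fractions for the same element
  and using additivity of the order gives equal differences.\<close>

lemma v0_eq:
  assumes a: "a \<in> R" "a \<noteq> \<zero>" and b: "b \<in> R" "b \<noteq> \<zero>"
  shows "v0 (a \<otimes> inv b) = int (oR a) - int (oR b)"
proof -
  have c: "a \<in> carrier K" "b \<in> carrier K" using R_carrier a b by auto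
  have "a \<otimes> inv b \<in> carrier (mult_of K)" using c a b inv_closed inv_nonzero nonzero_mult by auto
  moreover have "(THE n. \<exists>a'\<in>R - {\<zero>}. \<exists>b'\<in>R - {\<zero>}. a \<otimes> inv b = a' \<otimes> inv b' \<and>
      n = int (ideal_order (K\<lparr>carrier := R\<rparr>) m (PIdl\<^bsub>K\<lparr>carrier := R\<rparr>\<^esub> a'))
        - int (ideal_order (K\<lparr>carrier := R\<rparr>) m (PIdl\<^bsub>K\<lparr>carrier := R\<rparr>\<^esub> b'))) = int (oR a) - int (oR b)"
  proof (rule the_equality)
    show "\<exists>a'\<in>R - {\<zero>}. \<exists>b'\<in>R - {\<zero>}. a \<otimes> inv b = a' \<otimes> inv b' \<and>
      int (oR a) - int (oR b) = int (ideal_order (K\<lparr>carrier := R\<rparr>) m (PIdl\<^bsub>K\<lparr>carrier := R\<rparr>\<^esub> a'))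
        - int (ideal_order (K\<lparr>carrier := R\<rparr>) m (PIdl\<^bsub>K\<lparr>carrier := R\<rparr>\<^esub> b'))"
      using a b by (intro bexI[of _ a] bexI[of _ b]) (auto simp: ideal_order_PIdl)
    fix n
    assume "\<exists>a'\<in>R - {\<zero>}. \<exists>b'\<in>R - {\<zero>}. a \<otimes> inv b = a' \<otimes> inv b' \<and>
      n = int (ideal_order (K\<lparr>carrier := R\<rparr>) m (PIdl\<^bsub>K\<lparr>carrier := R\<rparr>\<^esub> a'))
        - int (ideal_order (K\<lparr>carrier := R\<rparr>) m (PIdl\<^bsub>K\<lparr>carrier := R\<rparr>\<^esub> b'))"
    then obtain a' b' where ab': "a' \<in> R" "a' \<noteq> \<zero>" "b' \<in> R" "b' \<noteq> \<zero>" "a \<otimes> inv b = a' \<otimes> inv b'"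
      and n: "n = int (oR a') - int (oR b')" by (auto simp: ideal_order_PIdl)
    have c': "a' \<in> carrier K" "b' \<in> carrier K" using R_carrier ab' by auto
    have i: "inv b \<in> carrier K" "inv b' \<in> carrier K" using inv_closed c c' b ab' by auto
    have "a \<otimes> b' = (a \<otimes> inv b) \<otimes> (b \<otimes> b')" using c c' i inv_l[OF c(2) b(2)] by (simp add: m_assoc inv_cancel[symmetric] m_assoc[symmetric, of "inv b"])
    also have "\<dots> = (a' \<otimes> b) \<otimes> (inv b' \<otimes> b')" unfolding ab'(5) using c c' i by (simp add: m_ac)
    also have "\<dots> = a' \<otimes> b" using c c' inv_l[OF c'(2) ab'(4)] by simp
    finally have "oR a + oR b' = oR a' + oR b" using oR_mult a b ab' by metis
    then show "n = int (oR a) - int (oR b)" using n by linarith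
  qed
  ultimately show ?thesis unfolding order_valuation_def by simp
qed

lemma v0_R: "a \<in> R \<Longrightarrow> a \<noteq> \<zero> \<Longrightarrow> v0 a = int (oR a)"
proof -
  assume a: "a \<in> R" "a \<noteq> \<zero>"
  have 1: "\<one> \<in> R" "\<one> \<noteq> \<zero>" using subringE(3)[OF R_subring] by auto
  have "oR \<one> = 0" using oR_mult[OF 1 1] by simp
  then show ?thesis using v0_eq[OF a 1] R_carrier[OF a(1)] by simp
qed

lemma mem_mp_v0: "a \<in> R \<Longrightarrow> a \<in> mp n \<longleftrightarrow> a = \<zero> \<or> int n \<le> v0 a"
  using mem_mp_iff[of a n] v0_R[of a] A.ideal_zero[OF A.mpow_ideal[OF A.m_ideal, of n]] by (cases "a = \<zero>") auto

lemma oR_x: "oR x = 1"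
  using oR_eq[of x 1] x_facts mp_1 by (simp add: numeral_2_eq_2)

lemma v0_x: "v0 x = 1" using v0_R x_facts oR_x by simp

lemma nonzero_fraction: "z \<in> carrier K \<Longrightarrow> z \<noteq> \<zero> \<Longrightarrow> \<exists>a\<in>R - {\<zero>}. \<exists>b\<in>R - {\<zero>}. z = a \<otimes> inv b"
proof -
  assume z: "z \<in> carrier K" "z \<noteq> \<zero>"
  obtain a b where ab: "a \<in> R" "b \<in> R - {\<zero>}" "z = a \<otimes> inv b" using fraction_rep[OF z(1)] by blast
  have "a \<noteq> \<zero>" using ab z inv_closed[of b] R_carrier by auto
  then show ?thesis using ab by blast
qed

lemma v0_normalized: "normalized_valuation K v0"
  unfolding normalized_valuation_def
proof (intro conjI ballI impI)
  show "v0 \<in> extensional (carrier (mult_of K))" unfolding order_valuation_def by (rule restrict_extensional)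
  have mult: "v0 (z \<otimes> w) = v0 z + v0 w" if z: "z \<in> carrier K" "z \<noteq> \<zero>" and w: "w \<in> carrier K" "w \<noteq> \<zero>" for z w
  proof -
    obtain a b where ab: "a \<in> R" "a \<noteq> \<zero>" "b \<in> R" "b \<noteq> \<zero>" "z = a \<otimes> inv b" using nonzero_fraction[OF z] by blast
    obtain c e where ce: "c \<in> R" "c \<noteq> \<zero>" "e \<in> R" "e \<noteq> \<zero>" "w = c \<otimes> inv e" using nonzero_fraction[OF w] by blast
    have k: "a \<in> carrier K" "b \<in> carrier K" "c \<in> carrier K" "e \<in> carrier K" using R_carrier ab ce by auto
    have "z \<otimes> w = (a \<otimes> c) \<otimes> inv (b \<otimes> e)"
      unfolding ab(5) ce(5) inv_distrib[OF k(2) ab(4) k(4) ce(4)] using k inv_closed ab ce by (simp add: m_ac)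
    moreover have "a \<otimes> c \<in> R" "b \<otimes> e \<in> R" "a \<otimes> c \<noteq> \<zero>" "b \<otimes> e \<noteq> \<zero>"
      using subringE(6)[OF R_subring] nonzero_mult k ab ce by auto
    ultimately show ?thesis using v0_eq ab ce oR_mult by simp
  qed
  have inv: "v0 (inv z) = - v0 z" if z: "z \<in> carrier K" "z \<noteq> \<zero>" for z
  proof -
    have "v0 \<one> = 0" using mult[of \<one> \<one>] by simp
    then show ?thesis using mult[OF z inv_closed[OF z] inv_nonzero[OF z]] inv_r[OF z] by simp
  qed
  have pow: "v0 (x [^] (n::nat)) = int n" for n
  proof (induction n)
    case 0
    have "v0 \<one> = 0" using mult[of \<one> \<one>] by simp
    then show ?case by simp
  next
    case (Suc n) then show ?case using mult[of "x [^] n" x] x_facts v0_x nonzero_pow[of x n] by simp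
  qed
  show "v0 \<in> epi (mult_of K) integer_group"
  proof -
    have "v0 \<in> hom (mult_of K) integer_group" using mult by (auto intro!: homI)
    moreover have "k \<in> v0 ` carrier (mult_of K)" for k :: int
    proof (cases "0 \<le> k")
      case True
      then have "k = v0 (x [^] nat k)" unfolding pow by simp
      then show ?thesis using x_facts nonzero_pow[of x] by (intro image_eqI[of _ v0 "x [^] nat k"]) auto
    next
      case False
      have xk: "x [^] nat (- k) \<in> carrier K" "x [^] nat (- k) \<noteq> \<zero>" using x_facts nonzero_pow by auto
      have "k = v0 (inv (x [^] nat (- k)))" using inv[OF xk] pow[of "nat (- k)"] False by simp
      then show ?thesis using inv_closed[OF xk] inv_nonzero[OF xk] by (intro image_eqI[of _ v0 "inv (x [^] nat (- k))"]) auto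
    qed
    ultimately show ?thesis unfolding epi_def by auto
  qed
  fix z w assume "z \<in> carrier (mult_of K)" "w \<in> carrier (mult_of K)" and zw: "z \<oplus> w \<noteq> \<zero>"
  then have z: "z \<in> carrier K" "z \<noteq> \<zero>" and w: "w \<in> carrier K" "w \<noteq> \<zero>" by auto
  obtain a b where ab: "a \<in> R" "a \<noteq> \<zero>" "b \<in> R" "b \<noteq> \<zero>" "z = a \<otimes> inv b" using nonzero_fraction[OF z] by blast
  obtain c e where ce: "c \<in> R" "c \<noteq> \<zero>" "e \<in> R" "e \<noteq> \<zero>" "w = c \<otimes> inv e" using nonzero_fraction[OF w] by blast
  have k: "a \<in> carrier K" "b \<in> carrier K" "c \<in> carrier K" "e \<in> carrier K" using R_carrier ab ce by auto
  define f where "f = b \<otimes> e"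
  have f: "f \<in> carrier K" "f \<noteq> \<zero>" using k nonzero_mult ab ce by (auto simp: f_def)
  have fz: "f \<otimes> z = a \<otimes> e" unfolding f_def ab(5) using k inv_closed[OF k(2) ab(4)] inv_r[OF k(2) ab(4)]
    by (simp add: m_ac inv_cancel' ab(4) m_lcomm[of b])
  have fw: "f \<otimes> w = b \<otimes> c" unfolding f_def ce(5) using k inv_closed[OF k(4) ce(4)] inv_r[OF k(4) ce(4)]
    by (simp add: m_ac inv_cancel' ce(4) m_lcomm[of e])
  have R: "f \<otimes> z \<in> R" "f \<otimes> w \<in> R" unfolding fz fw using subringE(6)[OF R_subring] ab ce by auto
  have fzw: "f \<otimes> (z \<oplus> w) = f \<otimes> z \<oplus> f \<otimes> w" using f z w by (simp add: r_distr)
  have nz: "f \<otimes> z \<noteq> \<zero>" "f \<otimes> w \<noteq> \<zero>" "f \<otimes> z \<oplus> f \<otimes> w \<noteq> \<zero>"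
    using nonzero_mult f z w zw fzw by (metis add.m_closed)+
  have "min (v0 (f \<otimes> z)) (v0 (f \<otimes> w)) \<le> v0 (f \<otimes> (z \<oplus> w))"
    using oR_add[OF R(1) nz(1) R(2) nz(2,3)] v0_R R nz subringE(7)[OF R_subring R] unfolding fzw by simp
  then show "min (v0 z) (v0 w) \<le> v0 (z \<oplus> w)" using mult[OF f z] mult[OF f w] mult[OF f _ zw] z w by simp
qed

lemmas v0_mult = val_mult[OF v0_normalized]
lemmas v0_inv = val_inv[OF v0_normalized]

lemma v0_x_pow: "v0 (x [^] (n::nat)) = int n"
  using val_pow[OF v0_normalized] x_facts v0_x by simp

lemma x_pow: "x [^] (n::nat) \<in> carrier K" "x [^] n \<noteq> \<zero>" "x [^] n \<in> R" "inv (x [^] n) \<in> carrier K" "inv (x [^] n) \<noteq> \<zero>"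
  using x_facts nonzero_pow[of x n] subring_pow[OF R_subring, of x n] inv_closed[of "x [^] n"] inv_nonzero[of "x [^] n"] by auto

lemma R_subset_V0: "R \<subseteq> V0"
  using v0_R R_carrier by (auto simp: valuation_ring_def)

text \<open>An integral a/b is almost integral with some t, so b^j divides t a^j for all j, and
  complete integral closedness modulo the zero ideal gives that b divides a.\<close>

lemma R_normal: "integral_closure K R \<subseteq> R"
proof
  fix z assume z: "z \<in> integral_closure K R"
  then have zc: "z \<in> carrier K" by (simp add: integral_closure_def)
  obtain a b where ab: "a \<in> R" "b \<in> R" "b \<noteq> \<zero>" "z = a \<otimes> inv b" using fraction_rep[OF zc] by blast
  obtain t where t: "t \<in> R" "t \<noteq> \<zero>" "\<And>j::nat. t \<otimes> z [^] j \<in> R"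
    using integral_imp_almost_integral[OF R_subring ab(1-3)] z unfolding ab(4) by blast
  have c: "a \<in> carrier K" "b \<in> carrier K" "t \<in> carrier K" using R_carrier ab t by auto
  have za: "a = z \<otimes> b" unfolding ab(4) using c inv_closed inv_l ab(3) by (simp add: m_assoc)
  obtain y ys where g: "m = Idl\<^bsub>K\<lparr>carrier := R\<rparr>\<^esub> (insert y (set ys))" "insert y (set ys) \<subseteq> m" "Suc (length ys) = d"
    using ex_generators .
  obtain C where C: "prime_chain (K\<lparr>carrier := R\<rparr>) C d" using ex_chain by blast
  have "A.cic (Idl\<^bsub>K\<lparr>carrier := R\<rparr>\<^esub> {})"
    using A.cic_of_generators[OF infinite_residue C, of "{}" "y # ys"] g by simp
  then have cic: "A.cic {\<zero>}" unfolding Idl_empty .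
  have "t \<otimes> a [^] j \<in> A.adj {\<zero>} (b [^] j)" for j :: nat
  proof -
    have "t \<otimes> a [^] j = \<zero> \<oplus> (t \<otimes> z [^] j) \<otimes> b [^] j"
      unfolding za using c zc by (simp add: nat_pow_distrib m_assoc)
    then show ?thesis using A.mem_adj[of "b [^] j" "t \<otimes> a [^] j" "{\<zero>}"] t(3)[of j] subring_pow[OF R_subring ab(2), of j] by auto
  qed
  moreover have "\<And>a b t. a \<in> R \<Longrightarrow> b \<in> R \<Longrightarrow> b \<noteq> \<zero> \<Longrightarrow> t \<in> R \<Longrightarrow> t \<noteq> \<zero> \<Longrightarrow>
      (\<And>j::nat. t \<otimes> a [^] j \<in> A.adj {\<zero>} (b [^] j)) \<Longrightarrow> a \<in> A.adj {\<zero>} b"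
    using cic unfolding A.cic_def R_pow by auto
  ultimately have "a \<in> A.adj {\<zero>} b" using ab(1-3) t(1,2) by blast
  then obtain e where e: "e \<in> R" "a = e \<otimes> b" using A.mem_adj[of b a "{\<zero>}"] ab R_carrier by auto
  have "z = e \<otimes> (b \<otimes> inv b)" unfolding ab(4) e(2) using c R_carrier[OF e(1)] inv_closed ab(3) by (simp add: m_assoc)
  then show "z \<in> R" using inv_r[OF c(2) ab(3)] e(1) R_carrier[OF e(1)] by simp
qed

section \<open>The affine chart of the blow-up of the maximal ideal\<close>

abbreviation S :: "'a set" where "S \<equiv> blowup_chart K R m x"

text \<open>The chart is R[1/x] intersected with the order valuation ring: a fraction a/x^n has
  nonnegative order exactly when a is in m^n, and then it is a sum of products of n factors y/x with
  y in m, with a coefficient in R.\<close>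

lemma S_iff: "z \<in> S \<longleftrightarrow> z \<in> V0 \<and> (\<exists>n::nat. x [^] n \<otimes> z \<in> R)"
proof -
  let ?H = "R \<union> {i \<otimes> inv x | i. i \<in> m}"
  have ix: "inv x \<in> carrier K" "inv x \<noteq> \<zero>" using inv_closed inv_nonzero x_facts by auto
  have H: "?H \<subseteq> carrier K" using R_carrier m_R ix by auto
  have S: "subring S K" unfolding blowup_chart_def by (rule generate_ring_is_subring[OF H])
  let ?T = "{z \<in> V0. \<exists>n::nat. x [^] n \<otimes> z \<in> R}"
  note V0s = valuation_ring_subring[OF v0_normalized]
  have TI: "z \<in> ?T" if "z \<in> V0" "x [^] (n::nat) \<otimes> z \<in> R" for z n using that by blast
  have T: "subring ?T K"
  proof (rule subringI)
    show "?T \<subseteq> carrier K" using subring_carrier[OF V0s] by blast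
    show "\<one> \<in> ?T" using TI[of \<one> 0] subringE(3)[OF V0s] subringE(3)[OF R_subring] by simp
    fix a assume "a \<in> ?T"
    then obtain n where a: "a \<in> V0" "x [^] (n::nat) \<otimes> a \<in> R" by blast
    have ac: "a \<in> carrier K" using subring_carrier[OF V0s a(1)] .
    have "x [^] n \<otimes> (\<ominus> a) = \<ominus> (x [^] n \<otimes> a)" using ac x_pow by (simp add: r_minus)
    then show "\<ominus> a \<in> ?T" using TI[of "\<ominus> a" n] subringE(5)[OF V0s a(1)] subringE(5)[OF R_subring a(2)] by simp
    fix b assume "b \<in> ?T"
    then obtain k where b: "b \<in> V0" "x [^] (k::nat) \<otimes> b \<in> R" by blast
    have bc: "b \<in> carrier K" using subring_carrier[OF V0s b(1)] .
    have "x [^] (n + k) \<otimes> (a \<otimes> b) = (x [^] n \<otimes> a) \<otimes> (x [^] k \<otimes> b)"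
      using ac bc x_facts by (simp add: nat_pow_mult[symmetric] m_ac)
    then show "a \<otimes> b \<in> ?T" using TI[of "a \<otimes> b" "n + k"] subringE(6)[OF V0s a(1) b(1)] subringE(6)[OF R_subring a(2) b(2)] by simp
    have "x [^] (n + k) \<otimes> (a \<oplus> b) = x [^] k \<otimes> (x [^] n \<otimes> a) \<oplus> x [^] n \<otimes> (x [^] k \<otimes> b)"
      using ac bc x_facts by (simp add: nat_pow_mult[symmetric] r_distr m_ac)
    then show "a \<oplus> b \<in> ?T" using TI[of "a \<oplus> b" "n + k"] subringE(7)[OF V0s a(1) b(1)] a(2) b(2) x_pow(3) subringE(6,7)[OF R_subring] by simp
  qed
  have "S \<subseteq> ?T" unfolding blowup_chart_def
  proof (rule generate_ring_min_subring1[OF H T])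
    have "a \<in> ?T" if "a \<in> R" for a using TI[of a 0] that R_subset_V0 R_carrier[OF that] by auto
    moreover have "i \<otimes> inv x \<in> ?T" if i: "i \<in> m" for i
    proof -
      have ic: "i \<in> carrier K" "i \<in> R" using m_R[OF i] R_carrier by auto
      have "x [^] (1::nat) \<otimes> (i \<otimes> inv x) = i" using ic ix x_facts inv_cancel'[of x i] by (simp add: m_comm)
      moreover have "i \<otimes> inv x \<in> V0"
      proof (cases "i = \<zero>")
        case False
        have "1 \<le> v0 i" using mem_mp_v0[OF ic(2), of 1] i mp_1 False by simp
        then show ?thesis using v0_mult[OF ic(1) False ix] v0_inv[of x] x_facts v0_x ic ix by (simp add: valuation_ring_def)
      qed (use ix subringE(2)[OF V0s] in simp)
      ultimately show ?thesis using TI[of "i \<otimes> inv x" 1] ic by simp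
    qed
    ultimately show "?H \<subseteq> ?T" by blast
  qed
  moreover have "?T \<subseteq> S"
  proof
    have low: "a \<otimes> inv (x [^] n) \<in> S" if "a \<in> mp n" for a n
      using that
    proof (induction n arbitrary: a)
      case 0
      then have "a \<in> R" by (simp add: mp_R)
      then show ?case unfolding blowup_chart_def using R_carrier by (auto intro: generate_ring.incl)
    next
      case (Suc n)
      have "mp (Suc n) \<subseteq> {a \<in> carrier K. a \<otimes> inv (x [^] Suc n) \<in> S}"
      proof
        fix a assume "a \<in> mp (Suc n)"
        then show "a \<in> {a \<in> carrier K. a \<otimes> inv (x [^] Suc n) \<in> S}" unfolding A.mpow_Suc
        proof (induction rule: ideal_prod.induct)
          case (prod i j)
          have c: "i \<in> carrier K" "j \<in> carrier K" using mp_R[OF prod(1)] m_R[OF prod(2)] R_carrier by auto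
          have jS: "j \<otimes> inv x \<in> S" unfolding blowup_chart_def using prod(2) by (auto intro: generate_ring.incl)
          have "(i \<otimes> j) \<otimes> inv (x [^] Suc n) = (i \<otimes> inv (x [^] n)) \<otimes> (j \<otimes> inv x)"
            using c x_pow[of n] x_facts ix inv_distrib[of "x [^] n" x] by (simp add: m_ac)
          then show ?case using subringE(6)[OF S Suc.IH[OF prod(1)] jS] c by simp
        next
          case (sum s1 s2)
          then show ?case using x_pow[of "Suc n"] subringE(7)[OF S] by (simp add: l_distr del: nat_pow_Suc)
        qed
      qed
      then show ?case using Suc.prems by blast
    qed
    fix z assume "z \<in> ?T"
    then obtain n where z: "z \<in> V0" "x [^] (n::nat) \<otimes> z \<in> R" by blast
    have zc: "z \<in> carrier K" using subring_carrier[OF V0s z(1)] .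
    have "x [^] n \<otimes> z \<in> mp n"
    proof (cases "z = \<zero>")
      case True then show ?thesis using x_pow A.ideal_zero[OF A.mpow_ideal[OF A.m_ideal, of n]] by simp
    next
      case False
      then show ?thesis using mem_mp_v0[OF z(2), of n] v0_mult[OF x_pow(1,2) zc False, of n] v0_x_pow[of n] z(1) by (simp add: valuation_ring_def)
    qed
    from low[OF this] have "x [^] n \<otimes> z \<otimes> inv (x [^] n) \<in> S" .
    moreover have "x [^] n \<otimes> z \<otimes> inv (x [^] n) = z" using inv_cancel[OF x_pow(1,2) zc] x_pow zc by (simp add: m_comm)
    ultimately show "z \<in> S" by simp
  qed
  ultimately show ?thesis by blast
qed

lemma S_subring: "subring S K"
proof -
  have "R \<union> {i \<otimes> inv x | i. i \<in> m} \<subseteq> carrier K" using R_carrier m_R inv_closed x_facts by auto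
  then show ?thesis unfolding blowup_chart_def by (rule generate_ring_is_subring)
qed

lemma S_carrier: "z \<in> S \<Longrightarrow> z \<in> carrier K" using subring_carrier[OF S_subring] .

lemma R_subset_S: "R \<subseteq> S" unfolding blowup_chart_def by (auto intro: generate_ring.incl)

lemma S_subset_V0: "S \<subseteq> V0" using S_iff by blast

lemma S_v0_nonneg: "z \<in> S \<Longrightarrow> z \<noteq> \<zero> \<Longrightarrow> 0 \<le> v0 z" using S_subset_V0 by (auto simp: valuation_ring_def)

text \<open>Order at least n means divisibility by x^n in S; in particular x generates the center of
  the order valuation on S.\<close>

lemma S_divide:
  assumes z: "z \<in> S" and v: "z = \<zero> \<or> int n \<le> v0 z"
  shows "inv (x [^] n) \<otimes> z \<in> S"
proof -
  have zc: "z \<in> carrier K" using S_carrier[OF z] .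
  obtain k where k: "x [^] (k::nat) \<otimes> z \<in> R" using z S_iff by blast
  have "x [^] (k + n) \<otimes> (inv (x [^] n) \<otimes> z) = x [^] k \<otimes> (x [^] n \<otimes> (inv (x [^] n) \<otimes> z))"
    using x_pow[of n] x_facts zc by (simp add: nat_pow_mult[symmetric] m_assoc)
  also have "\<dots> = x [^] k \<otimes> z" using inv_cancel'[OF x_pow(1,2) zc] by simp
  finally have "x [^] (k + n) \<otimes> (inv (x [^] n) \<otimes> z) \<in> R" using k by simp
  moreover have "inv (x [^] n) \<otimes> z \<in> V0"
  proof (cases "z = \<zero>")
    case True then show ?thesis using x_pow by (simp add: valuation_ring_def)
  next
    case False
    then show ?thesis using v0_mult[OF x_pow(4,5) zc False, of n] v0_inv[OF x_pow(1,2), of n] v0_x_pow[of n] v x_pow(4)[of n] zc by (simp add: valuation_ring_def)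
  qed
  ultimately show ?thesis unfolding S_iff by blast
qed

text \<open>Both rings in the intersection are integrally closed: R[1/x] as a localisation of R, and
  the valuation ring.\<close>

lemma S_normal: "integral_closure K S = S"
proof
  show "S \<subseteq> integral_closure K S" by (rule integral_closure_superset[OF S_subring])
  show "integral_closure K S \<subseteq> S"
  proof
    fix z assume z: "z \<in> integral_closure K S"
    let ?M = "range (\<lambda>n::nat. x [^] n)"
    have "\<exists>s\<in>?M. s \<otimes> z \<in> integral_closure K R"
    proof (rule integral_clear_denominators[OF R_subring S_subring _ _ _ _ z])
      show "?M \<subseteq> R" using x_pow by blast
      show "\<one> \<in> ?M" by (rule range_eqI[of _ _ 0]) simp
      show "s \<otimes> t \<in> ?M" if "s \<in> ?M" "t \<in> ?M" for s t
        using that nat_pow_mult[of x] x_facts by auto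
      show "\<exists>s\<in>?M. s \<otimes> b \<in> R" if "b \<in> S" for b using that S_iff by blast
    qed
    then have "\<exists>n::nat. x [^] n \<otimes> z \<in> R" using R_normal by blast
    moreover have "z \<in> V0"
      using z integral_closure_mono[OF S_subring valuation_ring_subring[OF v0_normalized] S_subset_V0]
        valring_integrally_closed[OF valuation_ring_valring[OF v0_normalized]] by blast
    ultimately show "z \<in> S" using S_iff by blast
  qed
qed

text \<open>Dividing numerator and denominator by x to the order of the denominator keeps both in S
  and turns the denominator into an element of order zero.\<close>

lemma V0_fraction:
  assumes w: "w \<in> V0" shows "\<exists>a\<in>S. \<exists>b\<in>S - nonunits V0. w = a \<otimes> inv b"
proof (cases "w = \<zero>")
  case True
  have "w = \<zero> \<otimes> inv \<one>" using True by simp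
  then show ?thesis using subringE(2,3)[OF S_subring] one_not_nonunit[OF valuation_ring_valring[OF v0_normalized]] by blast
next
  case False
  have wc: "w \<in> carrier K" using w by (simp add: valuation_ring_def)
  obtain a b where ab: "a \<in> R" "a \<noteq> \<zero>" "b \<in> R" "b \<noteq> \<zero>" "w = a \<otimes> inv b" using nonzero_fraction[OF wc False] by blast
  have c: "a \<in> carrier K" "b \<in> carrier K" "inv b \<in> carrier K" using R_carrier ab inv_closed by auto
  define n where "n = oR b"
  define i where "i = inv (x [^] n)"
  have i: "i \<in> carrier K" "i \<noteq> \<zero>" using x_pow by (auto simp: i_def)
  have vb: "v0 b = int n" using v0_R ab by (simp add: n_def)
  have "0 \<le> v0 w" using w False by (simp add: valuation_ring_def)
  then have va: "int n \<le> v0 a" using v0_eq[OF ab(1-4)] v0_R[OF ab(1,2)] v0_R[OF ab(3,4)] vb ab(5) by simp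
  have S: "i \<otimes> a \<in> S" "i \<otimes> b \<in> S" unfolding i_def using S_divide[of a n] S_divide[of b n] R_subset_S ab va vb by auto
  have "v0 (i \<otimes> b) = 0" using v0_mult[OF i c(2) ab(4)] v0_inv[OF x_pow(1,2), of n] v0_x_pow[of n] vb by (simp add: i_def)
  then have u: "i \<otimes> b \<notin> nonunits V0" using nonzero_mult[OF i c(2) ab(4)] by (simp add: valuation_ring_nonunits[OF v0_normalized])
  have "(i \<otimes> a) \<otimes> inv (i \<otimes> b) = (i \<otimes> inv i) \<otimes> (a \<otimes> inv b)"
    unfolding inv_distrib[OF i c(2) ab(4)] using i c inv_closed[OF i] by (simp add: m_ac)
  then have "w = (i \<otimes> a) \<otimes> inv (i \<otimes> b)" using inv_r[OF i] ab(5) c by simp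
  then show ?thesis using S u by blast
qed

text \<open>The chart at x is integrally closed, so no closure has to be taken, and its center has
  height one since the valuation has rank one.\<close>

lemma V0_Rees: "V0 \<in> Rees K R m"
proof -
  note vr = valuation_ring_valring[OF v0_normalized]
  have nu: "nonunits V0 = {a \<in> carrier K. a = \<zero> \<or> 0 < v0 a}" by (rule valuation_ring_nonunits[OF v0_normalized])
  have arch: "archimedean V0"
    using dvr_valring[OF valuation_ring_subring[OF v0_normalized] valuation_ring_dvr[OF v0_normalized]]
      fraction_rep R_subset_V0 by blast
  have xQ: "x \<in> nonunits V0 \<inter> S" using x_facts v0_x R_subset_S by (auto simp: nu)
  have "m \<subseteq> nonunits V0 \<inter> S"
  proof
    fix y assume y: "y \<in> m"
    have yR: "y \<in> R" using m_R[OF y] .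
    have "y = \<zero> \<or> 1 \<le> v0 y" using mem_mp_v0[OF yR, of 1] y mp_1 by simp
    then show "y \<in> nonunits V0 \<inter> S" using R_carrier[OF yR] R_subset_S yR by (auto simp: nu)
  qed
  moreover have "primeideal (nonunits V0 \<inter> S) (K\<lparr>carrier := S\<rparr>)" by (rule center_prime[OF vr S_subring S_subset_V0])
  moreover have "prime_height (K\<lparr>carrier := S\<rparr>) (nonunits V0 \<inter> S) = 1"
    by (rule center_height[OF vr S_subring S_subset_V0 V0_fraction arch xQ x_facts(5)])
  moreover have "V0 = localization_at K S (nonunits V0 \<inter> S)"
    by (rule center_localization[OF vr S_subring S_subset_V0 V0_fraction, symmetric])
  ultimately show ?thesis unfolding Rees_def using valuation_ring_dvr[OF v0_normalized] x_facts(1,5) S_normal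
    by (intro CollectI conjI bexI[of _ x] exI[of _ S] exI[of _ "nonunits V0 \<inter> S"]) auto
qed

end

section \<open>Rees valuation rings and the transform\<close>

locale primary_regular_local = regular_local +
  fixes I :: "'a set"
  assumes primary: "primary_to (K\<lparr>carrier := R\<rparr>) m I"
begin

lemma I_ideal: "ideal I (K\<lparr>carrier := R\<rparr>)" using primary by (simp add: primary_to_def)

lemma I_R: "i \<in> I \<Longrightarrow> i \<in> R" using A.ideal_carrier[OF I_ideal] by simp

lemma I_carrier: "i \<in> I \<Longrightarrow> i \<in> carrier K" using I_R R_carrier by blast

lemma m_pow_I: "y \<in> m \<Longrightarrow> \<exists>n::nat. y [^] n \<in> I"
  using primary unfolding primary_to_def radical_def R_pow by blast

definition r :: nat where "r = ideal_order (K\<lparr>carrier := R\<rparr>) m I"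

text \<open>The order of I is the least order of a nonzero element; a power of x in I shows that
  there is one.\<close>

lemma r_spec: "I \<subseteq> mp r" "\<not> I \<subseteq> mp (Suc r)"
proof -
  obtain N where N: "x [^] (N::nat) \<in> I" using m_pow_I x_facts by blast
  define s where "s = (LEAST n. n \<in> oR ` (I - {\<zero>}))"
  have "oR (x [^] N) \<in> oR ` (I - {\<zero>})" using N x_pow by auto
  then have "s \<in> oR ` (I - {\<zero>})" unfolding s_def by (rule LeastI)
  then obtain i where i: "s = oR i" "i \<in> I - {\<zero>}" by (rule imageE)
  have 1: "I \<subseteq> mp s"
  proof
    fix j assume j: "j \<in> I"
    show "j \<in> mp s"
    proof (cases "j = \<zero>")
      case True then show ?thesis using A.ideal_zero[OF A.mpow_ideal[OF A.m_ideal, of s]] by simp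
    next
      case False
      then have "s \<le> oR j" unfolding s_def using j by (intro Least_le) auto
      then show ?thesis using mem_mp_iff I_R j False by blast
    qed
  qed
  have 2: "\<not> I \<subseteq> mp (Suc s)" using i mem_mp_iff[of i "Suc s"] I_R by auto
  have "r = s" unfolding r_def by (rule ideal_order_eq[OF 1 2])
  then show "I \<subseteq> mp r" "\<not> I \<subseteq> mp (Suc r)" using 1 2 by auto
qed

abbreviation IS :: "'a set" where "IS \<equiv> Idl\<^bsub>K\<lparr>carrier := S\<rparr>\<^esub> I"

interpretation S: domain "K\<lparr>carrier := S\<rparr>" by (rule subring_is_domain[OF S_subring])

lemma I_subset_S: "I \<subseteq> S" using I_R R_subset_S by blast

lemma IS_ideal: "ideal IS (K\<lparr>carrier := S\<rparr>)"
  by (rule S.genideal_ideal) (use I_subset_S in simp)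

lemma I_subset_IS: "I \<subseteq> IS" using S.genideal_self[of I] I_subset_S by simp

lemma IS_S: "z \<in> IS \<Longrightarrow> z \<in> S" using S.ideal_carrier[OF IS_ideal] by simp

lemma mem_S_PIdl: "z \<in> PIdl\<^bsub>K\<lparr>carrier := S\<rparr>\<^esub> a \<longleftrightarrow> (\<exists>s\<in>S. z = s \<otimes> a)"
  by (auto simp: cgenideal_def)

lemma mem_IS_induct:
  assumes z: "z \<in> IS" and J: "ideal J (K\<lparr>carrier := S\<rparr>)" and "I \<subseteq> J" shows "z \<in> J"
  using S.genideal_minimal[OF J] assms by blast

lemma IS_subset_PIdl: "IS \<subseteq> PIdl\<^bsub>K\<lparr>carrier := S\<rparr>\<^esub> (x [^] r)"
proof (rule S.genideal_minimal)
  have xS: "x [^] r \<in> S" using x_pow R_subset_S by blast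
  show "ideal (PIdl\<^bsub>K\<lparr>carrier := S\<rparr>\<^esub> (x [^] r)) (K\<lparr>carrier := S\<rparr>)" using S.cgenideal_ideal xS by simp
  show "I \<subseteq> PIdl\<^bsub>K\<lparr>carrier := S\<rparr>\<^esub> (x [^] r)"
  proof
    fix i assume i: "i \<in> I"
    have "i = \<zero> \<or> int r \<le> v0 i" using mem_mp_v0[OF I_R[OF i], of r] r_spec(1) i by blast
    then have "inv (x [^] r) \<otimes> i \<in> S" using S_divide i I_subset_S by blast
    moreover have "i = (inv (x [^] r) \<otimes> i) \<otimes> x [^] r"
      using inv_cancel'[OF x_pow(1,2) I_carrier[OF i], of r] x_pow(1,4)[of r] I_carrier[OF i]
        m_comm[of "inv (x [^] r) \<otimes> i" "x [^] r"] by simp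
    ultimately show "i \<in> PIdl\<^bsub>K\<lparr>carrier := S\<rparr>\<^esub> (x [^] r)" unfolding mem_S_PIdl by blast
  qed
qed

text \<open>Let b divide all of I in S. It divides a power of x, so x^r / b lies in R[1/x]; and it
  divides an element of I of order at most r, so x^r / b has nonnegative order. Hence x^r / b is in
  S.\<close>

lemma x_pow_r_minimal:
  assumes b: "b \<in> S" and IS: "IS \<subseteq> PIdl\<^bsub>K\<lparr>carrier := S\<rparr>\<^esub> b"
  shows "PIdl\<^bsub>K\<lparr>carrier := S\<rparr>\<^esub> (x [^] r) \<subseteq> PIdl\<^bsub>K\<lparr>carrier := S\<rparr>\<^esub> b"
proof -
  have bc: "b \<in> carrier K" using S_carrier[OF b] .
  obtain N where "x [^] (N::nat) \<in> I" using m_pow_I x_facts by blast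
  then have "x [^] N \<in> PIdl\<^bsub>K\<lparr>carrier := S\<rparr>\<^esub> b" using IS I_subset_IS by blast
  then obtain c where c: "c \<in> S" "x [^] N = c \<otimes> b" unfolding mem_S_PIdl by blast
  have cc: "c \<in> carrier K" using S_carrier[OF c(1)] .
  have b0: "b \<noteq> \<zero>" using c(2) x_pow(2)[of N] cc by auto
  have c0: "c \<noteq> \<zero>" using c(2) x_pow(2)[of N] bc by auto
  obtain i where i: "i \<in> I" "i \<notin> mp (Suc r)" using r_spec(2) by blast
  have i0: "i \<noteq> \<zero>" using i(2) A.ideal_zero[OF A.mpow_ideal[OF A.m_ideal, of "Suc r"]] by auto
  have vi: "v0 i \<le> int r" using mem_mp_v0[OF I_R[OF i(1)], of "Suc r"] i(2) i0 by simp
  obtain e where e: "e \<in> S" "i = e \<otimes> b" using IS I_subset_IS i(1) mem_S_PIdl by blast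
  have ec: "e \<in> carrier K" "e \<noteq> \<zero>" using S_carrier[OF e(1)] e(2) i0 bc by auto
  have vb: "v0 b \<le> int r" using v0_mult[OF ec bc b0] S_v0_nonneg[OF e(1) ec(2)] vi e(2) by simp
  define q where "q = x [^] r \<otimes> inv b"
  have qc: "q \<in> carrier K" "q \<noteq> \<zero>" unfolding q_def using x_pow[of r] inv_closed[OF bc b0] inv_nonzero[OF bc b0] nonzero_mult by auto
  have qb: "x [^] r = q \<otimes> b" unfolding q_def using x_pow(1)[of r] inv_closed[OF bc b0] inv_l[OF bc b0] bc by (simp add: m_assoc)
  have "0 \<le> v0 q" using v0_mult[OF qc bc b0] v0_x_pow[of r] vb unfolding qb[symmetric] by simp
  then have qV: "q \<in> V0" using qc by (simp add: valuation_ring_def)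
  obtain k where k: "x [^] (k::nat) \<otimes> c \<in> R" using c(1) S_iff by blast
  have "x [^] N \<otimes> q = x [^] r \<otimes> c"
    unfolding c(2) q_def using cc bc x_pow(1)[of r] inv_closed[OF bc b0] inv_cancel'[OF bc b0, of "x [^] r \<otimes> c"] by (simp add: m_ac)
  then have "x [^] (k + N) \<otimes> q = x [^] r \<otimes> (x [^] k \<otimes> c)"
    using x_facts qc cc by (simp add: nat_pow_mult[symmetric] m_assoc m_lcomm)
  also have "\<dots> \<in> R" using subringE(6)[OF R_subring x_pow(3) k] .
  finally have "q \<in> S" using qV S_iff by blast
  then have "x [^] r \<in> PIdl\<^bsub>K\<lparr>carrier := S\<rparr>\<^esub> b" using qb mem_S_PIdl by blast
  moreover have "ideal (PIdl\<^bsub>K\<lparr>carrier := S\<rparr>\<^esub> b) (K\<lparr>carrier := S\<rparr>)" using S.cgenideal_ideal b by simp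
  ultimately show ?thesis by (intro S.cgenideal_minimal)
qed

abbreviation I1 :: "'a set" where "I1 \<equiv> ideal_transform K S I"

lemma I1_eq: "I1 = {inv (x [^] r) \<otimes> z | z. z \<in> IS}"
  unfolding ideal_transform_def
proof (rule the_equality)
  have xS: "x [^] r \<in> S" using x_pow R_subset_S by blast
  let ?P = "\<lambda>a. PIdl\<^bsub>K\<lparr>carrier := S\<rparr>\<^esub> a"
  show "\<exists>a\<in>S - {\<zero>}. IS \<subseteq> ?P a \<and> (\<forall>b\<in>S. IS \<subseteq> ?P b \<longrightarrow> ?P a \<subseteq> ?P b) \<and>
    {inv (x [^] r) \<otimes> z | z. z \<in> IS} = {inv a \<otimes> z | z. z \<in> IS}"
    using xS x_pow(2)[of r] IS_subset_PIdl x_pow_r_minimal by (intro bexI[of _ "x [^] r"]) auto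
  fix J assume "\<exists>a\<in>S - {\<zero>}. IS \<subseteq> ?P a \<and> (\<forall>b\<in>S. IS \<subseteq> ?P b \<longrightarrow> ?P a \<subseteq> ?P b) \<and> J = {inv a \<otimes> z | z. z \<in> IS}"
  then obtain a where a: "a \<in> S" "a \<noteq> \<zero>" "IS \<subseteq> ?P a" "\<And>b. b \<in> S \<Longrightarrow> IS \<subseteq> ?P b \<Longrightarrow> ?P a \<subseteq> ?P b"
    and J: "J = {inv a \<otimes> z | z. z \<in> IS}" by blast
  \<comment> \<open>If c = u b, then z / b = (u z) / c. Applied in both directions, it shows that
    the choice of generator does not change the transform.\<close>
  have shift: "{inv b \<otimes> z | z. z \<in> IS} \<subseteq> {inv c \<otimes> z | z. z \<in> IS}"
    if b: "b \<in> S" "b \<noteq> \<zero>" and c: "c \<in> S" "c \<noteq> \<zero>" and sub: "?P c \<subseteq> ?P b" for b c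
  proof -
    have "c \<in> ?P c" using S.cgenideal_self[of c] c by simp
    then obtain u where u: "u \<in> S" "c = u \<otimes> b" using sub mem_S_PIdl by blast
    have k: "b \<in> carrier K" "u \<in> carrier K" "c \<in> carrier K" using S_carrier b u c by auto
    have u0: "u \<noteq> \<zero>" using c(2) u(2) k by auto
    show ?thesis
    proof
      fix y assume "y \<in> {inv b \<otimes> z | z. z \<in> IS}"
      then obtain z where z: "y = inv b \<otimes> z" "z \<in> IS" by blast
      have zc: "z \<in> carrier K" using S_carrier[OF IS_S[OF z(2)]] .
      have "inv c \<otimes> (u \<otimes> z) = inv b \<otimes> (inv u \<otimes> (u \<otimes> z))"
        unfolding u(2) inv_distrib[OF k(2) u0 k(1) b(2)] using inv_closed[OF k(2) u0] inv_closed[OF k(1) b(2)] k zc by (simp add: m_ac)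
      then have "y = inv c \<otimes> (u \<otimes> z)" unfolding z(1) using inv_cancel[OF k(2) u0 zc] by simp
      moreover have "u \<otimes> z \<in> IS" using S.ideal_lmult[OF IS_ideal z(2), of u] u(1) by simp
      ultimately show "y \<in> {inv c \<otimes> z | z. z \<in> IS}" by blast
    qed
  qed
  show "J = {inv (x [^] r) \<otimes> z | z. z \<in> IS}"
    unfolding J using shift[OF a(1,2) xS x_pow(2) x_pow_r_minimal[OF a(1,3)]]
      shift[OF xS x_pow(2) a(1,2) a(4)[OF xS IS_subset_PIdl]] by blast
qed

lemma IS_eq: "IS = {x [^] r \<otimes> z | z. z \<in> I1}"
proof -
  have "x [^] r \<otimes> (inv (x [^] r) \<otimes> z) = z" if "z \<in> IS" for z
    using inv_cancel'[OF x_pow(1,2) S_carrier[OF IS_S[OF that]]] .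
  then show ?thesis unfolding I1_eq by force
qed

lemma I1_S: "z \<in> I1 \<Longrightarrow> z \<in> S"
proof -
  assume "z \<in> I1"
  then obtain y where y: "z = inv (x [^] r) \<otimes> y" "y \<in> IS" unfolding I1_eq by blast
  obtain s where s: "s \<in> S" "y = s \<otimes> x [^] r" using IS_subset_PIdl y(2) mem_S_PIdl by blast
  have "z = s" unfolding y(1) s(2) using inv_cancel[OF x_pow(1,2) S_carrier[OF s(1)], of r] x_pow(1)[of r] S_carrier[OF s(1)] by (simp add: m_comm)
  then show ?thesis using s(1) by simp
qed

lemma I_div_I1: "i \<in> I \<Longrightarrow> inv (x [^] r) \<otimes> i \<in> I1"
  unfolding I1_eq using I_subset_IS by blast

end

locale rees_ring = primary_regular_local +
  fixes W :: "'a set"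
  assumes W_Rees: "W \<in> Rees K R I"
    and W_m: "PIdl\<^bsub>K\<lparr>carrier := W\<rparr>\<^esub> x = Idl\<^bsub>K\<lparr>carrier := W\<rparr>\<^esub> m"
begin

text \<open>If the transform lies in the maximal ideal of \<open>W\<close>, then \<open>W\<close> is a localisation of the
  integral closure of \<open>S[I1/a']\<close> with \<open>a' = a/x\<^sup>r\<close>; otherwise \<open>a'\<close> is a unit of \<open>W\<close>, so that
  \<open>R[I/a]\<close>, and hence its integral closure, lies in the localisation of the normal ring \<open>S\<close> at
  the center of \<open>W\<close>, which must then be generated by \<open>x\<close>.\<close>

lemma Rees_cases: "(I1 \<subseteq> nonunits W \<and> W \<in> Rees K S I1) \<or> (\<not> I1 \<subseteq> nonunits W \<and> W = V0)"
proof -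
  let ?W = "K\<lparr>carrier := W\<rparr>"
  have dvr: "dvr ?W" using W_Rees by (simp add: Rees_def)
  obtain a C Q where a: "a \<in> I" "a \<noteq> \<zero>" and C: "C = integral_closure K (blowup_chart K R I a)"
    and Q: "primeideal Q (K\<lparr>carrier := C\<rparr>)" "I \<subseteq> Q" and WQ: "W = localization_at K C Q"
    using W_Rees by (auto simp: Rees_def)
  have ac: "a \<in> carrier K" "inv a \<in> carrier K" using I_carrier[OF a(1)] inv_closed a by auto
  let ?B = "blowup_chart K R I a"
  have gens: "R \<union> {i \<otimes> inv a | i. i \<in> I} \<subseteq> carrier K" using R_carrier I_carrier ac by auto
  have B: "subring ?B K" unfolding blowup_chart_def by (rule generate_ring_is_subring[OF gens])
  have RB: "R \<subseteq> ?B" and IB: "\<And>i. i \<in> I \<Longrightarrow> i \<otimes> inv a \<in> ?B" unfolding blowup_chart_def by (auto intro: generate_ring.incl)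
  have Cs: "subring C K" unfolding C by (rule integral_closure_subring[OF B])
  have BC: "?B \<subseteq> C" unfolding C by (rule integral_closure_superset[OF B])
  interpret C: domain "K\<lparr>carrier := C\<rparr>" by (rule subring_is_domain[OF Cs])
  note Qp = C.primeideal_D[OF Q(1)]
  have Q0: "\<zero> \<in> Q" using C.ideal_zero[OF Qp(1)] by simp
  have Cc: "c \<in> carrier K" if "c \<in> C" for c using subring_carrier[OF Cs that] .
  have CQ: "s \<in> carrier K" "s \<noteq> \<zero>" "inv s \<in> carrier K" if "s \<in> C - Q" for s using that Cc Q0 inv_closed by auto
  have Wel: "\<exists>c\<in>C. \<exists>s\<in>C - Q. w = c \<otimes> inv s" if "w \<in> W" for w using that unfolding WQ localization_at_def by blast
  have WI: "c \<otimes> inv s \<in> W" if "c \<in> C" "s \<in> C - Q" for c s using that unfolding WQ localization_at_def by blast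
  have Wc: "W \<subseteq> carrier K" using Wel Cc CQ by blast
  have "ring ?W" using dvr unfolding dvr_def principal_domain_def domain_def cring_def by blast
  then have Ws: "subring W K" by (rule ring_incl_imp_subring[OF Wc])
  have oneCQ: "\<one> \<in> C - Q" using subringE(3)[OF Cs] Qp(2) by simp
  have CW: "C \<subseteq> W"
  proof
    fix c assume c: "c \<in> C"
    then show "c \<in> W" using WI[OF c oneCQ] Cc[OF c] by simp
  qed
  have RW: "R \<subseteq> W" using RB BC CW by blast
  have vr: "valring W" and arch: "archimedean W" using dvr_valring[OF Ws dvr] fraction_rep RW by blast+
  have sunit: "s \<notin> nonunits W" if s: "s \<in> C - Q" for s
  proof -
    have "inv s \<in> W" using WI[OF subringE(3)[OF Cs] s] CQ[OF s] by simp
    then show ?thesis using nonunit_iff[OF vr, of s] CW s CQ(2)[OF s] by auto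
  qed
  have QN: "Q \<subseteq> nonunits W"
  proof
    fix q assume q: "q \<in> Q"
    have qC: "q \<in> C" using Qp(3) q by auto
    show "q \<in> nonunits W"
    proof (rule ccontr)
      assume "q \<notin> nonunits W"
      then have u: "q \<noteq> \<zero>" "inv q \<in> W" using nonunit_iff[OF vr] CW qC by auto
      obtain c s where cs: "c \<in> C" "s \<in> C - Q" "inv q = c \<otimes> inv s" using Wel[OF u(2)] by blast
      have "s = (inv q \<otimes> q) \<otimes> s" using inv_l[OF Cc[OF qC] u(1)] CQ(1)[OF cs(2)] by simp
      also have "\<dots> = c \<otimes> q \<otimes> (inv s \<otimes> s)" unfolding cs(3) using Cc qC cs(1) CQ[OF cs(2)] by (simp add: m_ac)
      also have "\<dots> = c \<otimes> q" using inv_l[OF CQ(1,2)[OF cs(2)]] Cc qC cs(1) by simp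
      finally have "s \<in> Q" using C.ideal_lmult[OF Qp(1) q, of c] cs(1) by simp
      then show False using cs(2) by simp
    qed
  qed
  \<comment> \<open>The radical of I is m, and the nonunits of W form a prime that contains
    I.\<close>
  have mN: "m \<subseteq> nonunits W"
  proof
    fix y assume y: "y \<in> m"
    obtain n where "y [^] (n::nat) \<in> I" using m_pow_I[OF y] by blast
    then have "y [^] n \<in> nonunits W" using Q(2) QN by blast
    then show "y \<in> nonunits W" using nonunits_pow[OF vr, of y n] RW m_R[OF y] by blast
  qed
  have xN: "x \<in> nonunits W" using mN x_facts by blast
  interpret W: domain ?W by (rule subring_is_domain[OF Ws])
  \<comment> \<open>Here xW = mW is used; it places R[m/x] inside W.\<close>
  have mx: "y \<otimes> inv x \<in> W" if y: "y \<in> m" for y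
  proof -
    have mW: "m \<subseteq> carrier ?W" using mN nonunits_subset[OF vr] by auto
    have "y \<in> PIdl\<^bsub>?W\<^esub> x" unfolding W_m using W.genideal_self[OF mW] y by blast
    then obtain w where w: "w \<in> W" "y = w \<otimes> x" by (auto simp: cgenideal_def)
    have "y \<otimes> inv x = w" unfolding w(2) using x_facts inv_closed[of x] inv_r[of x] Wc w(1) by (simp add: m_assoc subset_iff)
    then show ?thesis using w(1) by simp
  qed
  have SW: "S \<subseteq> W"
  proof -
    have "R \<union> {i \<otimes> inv x | i. i \<in> m} \<subseteq> W" using RW mx by blast
    then show ?thesis unfolding blowup_chart_def[of K R m x] using generate_ring_min_subring1[OF _ Ws] Wc by blast
  qed
  define xr where "xr = inv (x [^] r)"
  have xr: "xr \<in> carrier K" "xr \<noteq> \<zero>" using x_pow by (auto simp: xr_def)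
  define a' where "a' = xr \<otimes> a"
  have a'I: "a' \<in> I1" unfolding a'_def xr_def using I_div_I1[OF a(1)] .
  have a': "a' \<in> carrier K" "a' \<noteq> \<zero>" "a' \<in> S" "a' \<in> W" "inv a' \<in> carrier K"
    using nonzero_mult[OF xr ac(1) a(2)] I1_S[OF a'I] S_carrier SW inv_closed by (auto simp: a'_def)
  \<comment> \<open>The common factor x^(-r) cancels, so quotients by a in IS agree with quotients
    by a' in the transform.\<close>
  have quot: "(xr \<otimes> z) \<otimes> inv a' = z \<otimes> inv a" if z: "z \<in> carrier K" for z
  proof -
    have "(xr \<otimes> z) \<otimes> inv a' = (xr \<otimes> inv xr) \<otimes> (z \<otimes> inv a)"
      unfolding a'_def inv_distrib[OF xr ac(1) a(2)] using xr ac z inv_closed[OF xr] by (simp add: m_ac)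
    then show ?thesis using inv_r[OF xr] z ac by simp
  qed
  have ISW: "z \<otimes> inv a \<in> W" if z: "z \<in> IS" for z
  proof -
    interpret S: domain "K\<lparr>carrier := S\<rparr>" by (rule subring_is_domain[OF S_subring])
    have "ideal {z \<in> S. z \<otimes> inv a \<in> W} (K\<lparr>carrier := S\<rparr>)"
    proof (rule S.ideal_intro_comm)
      show "\<zero>\<^bsub>K\<lparr>carrier := S\<rparr>\<^esub> \<in> {z \<in> S. z \<otimes> inv a \<in> W}" using subringE(2)[OF S_subring] subringE(2)[OF Ws] ac by simp
      show "p \<oplus>\<^bsub>K\<lparr>carrier := S\<rparr>\<^esub> q \<in> {z \<in> S. z \<otimes> inv a \<in> W}" if "p \<in> {z \<in> S. z \<otimes> inv a \<in> W}" "q \<in> {z \<in> S. z \<otimes> inv a \<in> W}" for p q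
        using that subringE(7)[OF S_subring] subringE(7)[OF Ws] S_carrier ac by (simp add: l_distr)
      show "s \<otimes>\<^bsub>K\<lparr>carrier := S\<rparr>\<^esub> p \<in> {z \<in> S. z \<otimes> inv a \<in> W}" if "p \<in> {z \<in> S. z \<otimes> inv a \<in> W}" "s \<in> carrier (K\<lparr>carrier := S\<rparr>)" for p s
        using that subringE(6)[OF S_subring] subringE(6)[OF Ws, of s "p \<otimes> inv a"] SW S_carrier ac by (auto simp: m_assoc)
    qed auto
    from mem_IS_induct[OF z this] show ?thesis using I_subset_S IB BC CW by blast
  qed
  show ?thesis
  proof (cases "I1 \<subseteq> nonunits W")
    case True
    let ?B' = "blowup_chart K S I1 a'" let ?C' = "integral_closure K ?B'"
    have gens': "S \<union> {i \<otimes> inv a' | i. i \<in> I1} \<subseteq> carrier K" using S_carrier I1_S a' by auto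
    have B': "subring ?B' K" unfolding blowup_chart_def[of K S] by (rule generate_ring_is_subring[OF gens'])
    have SB': "S \<subseteq> ?B'" and IB': "\<And>i. i \<in> I1 \<Longrightarrow> i \<otimes> inv a' \<in> ?B'" unfolding blowup_chart_def[of K S] by (auto intro: generate_ring.incl)
    have B'W: "?B' \<subseteq> W" unfolding blowup_chart_def[of K S]
    proof (rule generate_ring_min_subring1[OF gens' Ws])
      have "i \<otimes> inv a' \<in> W" if i: "i \<in> I1" for i
      proof -
        obtain z where z: "i = xr \<otimes> z" "z \<in> IS" using i unfolding I1_eq xr_def by blast
        show ?thesis unfolding z(1) quot[OF S_carrier[OF IS_S[OF z(2)]]] by (rule ISW[OF z(2)])
      qed
      then show "S \<union> {i \<otimes> inv a' | i. i \<in> I1} \<subseteq> W" using SW by blast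
    qed
    have C's: "subring ?C' K" by (rule integral_closure_subring[OF B'])
    have C'W: "?C' \<subseteq> W" using integral_closure_mono[OF B' Ws B'W] valring_integrally_closed[OF vr] by blast
    have "?B \<subseteq> ?B'" unfolding blowup_chart_def[of K R I]
    proof (rule generate_ring_min_subring1[OF gens B'])
      have "i \<otimes> inv a \<in> ?B'" if i: "i \<in> I" for i
        using IB'[OF I_div_I1[OF i]] quot[OF I_carrier[OF i]] by (simp add: xr_def)
      then show "R \<union> {i \<otimes> inv a | i. i \<in> I} \<subseteq> ?B'" using R_subset_S SB' by blast
    qed
    then have CC': "C \<subseteq> ?C'" unfolding C by (rule integral_closure_mono[OF B B'])
    have frac: "\<exists>c\<in>?C'. \<exists>s\<in>?C' - nonunits W. w = c \<otimes> inv s" if w: "w \<in> W" for w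
    proof -
      obtain c s where "c \<in> C" "s \<in> C - Q" "w = c \<otimes> inv s" using Wel[OF w] by blast
      then show ?thesis using CC' sunit by blast
    qed
    have SC': "S \<subseteq> ?C'" using SB' integral_closure_superset[OF B'] by blast
    have xC': "x \<in> nonunits W \<inter> ?C'" using xN x_facts(3) R_subset_S SC' by blast
    have "I1 \<subseteq> nonunits W \<inter> ?C'" using True I1_S SC' by blast
    moreover have "primeideal (nonunits W \<inter> ?C') (K\<lparr>carrier := ?C'\<rparr>)" by (rule center_prime[OF vr C's C'W])
    moreover have "prime_height (K\<lparr>carrier := ?C'\<rparr>) (nonunits W \<inter> ?C') = 1"
      by (rule center_height[OF vr C's C'W frac arch xC' x_facts(5)])
    moreover have "W = localization_at K ?C' (nonunits W \<inter> ?C')"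
      by (rule center_localization[OF vr C's C'W frac, symmetric])
    ultimately have "W \<in> Rees K S I1" unfolding Rees_def using dvr a'I a'(2)
      by (intro CollectI conjI bexI[of _ a'] exI[of _ ?C'] exI[of _ "nonunits W \<inter> ?C'"]) auto
    then show ?thesis using True by simp
  next
    case False
    then obtain i where i: "i \<in> I1" "i \<notin> nonunits W" by blast
    obtain z where z: "i = xr \<otimes> z" "z \<in> IS" using i(1) unfolding I1_eq xr_def by blast
    have zc: "z \<in> carrier K" using S_carrier[OF IS_S[OF z(2)]] .
    \<comment> \<open>The transform contains a unit i of W, and i/a' lies in W because IW = aW; so
      a' must be a unit too.\<close>
    have a'u: "a' \<notin> nonunits W"
    proof
      assume "a' \<in> nonunits W"
      from nonunits_mult[OF vr this ISW[OF z(2)]] have "(z \<otimes> inv a) \<otimes> a' \<in> nonunits W" .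
      moreover have "(z \<otimes> inv a) \<otimes> a' = (xr \<otimes> z) \<otimes> (inv a \<otimes> a)"
        unfolding a'_def using zc ac xr by (simp add: m_ac)
      ultimately show False using i(2) z(1) inv_l[OF ac(1) a(2)] xr(1) zc by simp
    qed
    let ?M = "S - nonunits W"
    have MM: "s \<otimes> t \<in> ?M" if "s \<in> ?M" "t \<in> ?M" for s t
      using that nonunits_prime[OF vr, of s t] SW subringE(6)[OF S_subring, of s t] by blast
    have oneM: "\<one> \<in> ?M" using one_not_nonunit[OF vr] subringE(3)[OF S_subring] by simp
    \<comment> \<open>The localisation of S at the center of W, described by denominators. It
      contains every j/a with j in I, with a' serving as denominator.\<close>
    let ?E = "{b \<in> carrier K. \<exists>s\<in>?M. s \<otimes> b \<in> S}"
    have E: "subring ?E K"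
    proof (rule subringI)
      have "\<one> \<otimes> \<one> \<in> S" using subringE(3)[OF S_subring] by simp
      then show "\<one> \<in> ?E" using oneM one_closed by blast
      fix b assume "b \<in> ?E"
      then obtain s where b: "b \<in> carrier K" "s \<in> ?M" "s \<otimes> b \<in> S" by blast
      have sc: "s \<in> carrier K" "s \<in> S" using b(2) S_carrier by auto
      have "s \<otimes> (\<ominus> b) = \<ominus> (s \<otimes> b)" using sc b(1) by (simp add: r_minus)
      then have "s \<otimes> (\<ominus> b) \<in> S" using subringE(5)[OF S_subring b(3)] by simp
      then show "\<ominus> b \<in> ?E" using b(2) a_inv_closed[OF b(1)] by blast
      fix c assume "c \<in> ?E"
      then obtain t where c: "c \<in> carrier K" "t \<in> ?M" "t \<otimes> c \<in> S" by blast
      have tc: "t \<in> carrier K" "t \<in> S" using c(2) S_carrier by auto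
      have "(s \<otimes> t) \<otimes> (b \<otimes> c) = (s \<otimes> b) \<otimes> (t \<otimes> c)" using sc tc b(1) c(1) by (simp add: m_ac)
      then have "(s \<otimes> t) \<otimes> (b \<otimes> c) \<in> S" using subringE(6)[OF S_subring b(3) c(3)] by simp
      then show "b \<otimes> c \<in> ?E" using MM[OF b(2) c(2)] b(1) c(1) by blast
      have "(s \<otimes> t) \<otimes> (b \<oplus> c) = t \<otimes> (s \<otimes> b) \<oplus> s \<otimes> (t \<otimes> c)" using sc tc b(1) c(1) by (simp add: r_distr m_ac)
      then have "(s \<otimes> t) \<otimes> (b \<oplus> c) \<in> S" using subringE(6,7)[OF S_subring] b(3) c(3) sc(2) tc(2) by simp
      then show "b \<oplus> c \<in> ?E" using MM[OF b(2) c(2)] b(1) c(1) by blast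
    qed blast
    have BE: "?B \<subseteq> ?E" unfolding blowup_chart_def[of K R I]
    proof (rule generate_ring_min_subring1[OF gens E])
      have "b \<in> ?E" if "b \<in> R" for b
      proof -
        have "\<one> \<otimes> b \<in> S" using that R_subset_S R_carrier by auto
        then show ?thesis using oneM R_carrier[OF that] by blast
      qed
      moreover have "j \<otimes> inv a \<in> ?E" if j: "j \<in> I" for j
      proof -
        have jc: "j \<in> carrier K" using I_carrier[OF j] .
        have "a' \<otimes> (j \<otimes> inv a) = xr \<otimes> (j \<otimes> (a \<otimes> inv a))" unfolding a'_def using jc ac xr by (simp add: m_ac)
        then have "a' \<otimes> (j \<otimes> inv a) \<in> S" using inv_r[OF ac(1) a(2)] jc I1_S[OF I_div_I1[OF j]] by (simp add: xr_def)
        then show ?thesis using a'(3) a'u jc ac by blast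
      qed
      ultimately show "R \<union> {i \<otimes> inv a | i. i \<in> I} \<subseteq> ?E" by blast
    qed
    \<comment> \<open>Normality of S passes to its localisation, so the integral closure of R[I/a]
      also lies there.\<close>
    have CE: "\<exists>s\<in>?M. s \<otimes> c \<in> S" if c: "c \<in> C" for c
    proof -
      have "\<exists>s\<in>?M. s \<otimes> c \<in> integral_closure K S"
        by (rule integral_clear_denominators[OF S_subring B _ oneM MM _ c[unfolded C]]) (use BE in blast)+
      then show ?thesis unfolding S_normal .
    qed
    have frac: "\<exists>p\<in>S. \<exists>q\<in>?M. w = p \<otimes> inv q" if w: "w \<in> W" for w
    proof -
      obtain c t where ct: "c \<in> C" "t \<in> C - Q" "w = c \<otimes> inv t" using Wel[OF w] by blast
      obtain s1 where s1: "s1 \<in> ?M" "s1 \<otimes> c \<in> S" using CE[OF ct(1)] by blast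
      obtain s2 where s2: "s2 \<in> ?M" "s2 \<otimes> t \<in> S" using CE ct(2) by blast
      have k: "c \<in> carrier K" "t \<in> carrier K" "t \<noteq> \<zero>" "inv t \<in> carrier K" "s1 \<in> carrier K" "s2 \<in> carrier K"
        using Cc[OF ct(1)] CQ[OF ct(2)] s1 s2 S_carrier by auto
      have nz: "s1 \<noteq> \<zero>" "s2 \<noteq> \<zero>" using s1 s2 zero_nonunit[OF vr] by auto
      have st: "s2 \<otimes> t \<in> ?M" using s2 nonunits_prime[OF vr, of s2 t] SW CW ct(2) sunit[OF ct(2)] by blast
      define u where "u = s1 \<otimes> s2"
      have u: "u \<in> carrier K" "u \<noteq> \<zero>" using k nz nonzero_mult by (auto simp: u_def)
      have "(s2 \<otimes> (s1 \<otimes> c)) \<otimes> inv (s1 \<otimes> (s2 \<otimes> t)) = (u \<otimes> c) \<otimes> inv (u \<otimes> t)"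
        unfolding u_def using k by (simp add: m_ac)
      also have "\<dots> = (u \<otimes> inv u) \<otimes> (c \<otimes> inv t)"
        unfolding inv_distrib[OF u k(2,3)] using u k inv_closed[OF u] by (simp add: m_ac)
      finally have "w = (s2 \<otimes> (s1 \<otimes> c)) \<otimes> inv (s1 \<otimes> (s2 \<otimes> t))" unfolding ct(3) using inv_r[OF u] k by simp
      moreover have "s2 \<otimes> (s1 \<otimes> c) \<in> S" using subringE(6)[OF S_subring _ s1(2)] s2(1) by blast
      ultimately show ?thesis using MM[OF s1(1) st] by blast
    qed
    \<comment> \<open>An element of S of positive order is divisible by x in S, hence in W, where x
      is a nonunit. Units of W in S therefore have order zero.\<close>
    have vM: "v0 q = 0" if q: "q \<in> ?M" for q
    proof (rule ccontr)
      have q0: "q \<noteq> \<zero>" using q zero_nonunit[OF vr] by auto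
      assume "v0 q \<noteq> 0"
      then have "int 1 \<le> v0 q" using S_v0_nonneg[of q] q q0 by simp
      then have "inv (x [^] (1::nat)) \<otimes> q \<in> S" using S_divide[of q 1] q by blast
      then have "inv x \<otimes> q \<in> W" using SW x_facts by auto
      from nonunits_mult[OF vr xN this] have "(inv x \<otimes> q) \<otimes> x \<in> nonunits W" .
      moreover have "(inv x \<otimes> q) \<otimes> x = q" using x_facts inv_closed[of x] inv_cancel[of x q] q S_carrier[of q] by (simp add: m_ac)
      ultimately show False using q by simp
    qed
    \<comment> \<open>Conversely, a power of a nonunit z of W is divisible by x in W; writing the
      quotient as p/q with q of order zero gives k v0(z) >= 1. With \<open>vM\<close>, W and the
      order valuation ring have the same center on S, and both are localisations of S there.\<close>
    have vN: "0 < v0 z" if z: "z \<in> S" "z \<in> nonunits W" "z \<noteq> \<zero>" for z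
    proof -
      obtain k where k: "z [^] (k::nat) \<otimes> inv x \<in> W" using arch z(2) RW x_facts(3,5) unfolding archimedean_def by blast
      obtain p q where pq: "p \<in> S" "q \<in> ?M" "z [^] k \<otimes> inv x = p \<otimes> inv q" using frac[OF k] by blast
      have zc: "z \<in> carrier K" "z [^] k \<in> carrier K" "z [^] k \<noteq> \<zero>" using S_carrier[OF z(1)] nonzero_pow z(3) by auto
      have ix: "inv x \<in> carrier K" "inv x \<noteq> \<zero>" using x_facts inv_closed inv_nonzero by auto
      have qc: "q \<in> carrier K" "q \<noteq> \<zero>" "p \<in> carrier K" using pq S_carrier zero_nonunit[OF vr] by auto
      have iq: "inv q \<in> carrier K" "inv q \<noteq> \<zero>" using inv_closed[OF qc(1,2)] inv_nonzero[OF qc(1,2)] by auto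
      have "p \<otimes> inv q \<noteq> \<zero>" unfolding pq(3)[symmetric] using nonzero_mult[OF zc(2,3) ix] .
      then have p0: "p \<noteq> \<zero>" using iq by auto
      have "int k * v0 z - 1 = v0 p"
        using v0_mult[OF zc(2,3) ix] v0_mult[OF qc(3) p0 iq] v0_inv[OF qc(1,2)] v0_inv[OF x_facts(4,5)] v0_x vM[OF pq(2)]
          val_pow[OF v0_normalized zc(1) z(3), of k] pq(3) by simp
      then have "0 < int k * v0 z" using S_v0_nonneg[OF pq(1) p0] by simp
      then show ?thesis using S_v0_nonneg[OF z(1,3)] by (cases "v0 z = 0") auto
    qed
    have "W = V0"
    proof
      show "W \<subseteq> V0"
      proof
        fix w assume "w \<in> W"
        then obtain p q where pq: "p \<in> S" "q \<in> ?M" "w = p \<otimes> inv q" using frac by blast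
        have qc: "q \<in> carrier K" "q \<noteq> \<zero>" "p \<in> carrier K" using pq S_carrier zero_nonunit[OF vr] by auto
        have iq: "inv q \<in> carrier K" "inv q \<noteq> \<zero>" using inv_closed[OF qc(1,2)] inv_nonzero[OF qc(1,2)] by auto
        show "w \<in> V0"
        proof (cases "p = \<zero>")
          case True then show ?thesis using pq(3) iq by (simp add: valuation_ring_def)
        next
          case False
          then show ?thesis using v0_mult[OF qc(3) False iq] v0_inv[OF qc(1,2)] vM[OF pq(2)] S_v0_nonneg[OF pq(1) False] qc iq
            unfolding pq(3) by (simp add: valuation_ring_def)
        qed
      qed
      show "V0 \<subseteq> W"
      proof
        fix w assume "w \<in> V0"
        then obtain p q where pq: "p \<in> S" "q \<in> S" "q \<notin> nonunits V0" "w = p \<otimes> inv q" using V0_fraction by blast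
        have q: "q \<noteq> \<zero>" "\<not> 0 < v0 q" using pq(2,3) S_carrier by (auto simp: valuation_ring_nonunits[OF v0_normalized])
        then have "q \<notin> nonunits W" using vN[OF pq(2)] by blast
        then have "inv q \<in> W" using nonunit_iff[OF vr] SW pq(2) by blast
        then show "w \<in> W" unfolding pq(4) using subringE(6)[OF Ws] SW pq(1) by blast
      qed
    qed
    then show ?thesis using False by simp
  qed
qed

lemma one_not_mem_nonunits: "\<one> \<notin> nonunits W"
proof -
  have "principal_domain (K\<lparr>carrier := W\<rparr>)" using W_Rees by (simp add: Rees_def dvr_def)
  then interpret W: principal_domain "K\<lparr>carrier := W\<rparr>" .
  have "\<one> \<in> W" using W.one_closed by simp
  moreover have "inv \<one> = \<one>" by simp
  ultimately show ?thesis by (simp add: nonunits_def)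
qed

end

theorem proposition4p3:
  fixes K :: "('a, 'b) ring_scheme" (structure)
    and R m I S1 I1 V :: "'a set" and x :: 'a and v :: "'a \<Rightarrow> int" and d r :: nat
  assumes "fraction_field_of K R"
    and "0 < d"
    and "regular_local_ring (K\<lparr>carrier := R\<rparr>) m d"
    and "infinite (carrier (K\<lparr>carrier := R\<rparr> Quot m))"
    and "primary_to (K\<lparr>carrier := R\<rparr>) m I"
    and "x \<in> m - m [^]\<^bsub>ideals_set (K\<lparr>carrier := R\<rparr>)\<^esub> (2::nat)"
    and "\<And>W. W \<in> Rees K R I \<Longrightarrow>
           PIdl\<^bsub>K\<lparr>carrier := W\<rparr>\<^esub> x = Idl\<^bsub>K\<lparr>carrier := W\<rparr>\<^esub> m"
    and "S1 = blowup_chart K R m x"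
    and "r = ideal_order (K\<lparr>carrier := R\<rparr>) m I"
    and "I1 = ideal_transform K S1 I"
    and "V \<in> Rees K R I"
    and "normalized_valuation K v" and "valuation_ring K v = V"
  shows "Idl\<^bsub>K\<lparr>carrier := S1\<rparr>\<^esub> I = {x [^] r \<otimes> z | z. z \<in> I1} \<and>
    (I1 = S1 \<longrightarrow>
       v = order_valuation K R m \<and> Rees_valuations K R I = {order_valuation K R m}) \<and>
    (I1 \<noteq> S1 \<and> v \<noteq> order_valuation K R m \<longrightarrow> V \<in> Rees K S1 I1) \<and>
    Rees K R I \<subseteq> Rees K S1 I1 \<union> Rees K R m"
proof -
  have "field K" using assms(1) by (simp add: fraction_field_of_def)
  then interpret P: primary_regular_local K R m x d I
    using assms by (simp add: primary_regular_local_def regular_local_def ambient_field_def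
        regular_local_axioms_def primary_regular_local_axioms_def)
  let ?v0 = "order_valuation K R m"
  \<comment> \<open>Everything follows from this dichotomy for each W separately; for I1 = S1 the
    first alternative fails, since it would make 1 a nonunit of W.\<close>
  have cases: "(I1 \<subseteq> P.nonunits W \<and> W \<in> Rees K S1 I1) \<or> (\<not> I1 \<subseteq> P.nonunits W \<and> W = valuation_ring K ?v0)"
    and one: "\<one> \<notin> P.nonunits W" if W: "W \<in> Rees K R I" for W
  proof -
    interpret rees_ring K R m x d I W
      by (unfold_locales) (use W assms(7) in auto)
    show "(I1 \<subseteq> P.nonunits W \<and> W \<in> Rees K S1 I1) \<or> (\<not> I1 \<subseteq> P.nonunits W \<and> W = valuation_ring K ?v0)"
      using Rees_cases assms(8,10) by simp
    show "\<one> \<notin> P.nonunits W" by (rule one_not_mem_nonunits)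
  qed
  have uniq: "w = ?v0" if "normalized_valuation K w" "valuation_ring K w = valuation_ring K ?v0" for w
    using P.valuation_unique[OF that(1) P.v0_normalized that(2)] .
  have 1: "Idl\<^bsub>K\<lparr>carrier := S1\<rparr>\<^esub> I = {x [^] r \<otimes> z | z. z \<in> I1}"
    using P.IS_eq assms(8-10) by (simp add: P.r_def)
  have 2: "v = ?v0 \<and> Rees_valuations K R I = {?v0}" if "I1 = S1"
  proof -
    have eq: "W = valuation_ring K ?v0" if W: "W \<in> Rees K R I" for W
      using cases[OF W] one[OF W] subringE(3)[OF P.S_subring] \<open>I1 = S1\<close> assms(8) by blast
    have "Rees_valuations K R I = {?v0}"
    proof
      show "Rees_valuations K R I \<subseteq> {?v0}"
      proof
        fix w assume "w \<in> Rees_valuations K R I"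
        then have w: "normalized_valuation K w" "valuation_ring K w \<in> Rees K R I" by (simp_all add: Rees_valuations_def)
        show "w \<in> {?v0}" using uniq[OF w(1) eq[OF w(2)]] by simp
      qed
      \<comment> \<open>The given V shows that the set of Rees valuation rings is not empty, so the
        order valuation really occurs in it.\<close>
      have "valuation_ring K ?v0 \<in> Rees K R I" unfolding eq[OF assms(11), symmetric] by (rule assms(11))
      then show "{?v0} \<subseteq> Rees_valuations K R I" using P.v0_normalized by (simp add: Rees_valuations_def)
    qed
    moreover have "v = ?v0" using uniq[OF assms(12)] eq[OF assms(11)] unfolding assms(13) .
    ultimately show ?thesis by simp
  qed
  have 3: "V \<in> Rees K S1 I1" if "v \<noteq> ?v0"
    using cases[OF assms(11)] uniq[OF assms(12)] assms(13) that by blast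
  have 4: "Rees K R I \<subseteq> Rees K S1 I1 \<union> Rees K R m"
    using cases P.V0_Rees by blast
  show ?thesis using 1 2 3 4 by blast
qed

end
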